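(* Let $G$ be a finite-dimensional Lie group with Lie algebra $\mathfrak g$, let $L:TG\to\mathbb R$ be a smooth Lagrangian, and let $\ell:G\times\mathfrak g\to\mathbb R$, $\ell(g,\xi)=L(g,g\xi)$, be its left-trivialization. Let $g:[a,b]\to G$ be a smooth curve. Then the following are equivalent. 1. (Hamilton's principle) $\delta\int_a^b L(g,\dot g)\,dt=0$ for arbitrary variations of $g(t)$ with the endpoints $g(a)$ and $g(b)$ fixed. 2. With $\xi=g^{-1}\dot g$, one has $\delta\int_a^b \ell(g,\xi)\,dt=0$ for all variations of the form $\delta g=g\eta$, $\delta\xi=\dot\eta+\operatorname{ad}_\xi\eta$, where $\eta:[a,b]\to\mathfrak g$ is an arbitrary smooth curve with $\eta(a)=\eta(b)=0$. 3. (Hamilton-Pontryagin principle) There are smooth $v(t)\in T_{g(t)}G$ and $p(t)\in T^*_{g(t)}G$ such that the curve $(g,v,p):[a,b]\to TG\oplus T^*G$ satisfies $$\delta\int_a^b\big[L(g,v)+\langle p,\dot g-v\rangle\big]\,dt=0,$$ where $(g(t),v(t),p(t))\in TG\oplus T^*G$ are varied arbitrarily and independently with the endpoints $g(a)$ and $g(b)$ fixed. 4. (Left-trivialized Hamilton-Pontryagin principle) There are smooth $\xi(t)\in\mathfrak g$ and $\mu(t)\in\mathfrak g^*$ such that the curve $(g,\xi,\mu):[a,b]\to G\times\mathfrak g\times\mathfrak g^*$ satisfies $$\delta\int_a^b\big[\ell(g,\xi)+\langle\mu,g^{-1}\dot g-\xi\rangle\big]\,dt=0,$$ where $(g(t),\xi(t),\mu(t))$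 are varied arbitrarily and independently with the endpoints $g(a)$ and $g(b)$ fixed.
   Context: Left translation by $g\in G$ is $L_g(h)=gh$; concatenation denotes its lifted action: for $\xi\in\mathfrak g=T_eG$, $g\xi=T_eL_g\,\xi\in T_gG$, and for $w\in T_gG$, $g^{-1}w=T_gL_{g^{-1}}w\in\mathfrak g$. $TG\oplus T^*G$ is the Whitney sum (Pontryagin bundle), whose points are triples $(g,v,p)$ with $v\in T_gG$, $p\in T_g^*G$. $\langle\cdot,\cdot\rangle$ is the natural pairing of a vector space with its dual. $\operatorname{ad}_\xi\eta=[\xi,\eta]$. All curves are $C^\infty$. "$\delta\int(\dots)=0$ for a class of variations" means that for every smooth one-parameter family of curves (parameter $\epsilon$) passing through the given curve at $\epsilon=0$ and belonging to that class, the $\epsilon$-derivative at $\epsilon=0$ of the integral vanishes; in (2) it means that the derivative of the integral in each direction $(\delta g,\delta\xi)$ of the stated form vanishes. *)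

theory Defs
  imports "HOL-Analysis.Analysis" "HOL-Algebra.Group"
begin

section \<open>Smooth maps between normed spaces\<close>

text \<open>
  Derivatives are taken within \<open>S\<close>, so that at boundary points of a set such as
  \<open>{a..b}\<close> or \<open>{-r<..<r} \<times> {a..b}\<close> they are one-sided.  They are unique on the sets to which
  the notion is applied below, namely relatively open subsets of convex sets with nonempty
  interior.  The higher derivatives are directional, which gives the usual \<open>C\<^sup>k\<close> maps because all
  domains below are finite-dimensional.
\<close>

primrec Ck_on :: "nat \<Rightarrow> 'a set \<Rightarrow> ('a::real_normed_vector \<Rightarrow> 'b::real_normed_vector) \<Rightarrow> bool" where
  "Ck_on 0 S f \<longleftrightarrow> continuous_on S f"
| "Ck_on (Suc k) S f \<longleftrightarrow>
     (\<exists>f'. (\<forall>x\<in>S. (f has_derivative f' x) (at x within S)) \<and> (\<forall>v. Ck_on k S (\<lambda>x. f' x v)))"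

definition smooth_on :: "'a set \<Rightarrow> ('a::real_normed_vector \<Rightarrow> 'b::real_normed_vector) \<Rightarrow> bool" where
  "smooth_on S f \<longleftrightarrow> (\<forall>k. Ck_on k S f)"


section \<open>Smooth manifolds\<close>

text \<open>
  A chart is its domain together with the coordinate map; the values of the coordinate map
  outside the domain are irrelevant.
\<close>

type_synonym ('m, 'e) chart = "'m set \<times> ('m \<Rightarrow> 'e)"

abbreviation chart_dom :: "('m, 'e) chart \<Rightarrow> 'm set" where
  "chart_dom \<equiv> fst"

abbreviation chart_map :: "('m, 'e) chart \<Rightarrow> 'm \<Rightarrow> 'e" where
  "chart_map \<equiv> snd"

definition chart_inv :: "('m, 'e) chart \<Rightarrow> 'e \<Rightarrow> 'm" where
  "chart_inv c = inv_into (chart_dom c) (chart_map c)"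

definition manifold_topology ::
    "'m set \<Rightarrow> ('m, 'e::real_normed_vector) chart set \<Rightarrow> 'm topology" where
  "manifold_topology M A =
     topology (\<lambda>W. W \<subseteq> M \<and> (\<forall>c\<in>A. open (chart_map c ` (W \<inter> chart_dom c))))"

text \<open>
  The model space is an arbitrary finite-dimensional real normed space.  The class
  \<open>euclidean_space\<close> is avoided since it would exclude manifolds of dimension zero.
\<close>

locale smooth_manifold =
  fixes M :: "'m set" and A :: "('m, 'e::real_normed_vector) chart set"
  assumes finite_dimensional: "\<exists>B::'e set. finite B \<and> span B = UNIV"
    and chart_dom_subset: "c \<in> A \<Longrightarrow> chart_dom c \<subseteq> M"
    and charts_cover: "M \<subseteq> (\<Union>c\<in>A. chart_dom c)"
    and chart_inj: "c \<in> A \<Longrightarrow> inj_on (chart_map c) (chart_dom c)"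
    and chart_overlap_open: "c \<in> A \<Longrightarrow> d \<in> A \<Longrightarrow> open (chart_map c ` (chart_dom c \<inter> chart_dom d))"
    and transition_smooth: "c \<in> A \<Longrightarrow> d \<in> A \<Longrightarrow>
      smooth_on (chart_map c ` (chart_dom c \<inter> chart_dom d)) (chart_map d \<circ> chart_inv c)"
    and Hausdorff: "Hausdorff_space (manifold_topology M A)"
    and second_countable: "second_countable (manifold_topology M A)"

lemma openin_manifold_topology:
  assumes inj: "\<And>c. c \<in> A \<Longrightarrow> inj_on (chart_map c) (chart_dom c)"
  shows "openin (manifold_topology M A) W \<longleftrightarrow>
    W \<subseteq> M \<and> (\<forall>c\<in>A. open (chart_map c ` (W \<inter> chart_dom c)))"
proof -
  have int: "open (chart_map c ` (S \<inter> T \<inter> chart_dom c))"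
    if "c \<in> A" "open (chart_map c ` (S \<inter> chart_dom c))" "open (chart_map c ` (T \<inter> chart_dom c))"
    for c S T
  proof -
    have "chart_map c ` (S \<inter> T \<inter> chart_dom c) =
        chart_map c ` (S \<inter> chart_dom c) \<inter> chart_map c ` (T \<inter> chart_dom c)"
      using inj[OF that(1)] by (auto simp: inj_on_def)
    with that show ?thesis by auto
  qed
  have un: "open (chart_map c ` (\<Union>K \<inter> chart_dom c))"
    if "\<forall>S\<in>K. open (chart_map c ` (S \<inter> chart_dom c))" for c K
  proof -
    have "chart_map c ` (\<Union>K \<inter> chart_dom c) = (\<Union>S\<in>K. chart_map c ` (S \<inter> chart_dom c))"
      by blast
    with that show ?thesis by auto
  qed
  have "istopology (\<lambda>W. W \<subseteq> M \<and> (\<forall>c\<in>A. open (chart_map c ` (W \<inter> chart_dom c))))"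
    unfolding istopology_def
  proof (rule conjI; intro allI impI conjI ballI)
    show "S \<inter> T \<subseteq> M" if "S \<subseteq> M \<and> P" for S T P
      using that by blast
    show "\<Union>K \<subseteq> M" if "\<forall>S\<in>K. S \<subseteq> M \<and> P S" for K P
      using that by blast
  qed (rule int un; simp)+
  then show ?thesis
    by (simp add: manifold_topology_def topology_inverse')
qed

definition prod_atlas ::
    "('m, 'e) chart set \<Rightarrow> ('n, 'f) chart set \<Rightarrow> ('m \<times> 'n, 'e \<times> 'f) chart set" where
  "prod_atlas A B =
     {(chart_dom c \<times> chart_dom d, map_prod (chart_map c) (chart_map d)) | c d. c \<in> A \<and> d \<in> B}"

definition std_atlas :: "('e, 'e) chart set" where
  "std_atlas = {(UNIV, \<lambda>x. x)}"

definition smooth_map ::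
    "'m set \<Rightarrow> ('m, 'e::real_normed_vector) chart set \<Rightarrow>
     'n set \<Rightarrow> ('n, 'f::real_normed_vector) chart set \<Rightarrow> ('m \<Rightarrow> 'n) \<Rightarrow> bool" where
  "smooth_map M A N B F \<longleftrightarrow>
     F \<in> M \<rightarrow> N \<and>
     continuous_map (manifold_topology M A) (manifold_topology N B) F \<and>
     (\<forall>c\<in>A. \<forall>d\<in>B. smooth_on (chart_map c ` (chart_dom c \<inter> F -` chart_dom d))
        (chart_map d \<circ> F \<circ> chart_inv c))"

text \<open>
  Smooth maps from a subset \<open>S\<close> of a normed space (an interval or a strip, possibly with boundary)
  into a manifold.
\<close>

definition smooth_into ::
    "'a::real_normed_vector set \<Rightarrow> 'n set \<Rightarrow> ('n, 'f::real_normed_vector) chart set \<Rightarrow>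
     ('a \<Rightarrow> 'n) \<Rightarrow> bool" where
  "smooth_into S N B F \<longleftrightarrow>
     F \<in> S \<rightarrow> N \<and>
     continuous_map (top_of_set S) (manifold_topology N B) F \<and>
     (\<forall>d\<in>B. smooth_on (S \<inter> F -` chart_dom d) (chart_map d \<circ> F))"


section \<open>Tangent vectors\<close>

text \<open>
  A tangent vector at \<open>x\<close> is the family of its coordinate representations in all charts around \<open>x\<close>,
  any two of which are related by the derivative of the transition map.  The family is set to zero
  on everything else, so that the vector space operations of the tangent space are pointwise.
\<close>

type_synonym ('m, 'e) tvec = "('m, 'e) chart \<Rightarrow> 'e"

definition tangent_space ::
    "('m, 'e::real_normed_vector) chart set \<Rightarrow> 'm \<Rightarrow> ('m, 'e) tvec set" where
  "tangent_space A x =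
     {w. (\<forall>c\<in>A. \<forall>d\<in>A. x \<in> chart_dom c \<longrightarrow> x \<in> chart_dom d \<longrightarrow>
            w d = frechet_derivative (chart_map d \<circ> chart_inv c) (at (chart_map c x)) (w c)) \<and>
         (\<forall>c. \<not> (c \<in> A \<and> x \<in> chart_dom c) \<longrightarrow> w c = 0)}"

definition tvec_add :: "('m, 'e::real_normed_vector) tvec \<Rightarrow> ('m, 'e) tvec \<Rightarrow> ('m, 'e) tvec" where
  "tvec_add v w = (\<lambda>c. v c + w c)"

definition tvec_diff :: "('m, 'e::real_normed_vector) tvec \<Rightarrow> ('m, 'e) tvec \<Rightarrow> ('m, 'e) tvec" where
  "tvec_diff v w = (\<lambda>c. v c - w c)"

definition tvec_scale :: "real \<Rightarrow> ('m, 'e::real_normed_vector) tvec \<Rightarrow> ('m, 'e) tvec" where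
  "tvec_scale r v = (\<lambda>c. r *\<^sub>R v c)"

definition tvec_zero :: "('m, 'e::real_normed_vector) tvec" where
  "tvec_zero = (\<lambda>c. 0)"

text \<open>The tangent vector at \<open>x\<close> that is represented by \<open>u\<close> in the chart \<open>c\<close>.\<close>

definition tvec_of ::
    "('m, 'e::real_normed_vector) chart set \<Rightarrow> ('m, 'e) chart \<Rightarrow> 'm \<Rightarrow> 'e \<Rightarrow> ('m, 'e) tvec" where
  "tvec_of A c x u = (\<lambda>d. if d \<in> A \<and> x \<in> chart_dom d
     then frechet_derivative (chart_map d \<circ> chart_inv c) (at (chart_map c x)) u else 0)"

text \<open>
  The tangent map at \<open>x\<close>.  By the chain rule it does not depend on the chosen chart \<open>c\<close> around \<open>x\<close>.
\<close>

definition tangent_map ::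
    "('m, 'e::real_normed_vector) chart set \<Rightarrow> ('n, 'f::real_normed_vector) chart set \<Rightarrow>
     ('m \<Rightarrow> 'n) \<Rightarrow> 'm \<Rightarrow> ('m, 'e) tvec \<Rightarrow> ('n, 'f) tvec" where
  "tangent_map A B F x w =
     (let c = (SOME c. c \<in> A \<and> x \<in> chart_dom c) in
      (\<lambda>d. if d \<in> B \<and> F x \<in> chart_dom d
          then frechet_derivative (chart_map d \<circ> F \<circ> chart_inv c) (at (chart_map c x)) (w c)
          else 0))"

definition velocity ::
    "('m, 'e::real_normed_vector) chart set \<Rightarrow> real set \<Rightarrow> (real \<Rightarrow> 'm) \<Rightarrow> real \<Rightarrow> ('m, 'e) tvec" where
  "velocity A I g t = (\<lambda>d. if d \<in> A \<and> g t \<in> chart_dom d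
     then vector_derivative (chart_map d \<circ> g) (at t within I) else 0)"

text \<open>Derivative of a curve that stays in a single fixed tangent space.\<close>

definition tvec_deriv ::
    "real set \<Rightarrow> (real \<Rightarrow> ('m, 'e::real_normed_vector) tvec) \<Rightarrow> real \<Rightarrow> ('m, 'e) tvec" where
  "tvec_deriv I w t = (\<lambda>d. vector_derivative (\<lambda>s. w s d) (at t within I))"

definition cotangent_space ::
    "('m, 'e::real_normed_vector) chart set \<Rightarrow> 'm \<Rightarrow> (('m, 'e) tvec \<Rightarrow> real) set" where
  "cotangent_space A x =
     {p. (\<forall>v\<in>tangent_space A x. \<forall>w\<in>tangent_space A x. p (tvec_add v w) = p v + p w) \<and>
         (\<forall>r. \<forall>v\<in>tangent_space A x. p (tvec_scale r v) = r * p v) \<and>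
         (\<forall>v. v \<notin> tangent_space A x \<longrightarrow> p v = 0)}"

text \<open>Coordinates of a covector at \<open>x\<close> in the chart \<open>c\<close>, as a linear form on the model space.\<close>

definition covec_coord ::
    "('m, 'e::real_normed_vector) chart set \<Rightarrow> ('m, 'e) chart \<Rightarrow> 'm \<Rightarrow>
     (('m, 'e) tvec \<Rightarrow> real) \<Rightarrow> ('e \<Rightarrow>\<^sub>L real)" where
  "covec_coord A c x p = Blinfun (\<lambda>u. p (tvec_of A c x u))"


section \<open>Tangent and Pontryagin bundles\<close>

definition tangent_bundle ::
    "'m set \<Rightarrow> ('m, 'e::real_normed_vector) chart set \<Rightarrow> ('m \<times> ('m, 'e) tvec) set" where
  "tangent_bundle M A = {(x, v). x \<in> M \<and> v \<in> tangent_space A x}"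

definition tangent_bundle_atlas ::
    "('m, 'e::real_normed_vector) chart set \<Rightarrow> ('m \<times> ('m, 'e) tvec, 'e \<times> 'e) chart set" where
  "tangent_bundle_atlas A =
     {(tangent_bundle (chart_dom c) A, \<lambda>(x, v). (chart_map c x, v c)) | c. c \<in> A}"

definition pontryagin_bundle ::
    "'m set \<Rightarrow> ('m, 'e::real_normed_vector) chart set \<Rightarrow>
     ('m \<times> ('m, 'e) tvec \<times> (('m, 'e) tvec \<Rightarrow> real)) set" where
  "pontryagin_bundle M A =
     {(x, v, p). x \<in> M \<and> v \<in> tangent_space A x \<and> p \<in> cotangent_space A x}"

definition pontryagin_bundle_atlas ::
    "('m, 'e::real_normed_vector) chart set \<Rightarrow>
     ('m \<times> ('m, 'e) tvec \<times> (('m, 'e) tvec \<Rightarrow> real), 'e \<times> 'e \<times> ('e \<Rightarrow>\<^sub>L real)) chart set" where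
  "pontryagin_bundle_atlas A =
     {(pontryagin_bundle (chart_dom c) A,
       \<lambda>(x, v, p). (chart_map c x, v c, covec_coord A c x p)) | c. c \<in> A}"

text \<open>
  The standard smooth structures of the finite-dimensional vector spaces \<open>T\<^sub>xM\<close> and \<open>T\<^sub>x\<^sup>*M\<close>,
  given by the linear coordinates that the charts around \<open>x\<close> induce.
\<close>

definition tangent_space_atlas ::
    "('m, 'e::real_normed_vector) chart set \<Rightarrow> 'm \<Rightarrow> (('m, 'e) tvec, 'e) chart set" where
  "tangent_space_atlas A x = {(tangent_space A x, \<lambda>v. v c) | c. c \<in> A \<and> x \<in> chart_dom c}"

definition cotangent_space_atlas ::
    "('m, 'e::real_normed_vector) chart set \<Rightarrow> 'm \<Rightarrow>
     (('m, 'e) tvec \<Rightarrow> real, 'e \<Rightarrow>\<^sub>L real) chart set" where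
  "cotangent_space_atlas A x =
     {(cotangent_space A x, covec_coord A c x) | c. c \<in> A \<and> x \<in> chart_dom c}"

text \<open>
  The Lie bracket of vector fields, \<open>[X, Y]f = X(Yf) - Y(Xf)\<close>; in coordinates \<open>DY X - DX Y\<close>.
\<close>

definition vf_bracket ::
    "('m, 'e::real_normed_vector) chart set \<Rightarrow> ('m \<Rightarrow> ('m, 'e) tvec) \<Rightarrow> ('m \<Rightarrow> ('m, 'e) tvec) \<Rightarrow>
     'm \<Rightarrow> ('m, 'e) tvec" where
  "vf_bracket A X Y x = (\<lambda>d. if d \<in> A \<and> x \<in> chart_dom d
     then frechet_derivative (\<lambda>u. Y (chart_inv d u) d) (at (chart_map d x)) (X x d)
        - frechet_derivative (\<lambda>u. X (chart_inv d u) d) (at (chart_map d x)) (Y x d)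
     else 0)"


section \<open>Lie groups\<close>

locale lie_group = group G + smooth_manifold "carrier G" A
  for G :: "('g, 'k) monoid_scheme" (structure) and A :: "('g, 'e::real_normed_vector) chart set" +
  assumes mult_smooth:
      "smooth_map (carrier G \<times> carrier G) (prod_atlas A A) (carrier G) A (\<lambda>(x, y). x \<otimes> y)"
    and inv_smooth: "smooth_map (carrier G) A (carrier G) A (\<lambda>x. inv x)"

definition lie_algebra ::
    "('g, 'k) monoid_scheme \<Rightarrow> ('g, 'e::real_normed_vector) chart set \<Rightarrow> ('g, 'e) tvec set" where
  "lie_algebra G A = tangent_space A \<one>\<^bsub>G\<^esub>"

definition lie_algebra_dual ::
    "('g, 'k) monoid_scheme \<Rightarrow> ('g, 'e::real_normed_vector) chart set \<Rightarrow>
     (('g, 'e) tvec \<Rightarrow> real) set" where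
  "lie_algebra_dual G A = cotangent_space A \<one>\<^bsub>G\<^esub>"

abbreviation lie_algebra_atlas ::
    "('g, 'k) monoid_scheme \<Rightarrow> ('g, 'e::real_normed_vector) chart set \<Rightarrow>
     (('g, 'e) tvec, 'e) chart set" where
  "lie_algebra_atlas G A \<equiv> tangent_space_atlas A \<one>\<^bsub>G\<^esub>"

abbreviation lie_algebra_dual_atlas ::
    "('g, 'k) monoid_scheme \<Rightarrow> ('g, 'e::real_normed_vector) chart set \<Rightarrow>
     (('g, 'e) tvec \<Rightarrow> real, 'e \<Rightarrow>\<^sub>L real) chart set" where
  "lie_algebra_dual_atlas G A \<equiv> cotangent_space_atlas A \<one>\<^bsub>G\<^esub>"

text \<open>\<open>g \<xi> = T\<^sub>eL\<^sub>g \<xi>\<close>\<close>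

definition left_act ::
    "('g, 'k) monoid_scheme \<Rightarrow> ('g, 'e::real_normed_vector) chart set \<Rightarrow> 'g \<Rightarrow>
     ('g, 'e) tvec \<Rightarrow> ('g, 'e) tvec" where
  "left_act G A g \<xi> = tangent_map A A (\<lambda>h. g \<otimes>\<^bsub>G\<^esub> h) \<one>\<^bsub>G\<^esub> \<xi>"

text \<open>\<open>g\<^sup>-\<^sup>1 w = T\<^sub>gL w\<close> for \<open>w \<in> T\<^sub>gG\<close>, where \<open>L\<close> is left translation by \<open>g\<^sup>-\<^sup>1\<close>\<close>

definition left_triv ::
    "('g, 'k) monoid_scheme \<Rightarrow> ('g, 'e::real_normed_vector) chart set \<Rightarrow> 'g \<Rightarrow>
     ('g, 'e) tvec \<Rightarrow> ('g, 'e) tvec" where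
  "left_triv G A g w = tangent_map A A (\<lambda>h. inv\<^bsub>G\<^esub> g \<otimes>\<^bsub>G\<^esub> h) g w"

text \<open>
  \<open>ad\<^sub>\<xi> \<eta> = [\<xi>, \<eta>]\<close>, the value at the identity of the bracket of the left-invariant vector fields
  \<open>g \<mapsto> g \<xi>\<close> and \<open>g \<mapsto> g \<eta>\<close>.
\<close>

definition lie_ad ::
    "('g, 'k) monoid_scheme \<Rightarrow> ('g, 'e::real_normed_vector) chart set \<Rightarrow>
     ('g, 'e) tvec \<Rightarrow> ('g, 'e) tvec \<Rightarrow> ('g, 'e) tvec" where
  "lie_ad G A \<xi> \<eta> =
     vf_bracket A (\<lambda>g. left_act G A g \<xi>) (\<lambda>g. left_act G A g \<eta>) \<one>\<^bsub>G\<^esub>"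

definition left_trivialization ::
    "('g, 'k) monoid_scheme \<Rightarrow> ('g, 'e::real_normed_vector) chart set \<Rightarrow>
     ('g \<times> ('g, 'e) tvec \<Rightarrow> real) \<Rightarrow> 'g \<times> ('g, 'e) tvec \<Rightarrow> real" where
  "left_trivialization G A L = (\<lambda>(g, \<xi>). L (g, left_act G A g \<xi>))"


section \<open>Variational principles\<close>

text \<open>
  A one-parameter family of curves is a map \<open>\<Gamma>\<close> on a strip \<open>{-r<..<r} \<times> {a..b}\<close> with \<open>r > 0\<close>, jointly
  smooth in the parameter \<open>\<epsilon>\<close> (first component) and the time \<open>t\<close> (second component).
\<close>

definition family_through ::
    "real \<Rightarrow> real \<Rightarrow> 'n set \<Rightarrow> ('n, 'f::real_normed_vector) chart set \<Rightarrow> (real \<Rightarrow> 'n) \<Rightarrow>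
     real \<Rightarrow> (real \<times> real \<Rightarrow> 'n) \<Rightarrow> bool" where
  "family_through a b N B \<gamma> r \<Gamma> \<longleftrightarrow>
     0 < r \<and> smooth_into ({-r<..<r} \<times> {a..b}) N B \<Gamma> \<and> (\<forall>t\<in>{a..b}. \<Gamma> (0, t) = \<gamma> t)"

text \<open>\<open>\<pi>\<close> extracts the base point in \<open>G\<close>.\<close>

definition fixed_endpoints ::
    "real \<Rightarrow> real \<Rightarrow> ('n \<Rightarrow> 'g) \<Rightarrow> (real \<Rightarrow> 'g) \<Rightarrow> real \<Rightarrow> (real \<times> real \<Rightarrow> 'n) \<Rightarrow> bool" where
  "fixed_endpoints a b \<pi> g r \<Gamma> \<longleftrightarrow>
     (\<forall>\<epsilon>\<in>{-r<..<r}. \<pi> (\<Gamma> (\<epsilon>, a)) = g a \<and> \<pi> (\<Gamma> (\<epsilon>, b)) = g b)"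

definition hamilton_principle ::
    "('g, 'k) monoid_scheme \<Rightarrow> ('g, 'e::real_normed_vector) chart set \<Rightarrow>
     ('g \<times> ('g, 'e) tvec \<Rightarrow> real) \<Rightarrow> real \<Rightarrow> real \<Rightarrow> (real \<Rightarrow> 'g) \<Rightarrow> bool" where
  "hamilton_principle G A L a b g \<longleftrightarrow>
     (\<forall>r \<Gamma>. family_through a b (carrier G) A g r \<Gamma> \<longrightarrow>
            fixed_endpoints a b (\<lambda>x. x) g r \<Gamma> \<longrightarrow>
        ((\<lambda>\<epsilon>. integral {a..b} (\<lambda>t. L (\<Gamma> (\<epsilon>, t), velocity A {a..b} (\<lambda>s. \<Gamma> (\<epsilon>, s)) t)))
           has_real_derivative 0) (at 0))"

text \<open>
  The derivative of the integral in the direction \<open>(\<delta>g, \<delta>\<xi>)\<close> is its derivative along any family of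
  curves in \<open>G \<times> \<gg>\<close> through \<open>(g, g\<^sup>-\<^sup>1 g')\<close> whose velocity at \<open>\<epsilon> = 0\<close> is \<open>(\<delta>g, \<delta>\<xi>)\<close>.
\<close>

definition trivialized_hamilton_principle ::
    "('g, 'k) monoid_scheme \<Rightarrow> ('g, 'e::real_normed_vector) chart set \<Rightarrow>
     ('g \<times> ('g, 'e) tvec \<Rightarrow> real) \<Rightarrow> real \<Rightarrow> real \<Rightarrow> (real \<Rightarrow> 'g) \<Rightarrow> bool" where
  "trivialized_hamilton_principle G A l a b g \<longleftrightarrow>
     (let \<xi> = (\<lambda>t. left_triv G A (g t) (velocity A {a..b} g t)) in
      \<forall>\<eta>. smooth_into {a..b} (lie_algebra G A) (lie_algebra_atlas G A) \<eta> \<longrightarrow>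
          \<eta> a = tvec_zero \<longrightarrow> \<eta> b = tvec_zero \<longrightarrow>
        (\<forall>r \<Gamma>. family_through a b (carrier G \<times> lie_algebra G A)
                 (prod_atlas A (lie_algebra_atlas G A)) (\<lambda>t. (g t, \<xi> t)) r \<Gamma> \<longrightarrow>
               (\<forall>t\<in>{a..b}.
                  velocity A {-r<..<r} (\<lambda>\<epsilon>. fst (\<Gamma> (\<epsilon>, t))) 0 = left_act G A (g t) (\<eta> t) \<and>
                  tvec_deriv {-r<..<r} (\<lambda>\<epsilon>. snd (\<Gamma> (\<epsilon>, t))) 0 =
                    tvec_add (tvec_deriv {a..b} \<eta> t) (lie_ad G A (\<xi> t) (\<eta> t))) \<longrightarrow>
           ((\<lambda>\<epsilon>. integral {a..b} (\<lambda>t. l (\<Gamma> (\<epsilon>, t)))) has_real_derivative 0) (at 0)))"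

definition hamilton_pontryagin_principle ::
    "('g, 'k) monoid_scheme \<Rightarrow> ('g, 'e::real_normed_vector) chart set \<Rightarrow>
     ('g \<times> ('g, 'e) tvec \<Rightarrow> real) \<Rightarrow> real \<Rightarrow> real \<Rightarrow> (real \<Rightarrow> 'g) \<Rightarrow>
     (real \<Rightarrow> ('g, 'e) tvec) \<Rightarrow> (real \<Rightarrow> ('g, 'e) tvec \<Rightarrow> real) \<Rightarrow> bool" where
  "hamilton_pontryagin_principle G A L a b g v p \<longleftrightarrow>
     (\<forall>r \<Gamma>. family_through a b (pontryagin_bundle (carrier G) A) (pontryagin_bundle_atlas A)
               (\<lambda>t. (g t, v t, p t)) r \<Gamma> \<longrightarrow>
            fixed_endpoints a b fst g r \<Gamma> \<longrightarrow>
        ((\<lambda>\<epsilon>. integral {a..b} (\<lambda>t. case \<Gamma> (\<epsilon>, t) of (h, w, q) \<Rightarrow>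
             L (h, w) + q (tvec_diff (velocity A {a..b} (\<lambda>s. fst (\<Gamma> (\<epsilon>, s))) t) w)))
           has_real_derivative 0) (at 0))"

definition trivialized_hamilton_pontryagin_principle ::
    "('g, 'k) monoid_scheme \<Rightarrow> ('g, 'e::real_normed_vector) chart set \<Rightarrow>
     ('g \<times> ('g, 'e) tvec \<Rightarrow> real) \<Rightarrow> real \<Rightarrow> real \<Rightarrow> (real \<Rightarrow> 'g) \<Rightarrow>
     (real \<Rightarrow> ('g, 'e) tvec) \<Rightarrow> (real \<Rightarrow> ('g, 'e) tvec \<Rightarrow> real) \<Rightarrow> bool" where
  "trivialized_hamilton_pontryagin_principle G A l a b g \<xi> \<mu> \<longleftrightarrow>
     (\<forall>r \<Gamma>. family_through a b (carrier G \<times> lie_algebra G A \<times> lie_algebra_dual G A)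
               (prod_atlas A (prod_atlas (lie_algebra_atlas G A) (lie_algebra_dual_atlas G A)))
               (\<lambda>t. (g t, \<xi> t, \<mu> t)) r \<Gamma> \<longrightarrow>
            fixed_endpoints a b fst g r \<Gamma> \<longrightarrow>
        ((\<lambda>\<epsilon>. integral {a..b} (\<lambda>t. case \<Gamma> (\<epsilon>, t) of (h, \<zeta>, \<nu>) \<Rightarrow>
             l (h, \<zeta>) + \<nu> (tvec_diff
                (left_triv G A h (velocity A {a..b} (\<lambda>s. fst (\<Gamma> (\<epsilon>, s))) t)) \<zeta>)))
           has_real_derivative 0) (at 0))"

end

theory Submission
  imports Defs
begin

text \<open>
  No Euler-Lagrange equations are needed: the principles are compared directly.
  A family of curves \<open>\<Gamma>\<close> in \<open>G\<close> gives the family \<open>(\<Gamma>, \<zeta>)\<close> with \<open>\<zeta> = \<Gamma>\<^sup>-\<^sup>1 \<partial>\<^sub>t\<Gamma>\<close> in \<open>G \<times> \<gg>\<close>, and with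
  \<open>\<eta> = \<Gamma>\<^sup>-\<^sup>1 \<partial>\<^sub>\<epsilon>\<Gamma>\<close> equality of mixed partial derivatives yields the structure equation
  \<open>\<partial>\<^sub>\<epsilon>\<zeta> = \<partial>\<^sub>t\<eta> + [\<zeta>, \<eta>]\<close>.  Conversely \<open>\<eta>\<close> is realised by \<open>g(t) \<sigma>(\<epsilon> \<eta>(t))\<close> with \<open>\<sigma>\<close> the inverse of a chart
  centred at the identity.  As the derivative of an action depends only on the first-order variation,
  (1) and (2) are equivalent.  For (1) implies (4) take \<open>\<xi> = g\<^sup>-\<^sup>1 g'\<close> and \<open>\<mu> = \<partial>\<ell>/\<partial>\<xi>\<close>: then
  \<open>\<ell>(g, \<xi>) + \<langle>\<mu>, g\<^sup>-\<^sup>1 g' - \<xi>\<rangle>\<close> and \<open>\<ell>(g, g\<^sup>-\<^sup>1 g')\<close> agree to first order.  For (4) implies (1),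
  varying \<open>\<mu>\<close> alone gives \<open>\<xi> = g\<^sup>-\<^sup>1 g'\<close>, and on families with \<open>\<xi> = g\<^sup>-\<^sup>1 g'\<close> the action is that of Hamilton.
  Finally (3) and (4) correspond under left trivialization of the Pontryagin bundle.
\<close>

section \<open>Finite-dimensional normed spaces\<close>

text \<open>Two features of the setting shape the proof. The model space is an arbitrary real normed
  space spanned by a finite set, possibly zero, and higher smoothness is tested direction by
  direction. Wherever a linear map is applied to a vector that itself varies, the vector is
  therefore expanded over a finite set \<open>B\<close> with bounded coefficient functionals
  \<open>\<kappa> b\<close>. The same functionals later replace an inner product, in the sum of
  squares that forces \<xi> to be the trivialized velocity. \<open>findim\<close> is a predicate on
  types so that it passes to products and to \<open>real\<close>. Time runs over a closed interval,
  so derivatives must be unique, and mixed partials equal, at its ends too. A third difficulty is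
  that a curve need not stay in one chart. Objects that live at the identity are handled in one
  fixed chart \<open>d\<close> there, while charts around the moving point \<open>g t\<close> are
  chosen separately for each time and enter only pointwise or local statements.\<close>

definition findim :: "'a::real_normed_vector itself \<Rightarrow> bool" where
  "findim _ \<longleftrightarrow> (\<exists>B::'a set. finite B \<and> span B = UNIV)"

text \<open>Applied to differences, the bound makes the coefficients of a convergent sequence
  Cauchy; their limits are coefficients of the limit.\<close>

lemma closed_span_if_coeff_bound:
  fixes B :: "'a::real_normed_vector set"
  assumes fin: "finite B"
    and K: "\<And>c b. b \<in> B \<Longrightarrow> \<bar>c b\<bar> \<le> K * norm (\<Sum>b\<in>B. c b *\<^sub>R b)"
  shows "closed (span B)"
  unfolding closed_sequential_limits
proof (intro allI impI)
  fix x l assume "(\<forall>n. x n \<in> span B) \<and> x \<longlonglongrightarrow> l"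
  then have x: "\<And>n. x n \<in> span B" and l: "x \<longlonglongrightarrow> l" by auto
  from x have "\<forall>n. \<exists>u. x n = (\<Sum>v\<in>B. u v *\<^sub>R v)"
    by (auto simp: span_finite[OF fin])
  then obtain u where u: "\<And>n. x n = (\<Sum>v\<in>B. u n v *\<^sub>R v)" by metis
  have "convergent (\<lambda>n. u n b)" if b: "b \<in> B" for b
  proof -
    have *: "\<bar>u m b - u n b\<bar> \<le> K * norm (x m - x n)" for m n
      using K[OF b, of "\<lambda>b. u m b - u n b"] by (simp add: u scaleR_diff_left sum_subtractf)
    have "Cauchy (\<lambda>n. u n b)"
    proof (rule metric_CauchyI)
      fix e :: real assume e: "e > 0"
      have "Cauchy x" using l LIMSEQ_imp_Cauchy by blast
      then obtain M where M: "\<And>m n. m \<ge> M \<Longrightarrow> n \<ge> M \<Longrightarrow> dist (x m) (x n) < e / (\<bar>K\<bar> + 1)"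
        using metric_CauchyD[of x "e / (\<bar>K\<bar> + 1)"] e by (auto simp: add_nonneg_pos)
      have "dist (u m b) (u n b) < e" if "m \<ge> M" "n \<ge> M" for m n
      proof -
        have "\<bar>u m b - u n b\<bar> \<le> (\<bar>K\<bar> + 1) * norm (x m - x n)"
          using * [of m n] by (smt (verit) mult_right_mono norm_ge_zero)
        also have "\<dots> < e"
          using M[OF that] by (simp add: dist_norm pos_less_divide_eq mult.commute add_nonneg_pos)
        finally show ?thesis by (simp add: dist_real_def)
      qed
      then show "\<exists>M. \<forall>m\<ge>M. \<forall>n\<ge>M. dist (u m b) (u n b) < e" by blast
    qed
    then show ?thesis using Cauchy_convergent by blast
  qed
  then obtain w where w: "\<And>b. b \<in> B \<Longrightarrow> (\<lambda>n. u n b) \<longlonglongrightarrow> w b"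
    unfolding convergent_def by metis
  have "x \<longlonglongrightarrow> (\<Sum>v\<in>B. w v *\<^sub>R v)"
    unfolding u by (intro tendsto_sum tendsto_scaleR w tendsto_const)
  then have "l = (\<Sum>v\<in>B. w v *\<^sub>R v)" using l LIMSEQ_unique by blast
  then show "l \<in> span B" by (auto simp: span_finite[OF fin])
qed

text \<open>Induction on the basis. The span of the old vectors is closed by the induction
  hypothesis, so the new vector \<open>b\<close> has a positive distance \<delta> from it. This
  bounds the coefficient of \<open>b\<close>, and subtracting that term bounds the remaining
  ones.\<close>

lemma coeff_bound:
  fixes B :: "'a::real_normed_vector set"
  assumes "finite B" "independent B"
  shows "\<exists>K. \<forall>c. \<forall>b\<in>B. \<bar>c b\<bar> \<le> K * norm (\<Sum>b\<in>B. c b *\<^sub>R b)"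
  using assms
proof (induction B rule: finite_induct)
  case empty then show ?case by simp
next
  case (insert b B)
  have ind: "independent B" "b \<notin> span B"
    using insert.prems insert.hyps by (simp_all add: independent_insert)
  obtain K where K: "\<And>c b. b \<in> B \<Longrightarrow> \<bar>c b\<bar> \<le> K * norm (\<Sum>b\<in>B. c b *\<^sub>R b)"
    using insert.IH[OF ind(1)] by blast
  have "open (- span B)"
    using closed_span_if_coeff_bound[OF insert.hyps(1) K] by (simp add: open_closed)
  then obtain \<delta> where \<delta>: "\<delta> > 0" "ball b \<delta> \<subseteq> - span B"
    using ind(2) open_contains_ball by blast
  have dist: "\<delta> \<le> norm (b - y)" if "y \<in> span B" for y
    using \<delta>(2) that by (force simp: dist_norm subset_iff)
  show ?case
  proof (intro exI allI ballI)
    fix c b' assume b': "b' \<in> insert b B"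
    define y where "y = (\<Sum>b\<in>B. c b *\<^sub>R b)"
    have xy: "(\<Sum>b\<in>insert b B. c b *\<^sub>R b) = c b *\<^sub>R b + y"
      using insert.hyps by (simp add: y_def)
    have y: "y \<in> span B" unfolding y_def by (intro span_sum span_scale span_base)
    have 1: "\<bar>c b\<bar> * \<delta> \<le> norm (c b *\<^sub>R b + y)"
    proof (cases "c b = 0")
      case False
      \<comment> \<open>Dividing by \<open>c b\<close> leaves \<open>b\<close> minus an element of
        the span, to which the distance bound \<open>dist\<close> applies.\<close>
      have "c b *\<^sub>R b + y = c b *\<^sub>R (b - (- (1 / c b)) *\<^sub>R y)" using False by (simp add: algebra_simps)
      moreover have "\<delta> \<le> norm (b - (- (1 / c b)) *\<^sub>R y)" by (intro dist span_scale y)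
      ultimately show ?thesis by (simp add: mult_left_mono)
    qed simp
    then have 1: "\<bar>c b\<bar> \<le> (1 / \<delta>) * norm (c b *\<^sub>R b + y)"
      using \<delta>(1) by (simp add: field_simps)
    have "norm y \<le> norm (c b *\<^sub>R b + y) + \<bar>c b\<bar> * norm b"
      using norm_triangle_ineq4[of "c b *\<^sub>R b + y" "c b *\<^sub>R b"] by simp
    also have "\<dots> \<le> norm (c b *\<^sub>R b + y) + ((1 / \<delta>) * norm (c b *\<^sub>R b + y)) * norm b"
      using 1 by (intro add_left_mono mult_right_mono) auto
    finally have 2: "norm y \<le> (1 + norm b / \<delta>) * norm (c b *\<^sub>R b + y)"
      by (simp add: algebra_simps)
    \<comment> \<open>The first summand serves the new coefficient, the second the old ones.
      \<open>\<bar>K\<bar>\<close> stands for \<open>K\<close>, whose sign is unknown, so that both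
      summands are nonnegative.\<close>
    show "\<bar>c b'\<bar> \<le> (1 / \<delta> + \<bar>K\<bar> * (1 + norm b / \<delta>)) * norm (\<Sum>b\<in>insert b B. c b *\<^sub>R b)"
    proof (cases "b' = b")
      case True
      have "0 \<le> \<bar>K\<bar> * (1 + norm b / \<delta>) * norm (c b *\<^sub>R b + y)" using \<delta>(1) by simp
      then show ?thesis using 1 True unfolding xy distrib_right by simp
    next
      case False
      then have "\<bar>c b'\<bar> \<le> K * norm y" using K[of b' c] b' by (simp add: y_def)
      also have "\<dots> \<le> \<bar>K\<bar> * norm y" by (intro mult_right_mono) auto
      also have "\<dots> \<le> \<bar>K\<bar> * ((1 + norm b / \<delta>) * norm (c b *\<^sub>R b + y))"
        using 2 by (intro mult_left_mono) auto
      finally have "\<bar>c b'\<bar> \<le> \<bar>K\<bar> * (1 + norm b / \<delta>) * norm (c b *\<^sub>R b + y)" by simp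
      moreover have "0 \<le> (1 / \<delta>) * norm (c b *\<^sub>R b + y)" using \<delta>(1) by simp
      ultimately show ?thesis unfolding xy distrib_right by linarith
    qed
  qed
qed

text \<open>A basis with its dual functionals, the form in which finite dimension is used
  throughout. Boundedness of the functionals is the coefficient bound.\<close>

lemma findim_coords:
  assumes "findim TYPE('a::real_normed_vector)"
  shows "\<exists>(B :: 'a set) (\<kappa> :: 'a \<Rightarrow> 'a \<Rightarrow> real). finite B \<and> (\<forall>b. bounded_linear (\<kappa> b)) \<and>
    (\<forall>x. (\<Sum>b\<in>B. \<kappa> b x *\<^sub>R b) = x)"
proof -
  from assms obtain B0 :: "'a set" where B0: "finite B0" "span B0 = UNIV"
    unfolding findim_def by blast
  obtain B where B: "B \<subseteq> B0" "independent B" "B0 \<subseteq> span B"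
    by (rule maximal_independent_subset)
  have fin: "finite B" using B B0 finite_subset by blast
  have sp: "span B = UNIV" using B B0 by (metis span_mono span_span top.extremum_uniqueI)
  obtain K where K: "\<And>c b. b \<in> B \<Longrightarrow> \<bar>c b\<bar> \<le> K * norm (\<Sum>b\<in>B. c b *\<^sub>R b)"
    using coeff_bound[OF fin B(2)] by blast
  define \<kappa> where "\<kappa> b x = representation B x b" for b x
  have sum: "(\<Sum>b\<in>B. \<kappa> b x *\<^sub>R b) = x" for x
    unfolding \<kappa>_def by (rule sum_representation_eq) (use B fin sp in auto)
  have "bounded_linear (\<kappa> b)" for b
  proof (rule bounded_linear_intro)
    show "\<kappa> b (x + y) = \<kappa> b x + \<kappa> b y" for x y
      unfolding \<kappa>_def by (simp add: representation_add[OF B(2)] sp)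
    show "\<kappa> b (r *\<^sub>R x) = r *\<^sub>R \<kappa> b x" for r x
      unfolding \<kappa>_def by (simp add: representation_scale[OF B(2)] sp)
    show "norm (\<kappa> b x) \<le> norm x * \<bar>K\<bar>" for x
    proof (cases "b \<in> B")
      case True
      then have "\<bar>\<kappa> b x\<bar> \<le> K * norm x" using K[of b "\<lambda>b. \<kappa> b x"] by (simp add: sum)
      also have "\<dots> \<le> norm x * \<bar>K\<bar>" by (metis abs_ge_self mult.commute mult_left_mono norm_ge_zero)
      finally show ?thesis by simp
    next
      case False
      then have "\<kappa> b x = 0" using representation_ne_zero[of B x b] by (auto simp: \<kappa>_def)
      then show ?thesis by simp
    qed
  qed
  with fin sum show ?thesis by blast
qed

lemma findim_real: "findim TYPE(real)"
proof -
  have "x \<in> span {1::real}" for x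
    by (metis mult.right_neutral real_scaleR_def singletonI span_base span_scale)
  then show ?thesis unfolding findim_def by (intro exI[of _ "{1}"]) auto
qed

lemma findim_prod:
  assumes "findim TYPE('a::real_normed_vector)" "findim TYPE('b::real_normed_vector)"
  shows "findim TYPE('a \<times> 'b)"
proof -
  obtain B :: "'a set" and \<kappa> where B: "finite B" "\<And>b. bounded_linear (\<kappa> b)" "\<And>x. (\<Sum>b\<in>B. \<kappa> b x *\<^sub>R b) = x"
    using findim_coords[OF assms(1)] by blast
  obtain C :: "'b set" and \<nu> where C: "finite C" "\<And>b. bounded_linear (\<nu> b)" "\<And>x. (\<Sum>b\<in>C. \<nu> b x *\<^sub>R b) = x"
    using findim_coords[OF assms(2)] by blast
  let ?D = "(\<lambda>b. (b, 0)) ` B \<union> (\<lambda>b. (0, b)) ` C"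
  have "(x, y) \<in> span ?D" for x y
  proof -
    have "(\<Sum>b\<in>B. \<kappa> b x *\<^sub>R (b, 0)) + (\<Sum>b\<in>C. \<nu> b y *\<^sub>R (0, b)) \<in> span ?D"
      by (intro span_add span_sum span_scale span_base) auto
    moreover have "(\<Sum>b\<in>B. \<kappa> b x *\<^sub>R (b, 0::'b)) = (x, 0)"
      by (rule prod_eqI) (simp_all add: fst_sum snd_sum B(3))
    moreover have "(\<Sum>b\<in>C. \<nu> b y *\<^sub>R (0::'a, b)) = (0, y)"
      by (rule prod_eqI) (simp_all add: fst_sum snd_sum C(3))
    ultimately show ?thesis by simp
  qed
  then show ?thesis unfolding findim_def using B(1) C(1) by (intro exI[of _ ?D]) auto
qed

text \<open>Covectors are defined purely algebraically; this gives them coordinates in the space of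
  bounded linear forms on the model space.\<close>

lemma findim_linear_bounded:
  assumes "findim TYPE('a::real_normed_vector)" "linear (f :: 'a \<Rightarrow> 'b::real_normed_vector)"
  shows "bounded_linear f"
proof -
  obtain B :: "'a set" and \<kappa> where B: "finite B" "\<And>b. bounded_linear (\<kappa> b)"
    "\<And>x. (\<Sum>b\<in>B. \<kappa> b x *\<^sub>R b) = x" using findim_coords[OF assms(1)] by blast
  have eq: "f = (\<lambda>x. \<Sum>b\<in>B. \<kappa> b x *\<^sub>R f b)"
  proof
    fix x
    have "f x = f (\<Sum>b\<in>B. \<kappa> b x *\<^sub>R b)" by (simp add: B(3))
    also have "\<dots> = (\<Sum>b\<in>B. \<kappa> b x *\<^sub>R f b)" by (simp add: linear_sum[OF assms(2)] linear_scale[OF assms(2)])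
    finally show "f x = (\<Sum>b\<in>B. \<kappa> b x *\<^sub>R f b)" .
  qed
  show ?thesis
    by (subst eq) (intro bounded_linear_sum bounded_linear_scaleR_const B(2))
qed

section \<open>Calculus of smooth maps\<close>

text \<open>Sets on which derivatives are unique.\<close>

definition thick :: "'a::real_normed_vector set \<Rightarrow> bool" where
  "thick S \<longleftrightarrow> (\<forall>x\<in>S. \<exists>B. span B = UNIV \<and>
     (\<forall>v\<in>B. \<forall>e>0. \<exists>h::real. 0 < \<bar>h\<bar> \<and> \<bar>h\<bar> < e \<and> x + h *\<^sub>R v \<in> S))"

text \<open>The difference \<open>D\<close> of the two derivatives is a derivative of the zero
  function. Arbitrarily short steps inside \<open>S\<close> along \<open>v\<close> force
  \<open>D v = 0\<close>, and such \<open>v\<close> span the space.\<close>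

lemma thick_derivative_unique:
  assumes "thick S" "x \<in> S" "(f has_derivative f1) (at x within S)" "(f has_derivative f2) (at x within S)"
  shows "f1 = f2"
proof -
  define D where "D = (\<lambda>v. f1 v - f2 v)"
  have der: "((\<lambda>x. 0) has_derivative D) (at x within S)"
    using has_derivative_diff[OF assms(3,4)] by (simp add: D_def)
  then have lin: "linear D" by (simp add: bounded_linear.linear has_derivative_bounded_linear)
  obtain B where B: "span B = UNIV"
    "\<And>v e. v \<in> B \<Longrightarrow> e > 0 \<Longrightarrow> \<exists>h::real. 0 < \<bar>h\<bar> \<and> \<bar>h\<bar> < e \<and> x + h *\<^sub>R v \<in> S"
    using assms(1,2) unfolding thick_def by blast
  have "D v = 0" if v: "v \<in> B" for v
  proof (rule ccontr)
    assume nz: "D v \<noteq> 0"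
    have "v \<noteq> 0" using nz linear_0[OF lin] by auto
    \<comment> \<open>Half of the quotient \<open>norm (D v) / norm v\<close>, so that the
      derivative estimate for one step along \<open>v\<close> bounds \<open>norm (D v)\<close> by
      half of itself.\<close>
    define e where "e = norm (D v) / (2 * norm v)"
    have e: "e > 0" using nz \<open>v \<noteq> 0\<close> by (simp add: e_def)
    obtain d where d: "d > 0" "\<And>y. y \<in> S \<Longrightarrow> norm (y - x) < d \<Longrightarrow> norm (D (y - x)) \<le> e * norm (y - x)"
      using der[unfolded has_derivative_within_alt] e by fastforce
    obtain h where h: "0 < \<bar>h\<bar>" "\<bar>h\<bar> < d / norm v" "x + h *\<^sub>R v \<in> S"
      using B(2)[OF v, of "d / norm v"] d(1) \<open>v \<noteq> 0\<close> by auto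
    have "norm (D (h *\<^sub>R v)) \<le> e * norm (h *\<^sub>R v)"
      using d(2)[OF h(3)] h \<open>v \<noteq> 0\<close> by (simp add: pos_less_divide_eq)
    then have "norm (D v) \<le> e * norm v"
      using h(1) by (simp add: linear_scale[OF lin] mult.left_commute)
    then show False using nz \<open>v \<noteq> 0\<close> by (simp add: e_def)
  qed
  then have "D v = 0" for v using linear_eq_0_on_span[OF lin, of B v] B(1) by auto
  then show ?thesis by (auto simp: D_def)
qed

text \<open>A manifold-valued map has coordinates only on pieces \<open>S \<inter> U\<close> that
  stay in one chart, so uniqueness of derivatives has to survive this restriction.\<close>

lemma thick_Int_open:
  assumes "thick S" "open U"
  shows "thick (S \<inter> U)"
  unfolding thick_def
proof
  fix x assume x: "x \<in> S \<inter> U"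
  obtain B where B: "span B = UNIV"
    "\<And>v e. v \<in> B \<Longrightarrow> e > 0 \<Longrightarrow> \<exists>h::real. 0 < \<bar>h\<bar> \<and> \<bar>h\<bar> < e \<and> x + h *\<^sub>R v \<in> S"
    using assms(1) x unfolding thick_def by blast
  obtain d where d: "d > 0" "ball x d \<subseteq> U" using assms(2) x open_contains_ball by blast
  show "\<exists>B. span B = UNIV \<and> (\<forall>v\<in>B. \<forall>e>0. \<exists>h::real. 0 < \<bar>h\<bar> \<and> \<bar>h\<bar> < e \<and> x + h *\<^sub>R v \<in> S \<inter> U)"
  proof (intro exI[of _ B] conjI ballI allI impI)
    fix v and e :: real assume v: "v \<in> B" and e: "0 < e"
    \<comment> \<open>The added 1 keeps the denominator positive when \<open>v = 0\<close>; the
      bound keeps the step inside the ball of radius \<open>d\<close>.\<close>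
    obtain h where h: "0 < \<bar>h\<bar>" "\<bar>h\<bar> < min e (d / (norm v + 1))" "x + h *\<^sub>R v \<in> S"
      using B(2)[OF v, of "min e (d / (norm v + 1))"] e d(1) by (auto simp: add_nonneg_pos)
    have "\<bar>h\<bar> * norm v \<le> \<bar>h\<bar> * (norm v + 1)" by (simp add: mult_left_mono)
    also have "\<dots> < d" using h(2) by (simp add: pos_less_divide_eq add_nonneg_pos)
    finally have "x + h *\<^sub>R v \<in> U" using d(2) by (auto simp: dist_norm subset_iff)
    with h show "\<exists>h::real. 0 < \<bar>h\<bar> \<and> \<bar>h\<bar> < e \<and> x + h *\<^sub>R v \<in> S \<inter> U" by auto
  qed (rule B(1))
qed

lemma thick_UNIV: "thick (UNIV :: 'a::real_normed_vector set)"
  unfolding thick_def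
proof
  fix x :: 'a
  show "\<exists>B. span B = UNIV \<and> (\<forall>v\<in>B. \<forall>e>0. \<exists>h::real. 0 < \<bar>h\<bar> \<and> \<bar>h\<bar> < e \<and> x + h *\<^sub>R v \<in> UNIV)"
  proof (intro exI[of _ UNIV] conjI ballI allI impI)
    fix e :: real assume "0 < e"
    then show "\<exists>h::real. 0 < \<bar>h\<bar> \<and> \<bar>h\<bar> < e \<and> x + h *\<^sub>R v \<in> UNIV" for v
      by (intro exI[of _ "e / 2"]) auto
  qed simp
qed

lemma thick_open: "open S \<Longrightarrow> thick S"
  using thick_Int_open[OF thick_UNIV] by simp

lemma thick_Icc:
  assumes "a < (b::real)"
  shows "thick {a..b}"
  unfolding thick_def
proof
  fix x assume x: "x \<in> {a..b}"
  have "\<exists>h::real. 0 < \<bar>h\<bar> \<and> \<bar>h\<bar> < e \<and> x + h *\<^sub>R 1 \<in> {a..b}" if "e > 0" for e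
  proof (cases "x < b")
    case True
    then show ?thesis using x that by (intro exI[of _ "min (e/2) (b - x)"]) auto
  next
    case False
    \<comment> \<open>Here \<open>x = b\<close>: the step goes backwards, and \<open>a < b\<close>
      leaves room for it.\<close>
    then show ?thesis using x that assms by (intro exI[of _ "- min (e/2) (b - a)"]) auto
  qed
  moreover have "span {1::real} = UNIV"
    by (metis UNIV_I mult.right_neutral real_scaleR_def singletonI span_base span_scale subsetI subset_antisym)
  ultimately show "\<exists>B. span B = UNIV \<and>
      (\<forall>v\<in>B. \<forall>e>0. \<exists>h::real. 0 < \<bar>h\<bar> \<and> \<bar>h\<bar> < e \<and> x + h *\<^sub>R v \<in> {a..b})"
    by (intro exI[of _ "{1}"]) auto
qed

text \<open>Spanning directions of the factors, placed in the two coordinate subspaces, span the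
  product. Asking for a spanning set of directions, rather than for all of them, is what makes
  thickness stable under products.\<close>

lemma thick_Times:
  assumes S: "thick (S :: 'a::real_normed_vector set)" and T: "thick (T :: 'b::real_normed_vector set)"
  shows "thick (S \<times> T)"
  unfolding thick_def
proof
  fix z assume "z \<in> S \<times> T"
  then obtain x y where z: "z = (x, y)" and x: "x \<in> S" and y: "y \<in> T" by auto
  obtain B where B: "span B = UNIV"
    "\<And>v e. v \<in> B \<Longrightarrow> e > 0 \<Longrightarrow> \<exists>h::real. 0 < \<bar>h\<bar> \<and> \<bar>h\<bar> < e \<and> x + h *\<^sub>R v \<in> S"
    using S x unfolding thick_def by blast
  obtain C where C: "span C = UNIV"
    "\<And>v e. v \<in> C \<Longrightarrow> e > 0 \<Longrightarrow> \<exists>h::real. 0 < \<bar>h\<bar> \<and> \<bar>h\<bar> < e \<and> y + h *\<^sub>R v \<in> T"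
    using T y unfolding thick_def by blast
  let ?D = "(\<lambda>b. (b, 0)) ` B \<union> (\<lambda>b. (0, b)) ` C"
  have "(u, 0) \<in> span ?D" for u
  proof -
    have l: "linear (\<lambda>b::'a. (b, 0::'b))" by (rule linearI) auto
    have "(\<lambda>b. (b, 0)) u \<in> (\<lambda>b. (b, 0::'b)) ` span B" using B(1) by blast
    also have "\<dots> = span ((\<lambda>b. (b, 0)) ` B)" by (rule linear_span_image[OF l, symmetric])
    finally show ?thesis by (meson Un_upper1 span_mono subsetD)
  qed
  moreover have "(0, v) \<in> span ?D" for v
  proof -
    have l: "linear (\<lambda>b::'b. (0::'a, b))" by (rule linearI) auto
    have "(\<lambda>b. (0, b)) v \<in> (\<lambda>b. (0::'a, b)) ` span C" using C(1) by blast
    also have "\<dots> = span ((\<lambda>b. (0, b)) ` C)" by (rule linear_span_image[OF l, symmetric])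
    finally show ?thesis by (meson Un_upper2 span_mono subsetD)
  qed
  ultimately have "(u, v) \<in> span ?D" for u v
    using span_add[of "(u, 0)" ?D "(0, v)"] by simp
  then have "span ?D = UNIV" by auto
  moreover have "\<exists>h::real. 0 < \<bar>h\<bar> \<and> \<bar>h\<bar> < e \<and> z + h *\<^sub>R v \<in> S \<times> T" if "v \<in> ?D" "e > 0" for v e
    using that(1)
  proof
    assume "v \<in> (\<lambda>b. (b, 0)) ` B"
    then obtain b where "b \<in> B" "v = (b, 0)" by blast
    with B(2)[OF _ that(2), of b] show ?thesis by (auto simp: z y)
  next
    assume "v \<in> (\<lambda>b. (0, b)) ` C"
    then obtain b where "b \<in> C" "v = (0, b)" by blast
    with C(2)[OF _ that(2), of b] show ?thesis by (auto simp: z x)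
  qed
  ultimately show "\<exists>B. span B = UNIV \<and>
      (\<forall>v\<in>B. \<forall>e>0. \<exists>h::real. 0 < \<bar>h\<bar> \<and> \<bar>h\<bar> < e \<and> z + h *\<^sub>R v \<in> S \<times> T)"
    by blast
qed

section \<open>Closure properties of C^k and smooth maps\<close>

lemma Ck_on_subset: "Ck_on k S f \<Longrightarrow> T \<subseteq> S \<Longrightarrow> Ck_on k T f"
proof (induction k arbitrary: f)
  case 0 then show ?case using continuous_on_subset by auto
next
  case (Suc k) then show ?case by (simp, meson has_derivative_subset subsetD)
qed

lemma Ck_on_cong:
  assumes "\<And>x. x \<in> S \<Longrightarrow> f x = g x" "Ck_on k S f"
  shows "Ck_on k S g"
proof (cases k)
  case 0 then show ?thesis using assms continuous_on_eq[of S f g] by auto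
next
  case (Suc n)
  with assms(2) obtain f' where f': "\<And>x. x \<in> S \<Longrightarrow> (f has_derivative f' x) (at x within S)"
    "\<And>v. Ck_on n S (\<lambda>x. f' x v)" by auto
  have "(g has_derivative f' x) (at x within S)" if "x \<in> S" for x
    using has_derivative_transform[OF that _ f'(1)[OF that]] assms(1) by auto
  with Suc f'(2) show ?thesis by auto
qed

lemma Ck_on_continuous: "Ck_on k S f \<Longrightarrow> continuous_on S f"
  by (cases k) (auto intro: has_derivative_continuous_on)

lemma Ck_on_SucD: "Ck_on (Suc k) S f \<Longrightarrow> Ck_on k S f"
proof (induction k arbitrary: f)
  case 0 then show ?case using Ck_on_continuous[of "Suc 0" S f] by (simp del: Ck_on.simps(2))
next
  case (Suc k)
  from Suc.prems obtain f' where f': "\<And>x. x \<in> S \<Longrightarrow> (f has_derivative f' x) (at x within S)"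
    "\<And>v. Ck_on (Suc k) S (\<lambda>x. f' x v)" unfolding Ck_on.simps(2)[of "Suc k"] by blast
  then show ?case using Suc.IH unfolding Ck_on.simps(2)[of k] by blast
qed

lemma Ck_on_const: "Ck_on k S (\<lambda>x. c)"
proof (induction k arbitrary: c)
  case (Suc k)
  then show ?case by (auto intro!: exI[of _ "\<lambda>x v. 0"])
qed simp

lemma Ck_on_id: "Ck_on k S (\<lambda>x. x)"
  by (cases k) (auto intro!: exI[of _ "\<lambda>x v. v"] Ck_on_const)

lemma Ck_on_bounded_linear:
  assumes h: "bounded_linear h"
  shows "Ck_on k S f \<Longrightarrow> Ck_on k S (\<lambda>x. h (f x))"
proof (induction k arbitrary: f)
  case 0 then show ?case using bounded_linear.continuous_on[OF h] by auto
next
  case (Suc k)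
  then obtain f' where f': "\<And>x. x \<in> S \<Longrightarrow> (f has_derivative f' x) (at x within S)"
    "\<And>v. Ck_on k S (\<lambda>x. f' x v)" by auto
  then show ?case
    using Suc.IH by (auto intro!: bounded_linear.has_derivative[OF h] exI[of _ "\<lambda>x v. h (f' x v)"])
qed

lemma Ck_on_add: "Ck_on k S f \<Longrightarrow> Ck_on k S g \<Longrightarrow> Ck_on k S (\<lambda>x. f x + g x)"
proof (induction k arbitrary: f g)
  case 0 then show ?case by (auto intro: continuous_on_add)
next
  case (Suc k)
  obtain f' where f': "\<And>x. x \<in> S \<Longrightarrow> (f has_derivative f' x) (at x within S)"
    "\<And>v. Ck_on k S (\<lambda>x. f' x v)" using Suc.prems(1) by auto
  obtain g' where g': "\<And>x. x \<in> S \<Longrightarrow> (g has_derivative g' x) (at x within S)"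
    "\<And>v. Ck_on k S (\<lambda>x. g' x v)" using Suc.prems(2) by auto
  show ?case using Suc.IH f' g'
    by (auto intro!: exI[of _ "\<lambda>x v. f' x v + g' x v"] has_derivative_add)
qed

lemma Ck_on_bounded_bilinear:
  assumes h: "bounded_bilinear h"
  shows "Ck_on k S f \<Longrightarrow> Ck_on k S g \<Longrightarrow> Ck_on k S (\<lambda>x. h (f x) (g x))"
proof (induction k arbitrary: f g)
  case 0 then show ?case by (auto intro: bounded_bilinear.continuous_on[OF h])
next
  case (Suc k)
  obtain f' where f': "\<And>x. x \<in> S \<Longrightarrow> (f has_derivative f' x) (at x within S)"
    "\<And>v. Ck_on k S (\<lambda>x. f' x v)" using Suc.prems(1) by auto
  obtain g' where g': "\<And>x. x \<in> S \<Longrightarrow> (g has_derivative g' x) (at x within S)"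
    "\<And>v. Ck_on k S (\<lambda>x. g' x v)" using Suc.prems(2) by auto
  show ?case using Suc.IH f' g' Suc.prems[THEN Ck_on_SucD]
    by (auto intro!: exI[of _ "\<lambda>x v. h (f x) (g' x v) + h (f' x v) (g x)"] Ck_on_add
        bounded_bilinear.FDERIV[OF h])
qed

lemma Ck_on_sum: "(\<And>i. i \<in> I \<Longrightarrow> Ck_on k S (f i)) \<Longrightarrow> Ck_on k S (\<lambda>x. \<Sum>i\<in>I. f i x)"
  by (induction I rule: infinite_finite_induct) (simp_all add: Ck_on_const Ck_on_add)

text \<open>The chain rule produces \<open>g' (f x) (f' x v)\<close>, where the direction moves with
  \<open>x\<close>, whereas the definition of \<open>Ck_on\<close> speaks of fixed directions only.
  Expanding \<open>f' x v\<close> in coordinates turns this into a finite sum of scalars times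
  derivatives of \<open>g\<close> in fixed directions, which the induction hypothesis
  covers.\<close>

lemma Ck_on_compose:
  fixes f :: "'a::real_normed_vector \<Rightarrow> 'b::real_normed_vector"
    and g :: "'b \<Rightarrow> 'c::real_normed_vector"
  assumes fd: "findim TYPE('b)"
  shows "Ck_on k S f \<Longrightarrow> Ck_on k T g \<Longrightarrow> f ` S \<subseteq> T \<Longrightarrow> Ck_on k S (\<lambda>x. g (f x))"
proof (induction k arbitrary: g)
  case 0 then show ?case using continuous_on_compose2[of T g S f] by auto
next
  case (Suc k)
  obtain B :: "'b set" and \<kappa> where B: "finite B" "\<And>b. bounded_linear (\<kappa> b)"
    "\<And>x. (\<Sum>b\<in>B. \<kappa> b x *\<^sub>R b) = x" using findim_coords[OF fd] by blast
  obtain f' where f': "\<And>x. x \<in> S \<Longrightarrow> (f has_derivative f' x) (at x within S)"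
    "\<And>v. Ck_on k S (\<lambda>x. f' x v)" using Suc.prems(1) by auto
  obtain g' where g': "\<And>x. x \<in> T \<Longrightarrow> (g has_derivative g' x) (at x within T)"
    "\<And>v. Ck_on k T (\<lambda>x. g' x v)" using Suc.prems(2) by auto
  have "Ck_on k S (\<lambda>x. g' (f x) (f' x v))" for v
  proof (rule Ck_on_cong)
    show "Ck_on k S (\<lambda>x. \<Sum>b\<in>B. \<kappa> b (f' x v) *\<^sub>R g' (f x) b)"
      by (rule Ck_on_sum, rule Ck_on_bounded_bilinear[OF bounded_bilinear_scaleR],
          rule Ck_on_bounded_linear[OF B(2)], rule f'(2),
          rule Suc.IH[OF Ck_on_SucD[OF Suc.prems(1)] g'(2) Suc.prems(3)])
  next
    fix x assume "x \<in> S"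
    then have l: "linear (g' (f x))"
      using g'(1) Suc.prems(3) by (meson bounded_linear.linear has_derivative_bounded_linear image_subset_iff)
    show "(\<Sum>b\<in>B. \<kappa> b (f' x v) *\<^sub>R g' (f x) b) = g' (f x) (f' x v)"
      by (subst (2) B(3)[symmetric]) (simp add: linear_sum[OF l] linear_scale[OF l])
  qed
  moreover have "((\<lambda>x. g (f x)) has_derivative (\<lambda>v. g' (f x) (f' x v))) (at x within S)" if "x \<in> S" for x
    using has_derivative_in_compose2[OF g'(1) Suc.prems(3) that f'(1)[OF that]] by blast
  ultimately show ?case by (auto intro!: exI[of _ "\<lambda>x v. g' (f x) (f' x v)"])
qed

text \<open>Each piece comes with its own derivative. Uniqueness on thick sets makes the pieces
  agree, so the diagonal choice \<open>f' x x\<close> is a derivative on all of \<open>S\<close>,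
  locally equal to a smooth one, and the induction hypothesis applies to it.\<close>

lemma Ck_on_local:
  assumes S: "thick S"
  shows "(\<And>x. x \<in> S \<Longrightarrow> \<exists>U. open U \<and> x \<in> U \<and> Ck_on k (S \<inter> U) f) \<Longrightarrow> Ck_on k S f"
proof (induction k arbitrary: f)
  case 0
  have "continuous (at x within S) f" if x: "x \<in> S" for x
  proof -
    obtain U where U: "open U" "x \<in> U" "continuous_on (S \<inter> U) f" using 0[OF x] by auto
    then have "continuous (at x within S \<inter> U) f" using x by (simp add: continuous_on_eq_continuous_within)
    moreover have "at x within S \<inter> U = at x within S"
      by (rule at_within_nhd[OF U(2,1)]) auto
    ultimately show ?thesis by simp
  qed
  then show ?case by (simp add: continuous_on_eq_continuous_within)
next
  case (Suc k)
  have at: "at x within S \<inter> U = at x within S" if "open U" "x \<in> U" for x U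
    by (rule at_within_nhd[OF that(2,1)]) auto
  have "\<forall>x\<in>S. \<exists>U f'. open U \<and> x \<in> U \<and> (\<forall>y\<in>S \<inter> U. (f has_derivative f' y) (at y within S \<inter> U)) \<and>
      (\<forall>v. Ck_on k (S \<inter> U) (\<lambda>y. f' y v))"
    using Suc.prems by (simp only: Ck_on.simps) blast
  then obtain U f' where U: "\<And>x. x \<in> S \<Longrightarrow> open (U x)" "\<And>x. x \<in> S \<Longrightarrow> x \<in> U x" and
    f': "\<And>x y. x \<in> S \<Longrightarrow> y \<in> S \<inter> U x \<Longrightarrow> (f has_derivative f' x y) (at y within S \<inter> U x)"
    "\<And>x v. x \<in> S \<Longrightarrow> Ck_on k (S \<inter> U x) (\<lambda>y. f' x y v)"
    by metis
  have d: "(f has_derivative f' x y) (at y within S)" if "x \<in> S" "y \<in> S \<inter> U x" for x y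
    using f'(1)[OF that] that at[OF U(1)[OF that(1)]] by auto
  have "Ck_on k S (\<lambda>x. f' x x v)" for v
  proof (rule Suc.IH)
    fix x assume x: "x \<in> S"
    have "f' x y v = f' y y v" if "y \<in> S \<inter> U x" for y
    proof -
      have "f' x y = f' y y"
        by (rule thick_derivative_unique[OF S _ d d]) (use that x U in auto)
      then show ?thesis by simp
    qed
    then have "Ck_on k (S \<inter> U x) (\<lambda>x. f' x x v)"
      by (rule Ck_on_cong[OF _ f'(2)[OF x]])
    with U[OF x] show "\<exists>U. open U \<and> x \<in> U \<and> Ck_on k (S \<inter> U) (\<lambda>x. f' x x v)" by blast
  qed
  moreover have "(f has_derivative f' x x) (at x within S)" if "x \<in> S" for x
    by (rule d) (use that U in auto)
  ultimately show ?case by (auto intro!: exI[of _ "\<lambda>x. f' x x"])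
qed

lemma smooth_on_subset: "smooth_on S f \<Longrightarrow> T \<subseteq> S \<Longrightarrow> smooth_on T f"
  unfolding smooth_on_def by (auto intro: Ck_on_subset[of _ S f T])

lemma smooth_on_cong: "(\<And>x. x \<in> S \<Longrightarrow> f x = g x) \<Longrightarrow> smooth_on S f \<Longrightarrow> smooth_on S g"
  unfolding smooth_on_def by (auto intro: Ck_on_cong[of S f g])

lemma smooth_on_continuous: "smooth_on S f \<Longrightarrow> continuous_on S f"
  unfolding smooth_on_def by (auto intro: Ck_on_continuous[of 0 S f])

lemma smooth_on_const: "smooth_on S (\<lambda>x. c)"
  unfolding smooth_on_def by (simp add: Ck_on_const)

lemma smooth_on_id: "smooth_on S (\<lambda>x. x)"
  unfolding smooth_on_def by (simp add: Ck_on_id)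

lemma smooth_on_bounded_linear: "bounded_linear h \<Longrightarrow> smooth_on S f \<Longrightarrow> smooth_on S (\<lambda>x. h (f x))"
  unfolding smooth_on_def by (simp add: Ck_on_bounded_linear)

lemma smooth_on_add: "smooth_on S f \<Longrightarrow> smooth_on S g \<Longrightarrow> smooth_on S (\<lambda>x. f x + g x)"
  unfolding smooth_on_def by (simp add: Ck_on_add)

lemma smooth_on_bounded_bilinear:
  "bounded_bilinear h \<Longrightarrow> smooth_on S f \<Longrightarrow> smooth_on S g \<Longrightarrow> smooth_on S (\<lambda>x. h (f x) (g x))"
  unfolding smooth_on_def by (simp add: Ck_on_bounded_bilinear)

lemmas smooth_on_scaleR = smooth_on_bounded_bilinear[OF bounded_bilinear_scaleR]

lemma smooth_on_diff:
  assumes "smooth_on S f" "smooth_on S g"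
  shows "smooth_on S (\<lambda>x. f x - g x)"
  using smooth_on_add[OF assms(1) smooth_on_bounded_linear[OF bounded_linear_minus[OF bounded_linear_ident] assms(2)]]
  by simp

lemma smooth_on_sum: "(\<And>i. i \<in> I \<Longrightarrow> smooth_on S (f i)) \<Longrightarrow> smooth_on S (\<lambda>x. \<Sum>i\<in>I. f i x)"
  unfolding smooth_on_def by (simp add: Ck_on_sum)

lemma smooth_on_compose:
  fixes f :: "'a::real_normed_vector \<Rightarrow> 'b::real_normed_vector"
  shows "findim TYPE('b) \<Longrightarrow> smooth_on T g \<Longrightarrow> smooth_on S f \<Longrightarrow> f ` S \<subseteq> T \<Longrightarrow> smooth_on S (\<lambda>x. g (f x))"
  unfolding smooth_on_def by (auto intro: Ck_on_compose[of _ S f T g])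

lemma smooth_on_Pair:
  assumes "smooth_on S f" "smooth_on S g"
  shows "smooth_on S (\<lambda>x. (f x, g x))"
proof -
  have 1: "bounded_linear (\<lambda>x. (x, 0))" and 2: "bounded_linear (\<lambda>x. (0, x))"
    by (intro bounded_linear_Pair bounded_linear_ident bounded_linear_zero)+
  show ?thesis
    using smooth_on_add[OF smooth_on_bounded_linear[OF 1 assms(1)] smooth_on_bounded_linear[OF 2 assms(2)]]
    by simp
qed

lemmas smooth_on_fst = smooth_on_bounded_linear[OF bounded_linear_fst]
lemmas smooth_on_snd = smooth_on_bounded_linear[OF bounded_linear_snd]

lemma smooth_on_local:
  assumes "thick S" "\<And>x. x \<in> S \<Longrightarrow> \<exists>U. open U \<and> x \<in> U \<and> smooth_on (S \<inter> U) f"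
  shows "smooth_on S f"
  unfolding smooth_on_def
proof (intro allI Ck_on_local[OF assms(1)])
  fix k x assume "x \<in> S"
  then show "\<exists>U. open U \<and> x \<in> U \<and> Ck_on k (S \<inter> U) f"
    using assms(2)[of x] unfolding smooth_on_def by blast
qed

text \<open>The definition supplies a possibly different derivative for every order
  \<open>k\<close>; uniqueness merges them into one whose directional derivatives have every
  order.\<close>

lemma smooth_on_derivative:
  assumes S: "thick S" and f: "smooth_on S f"
  obtains f' where "\<And>x. x \<in> S \<Longrightarrow> (f has_derivative f' x) (at x within S)"
    "\<And>v. smooth_on S (\<lambda>x. f' x v)"
proof -
  have "\<forall>k. \<exists>f'. (\<forall>x\<in>S. (f has_derivative f' x) (at x within S)) \<and> (\<forall>v. Ck_on k S (\<lambda>x. f' x v))"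
    using f unfolding smooth_on_def by (metis Ck_on.simps(2))
  then obtain f' where f': "\<And>k x. x \<in> S \<Longrightarrow> (f has_derivative f' k x) (at x within S)"
    "\<And>k v. Ck_on k S (\<lambda>x. f' k x v)" by metis
  have "f' k x = f' 0 x" if "x \<in> S" for k x
    by (rule thick_derivative_unique[OF S that f'(1)[OF that] f'(1)[OF that]])
  then have "Ck_on k S (\<lambda>x. f' 0 x v)" for k v
    by (intro Ck_on_cong[OF _ f'(2)[of k v]]) (rule fun_cong)
  then show ?thesis using f'(1)[of _ 0] that[of "f' 0"] unfolding smooth_on_def by auto
qed

text \<open>Point and direction may both vary. Every smoothness claim about transformed tangent
  vectors rests on this.\<close>

lemma smooth_on_derivative_apply:
  fixes S :: "'a::real_normed_vector set" and T :: "'b::real_normed_vector set"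
  assumes fd: "findim TYPE('a)"
    and f': "\<And>v. smooth_on S (\<lambda>x. f' x v)" "\<And>x. x \<in> S \<Longrightarrow> linear (f' x)"
    and x: "smooth_on T x" "x ` T \<subseteq> S" and u: "smooth_on T (u :: 'b \<Rightarrow> 'a)"
  shows "smooth_on T (\<lambda>s. f' (x s) (u s))"
proof -
  obtain B :: "'a set" and \<kappa> where B: "finite B" "\<And>b. bounded_linear (\<kappa> b)"
    "\<And>x. (\<Sum>b\<in>B. \<kappa> b x *\<^sub>R b) = x" using findim_coords[OF fd] by blast
  show ?thesis
  proof (rule smooth_on_cong)
    show "smooth_on T (\<lambda>s. \<Sum>b\<in>B. \<kappa> b (u s) *\<^sub>R f' (x s) b)"
      by (intro smooth_on_sum smooth_on_scaleR smooth_on_bounded_linear[OF B(2)] u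
          smooth_on_compose[OF fd f'(1) x])
  next
    fix s assume "s \<in> T"
    then have l: "linear (f' (x s))" using f'(2) x(2) by blast
    show "(\<Sum>b\<in>B. \<kappa> b (u s) *\<^sub>R f' (x s) b) = f' (x s) (u s)"
      by (subst (2) B(3)[symmetric]) (simp add: linear_sum[OF l] linear_scale[OF l])
  qed
qed

text \<open>A linear map on a finite-dimensional space is determined, linearly and boundedly, by its
  values on finitely many vectors, so smoothness of these values suffices.\<close>

lemma smooth_on_blinfun:
  fixes \<beta> :: "'s::real_normed_vector \<Rightarrow> 'a::real_normed_vector \<Rightarrow>\<^sub>L 'b::real_normed_vector"
  assumes fd: "findim TYPE('a)" and "\<And>u. smooth_on S (\<lambda>s. \<beta> s u)"
  shows "smooth_on S \<beta>"
proof -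
  obtain B :: "'a set" and \<kappa> where B: "finite B" "\<And>b. bounded_linear (\<kappa> b)"
    "\<And>x. (\<Sum>b\<in>B. \<kappa> b x *\<^sub>R b) = x" using findim_coords[OF fd] by blast
  \<comment> \<open>\<open>?h b y\<close> is the rank-one map that sends \<open>x\<close> to
    \<open>\<kappa> b x\<close> times \<open>y\<close>.\<close>
  let ?h = "\<lambda>b y. blinfun_scaleR_left y o\<^sub>L Blinfun (\<kappa> b)"
  have h: "bounded_linear (?h b)" for b
    by (rule bounded_linear_compose[OF bounded_bilinear.bounded_linear_left[OF bounded_bilinear_blinfun_compose]
        bounded_linear_blinfun_scaleR_left])
  have "\<beta> s = (\<Sum>b\<in>B. ?h b (\<beta> s b))" for s
  proof (rule blinfun_eqI)
    fix x
    have "\<beta> s x = \<beta> s (\<Sum>b\<in>B. \<kappa> b x *\<^sub>R b)" by (simp add: B(3))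
    also have "\<dots> = (\<Sum>b\<in>B. \<kappa> b x *\<^sub>R \<beta> s b)" by (simp add: blinfun.sum_right blinfun.scaleR_right)
    finally show "\<beta> s x = (\<Sum>b\<in>B. ?h b (\<beta> s b)) x"
      by (simp add: blinfun.sum_left bounded_linear_Blinfun_apply[OF B(2)])
  qed
  then have "\<beta> = (\<lambda>s. \<Sum>b\<in>B. ?h b (\<beta> s b))" by blast
  moreover have "smooth_on S (\<lambda>s. \<Sum>b\<in>B. ?h b (\<beta> s b))"
    by (intro smooth_on_sum smooth_on_bounded_linear[OF h] assms)
  ultimately show ?thesis by simp
qed

section \<open>Smooth maps into manifolds in local coordinates\<close>

text \<open>The common interface of the manifold, its products, its tangent and cotangent spaces and
  its Pontryagin bundle: just enough structure to test maps into any of them in local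
  coordinates.\<close>

locale atlas =
  fixes M :: "'m set" and A :: "('m, 'e::real_normed_vector) chart set"
  assumes dom_subset: "c \<in> A \<Longrightarrow> chart_dom c \<subseteq> M"
    and cover: "x \<in> M \<Longrightarrow> \<exists>c\<in>A. x \<in> chart_dom c"
    and inj: "c \<in> A \<Longrightarrow> inj_on (chart_map c) (chart_dom c)"
    and overlap_open: "c \<in> A \<Longrightarrow> d \<in> A \<Longrightarrow> open (chart_map c ` (chart_dom c \<inter> chart_dom d))"
begin

lemma openin_iff: "openin (manifold_topology M A) W \<longleftrightarrow>
    W \<subseteq> M \<and> (\<forall>c\<in>A. open (chart_map c ` (W \<inter> chart_dom c)))"
  by (rule openin_manifold_topology) (rule inj)

lemma openin_chart_dom: "c \<in> A \<Longrightarrow> openin (manifold_topology M A) (chart_dom c)"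
  unfolding openin_iff using dom_subset overlap_open by (simp add: Int_commute)

lemma open_chart_image: "c \<in> A \<Longrightarrow> open (chart_map c ` chart_dom c)"
  using overlap_open[of c c] by simp

lemma topspace_manifold: "topspace (manifold_topology M A) = M"
proof -
  have "openin (manifold_topology M A) M"
    unfolding openin_iff using dom_subset open_chart_image by (simp add: Int_absorb1)
  moreover have "W \<subseteq> M" if "openin (manifold_topology M A) W" for W
    using that openin_iff by blast
  ultimately show ?thesis unfolding topspace_def by blast
qed

lemma chart_inv_map: "c \<in> A \<Longrightarrow> x \<in> chart_dom c \<Longrightarrow> chart_inv c (chart_map c x) = x"
  unfolding chart_inv_def using inj by (simp add: inv_into_f_f)

lemma chart_inv_dom: "y \<in> chart_map c ` chart_dom c \<Longrightarrow> chart_inv c y \<in> chart_dom c"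
  unfolding chart_inv_def by (rule inv_into_into)

lemma chart_map_inv: "y \<in> chart_map c ` chart_dom c \<Longrightarrow> chart_map c (chart_inv c y) = y"
  unfolding chart_inv_def by (rule f_inv_into_f)

lemma smooth_into_carrier: "smooth_into S M A F \<Longrightarrow> s \<in> S \<Longrightarrow> F s \<in> M"
  unfolding smooth_into_def by blast

lemma smooth_intoD:
  assumes F: "smooth_into S M A F" and s: "s \<in> S" and c: "c \<in> A" "F s \<in> chart_dom c"
  shows "\<exists>U. open U \<and> s \<in> U \<and> F ` (S \<inter> U) \<subseteq> chart_dom c \<and> smooth_on (S \<inter> U) (\<lambda>s. chart_map c (F s))"
proof -
  have "openin (top_of_set S) {x \<in> topspace (top_of_set S). F x \<in> chart_dom c}"
    using F openin_continuous_map_preimage openin_chart_dom[OF c(1)] unfolding smooth_into_def by blast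
  then obtain U where U: "open U" "{x \<in> S. F x \<in> chart_dom c} = S \<inter> U"
    by (auto simp: openin_open)
  have "smooth_on (S \<inter> F -` chart_dom c) (chart_map c \<circ> F)"
    using F c unfolding smooth_into_def by blast
  moreover have "S \<inter> F -` chart_dom c = S \<inter> U" using U(2) by blast
  ultimately have "smooth_on (S \<inter> U) (\<lambda>s. chart_map c (F s))" by (simp add: o_def)
  with U s c show ?thesis by blast
qed

text \<open>Reduces smoothness into a manifold to a test near each point. Continuity follows from
  the test: the coordinates are continuous, charts are injective, and open sets are those with open
  chart images.\<close>

lemma smooth_intoI:
  assumes S: "thick S" and M: "\<And>s. s \<in> S \<Longrightarrow> F s \<in> M"
    and loc: "\<And>s c. s \<in> S \<Longrightarrow> c \<in> A \<Longrightarrow> F s \<in> chart_dom c \<Longrightarrow>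
      \<exists>U. open U \<and> s \<in> U \<and> F ` (S \<inter> U) \<subseteq> chart_dom c \<and> smooth_on (S \<inter> U) (\<lambda>s. chart_map c (F s))"
  shows "smooth_into S M A F"
proof -
  have pre: "openin (top_of_set S) {s \<in> S. F s \<in> V}" if V: "openin (manifold_topology M A) V" for V
  proof (subst openin_subopen, intro ballI)
    fix s assume "s \<in> {s \<in> S. F s \<in> V}"
    then have s: "s \<in> S" "F s \<in> V" by auto
    obtain c where c: "c \<in> A" "F s \<in> chart_dom c" using cover M s by blast
    obtain U where U: "open U" "s \<in> U" "F ` (S \<inter> U) \<subseteq> chart_dom c"
      "smooth_on (S \<inter> U) (\<lambda>s. chart_map c (F s))" using loc[OF s(1) c] by blast
    have op: "open (chart_map c ` (V \<inter> chart_dom c))" using V c openin_iff by blast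
    obtain W where W: "open W"
      "(S \<inter> U) \<inter> (\<lambda>s. chart_map c (F s)) -` (chart_map c ` (V \<inter> chart_dom c)) = S \<inter> U \<inter> W"
      using continuous_openin_preimage_gen[OF smooth_on_continuous[OF U(4)] op]
      by (auto simp: openin_open)
    have "S \<inter> (U \<inter> W) \<subseteq> {s \<in> S. F s \<in> V}"
    proof
      fix t assume t: "t \<in> S \<inter> (U \<inter> W)"
      then have "chart_map c (F t) \<in> chart_map c ` (V \<inter> chart_dom c)" using W(2) by blast
      moreover have "F t \<in> chart_dom c" using t U(3) by blast
      ultimately show "t \<in> {s \<in> S. F s \<in> V}"
        using inj[OF c(1)] t by (auto dest: inj_onD)
    qed
    moreover have "s \<in> S \<inter> (U \<inter> W)" using s c U W(2) by blast
    moreover have "openin (top_of_set S) (S \<inter> (U \<inter> W))" using U(1) W(1) by (auto simp: openin_open)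
    ultimately show "\<exists>T. openin (top_of_set S) T \<and> s \<in> T \<and> T \<subseteq> {s \<in> S. F s \<in> V}" by blast
  qed
  have cont: "continuous_map (top_of_set S) (manifold_topology M A) F"
    unfolding continuous_map_def topspace_manifold using M pre by simp
  have "smooth_on (S \<inter> F -` chart_dom d) (chart_map d \<circ> F)" if d: "d \<in> A" for d
  proof (rule smooth_on_local)
    obtain W where W: "open W" "{s \<in> S. F s \<in> chart_dom d} = S \<inter> W"
      using pre[OF openin_chart_dom[OF d]] by (auto simp: openin_open)
    have eq: "S \<inter> F -` chart_dom d = S \<inter> W" using W(2) by blast
    show "thick (S \<inter> F -` chart_dom d)" unfolding eq by (rule thick_Int_open[OF S W(1)])
    fix s assume "s \<in> S \<inter> F -` chart_dom d"
    then obtain U where "open U" "s \<in> U" "smooth_on (S \<inter> U) (\<lambda>s. chart_map d (F s))"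
      using loc[of s d] d by blast
    then show "\<exists>U. open U \<and> s \<in> U \<and> smooth_on (S \<inter> F -` chart_dom d \<inter> U) (chart_map d \<circ> F)"
      by (intro exI[of _ U]) (auto simp: o_def elim: smooth_on_subset)
  qed
  then show ?thesis unfolding smooth_into_def using M cont by blast
qed

lemma smooth_into_compose:
  fixes \<phi> :: "'t::real_normed_vector \<Rightarrow> 's::real_normed_vector"
  assumes fd: "findim TYPE('s)" and F: "smooth_into S M A F"
    and \<phi>: "smooth_on T \<phi>" "\<phi> ` T \<subseteq> S" and T: "thick T"
  shows "smooth_into T M A (\<lambda>t. F (\<phi> t))"
proof (rule smooth_intoI[OF T])
  fix t assume t: "t \<in> T"
  show "F (\<phi> t) \<in> M" using smooth_into_carrier[OF F] t \<phi>(2) by blast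
  fix c assume c: "c \<in> A" "F (\<phi> t) \<in> chart_dom c"
  have "\<phi> t \<in> S" using t \<phi>(2) by blast
  then obtain U where U: "open U" "\<phi> t \<in> U" "F ` (S \<inter> U) \<subseteq> chart_dom c"
      "smooth_on (S \<inter> U) (\<lambda>s. chart_map c (F s))" using smooth_intoD[OF F _ c] by blast
  obtain W where W: "open W" "T \<inter> \<phi> -` U = T \<inter> W"
    using continuous_openin_preimage_gen[OF smooth_on_continuous[OF \<phi>(1)] U(1)]
    by (auto simp: openin_open)
  have sub: "\<phi> ` (T \<inter> W) \<subseteq> S \<inter> U" using \<phi>(2) W(2) by blast
  have "smooth_on (T \<inter> W) (\<lambda>t. chart_map c (F (\<phi> t)))"
    by (rule smooth_on_compose[OF fd U(4) smooth_on_subset[OF \<phi>(1)] sub]) simp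
  moreover have "t \<in> W" using t U(2) W(2) by blast
  moreover have "(\<lambda>t. F (\<phi> t)) ` (T \<inter> W) \<subseteq> chart_dom c" using sub U(3) by blast
  ultimately show "\<exists>U. open U \<and> t \<in> U \<and> (\<lambda>t. F (\<phi> t)) ` (T \<inter> U) \<subseteq> chart_dom c \<and>
      smooth_on (T \<inter> U) (\<lambda>t. chart_map c (F (\<phi> t)))" using W(1) by blast
qed

lemma smooth_into_subset:
  assumes \<Gamma>: "smooth_into S M A \<Gamma>" and S: "thick S" and U: "open U"
  shows "smooth_into (S \<inter> U) M A \<Gamma>"
proof (rule smooth_intoI[OF thick_Int_open[OF S U]])
  show "\<Gamma> s \<in> M" if "s \<in> S \<inter> U" for s using smooth_into_carrier[OF \<Gamma>] that by blast
  fix s c assume s: "s \<in> S \<inter> U" and c: "c \<in> A" "\<Gamma> s \<in> chart_dom c"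
  then obtain V where V: "open V" "s \<in> V" "\<Gamma> ` (S \<inter> V) \<subseteq> chart_dom c" "smooth_on (S \<inter> V) (\<lambda>s. chart_map c (\<Gamma> s))"
    using smooth_intoD[OF \<Gamma> _ c] by blast
  have "smooth_on (S \<inter> U \<inter> V) (\<lambda>s. chart_map c (\<Gamma> s))" by (rule smooth_on_subset[OF V(4)]) blast
  then show "\<exists>V. open V \<and> s \<in> V \<and> \<Gamma> ` (S \<inter> U \<inter> V) \<subseteq> chart_dom c \<and> smooth_on (S \<inter> U \<inter> V) (\<lambda>s. chart_map c (\<Gamma> s))"
    using V by blast
qed

end

section \<open>Smooth maps between manifolds and into products\<close>

lemma smooth_into_map:
  fixes A :: "('m, 'e::real_normed_vector) chart set" and B :: "('n, 'f::real_normed_vector) chart set"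
  assumes "atlas M A" "atlas N B" and fd: "findim TYPE('e)" and F: "smooth_map M A N B F"
    and \<Gamma>: "smooth_into S M A \<Gamma>" and S: "thick S"
  shows "smooth_into S N B (\<lambda>s. F (\<Gamma> s))"
proof -
  interpret M: atlas M A by fact
  interpret N: atlas N B by fact
  show ?thesis
  proof (rule N.smooth_intoI[OF S])
    fix s assume s: "s \<in> S"
    show "F (\<Gamma> s) \<in> N" using M.smooth_into_carrier[OF \<Gamma> s] F unfolding smooth_map_def by blast
    fix d assume d: "d \<in> B" "F (\<Gamma> s) \<in> chart_dom d"
    obtain c where c: "c \<in> A" "\<Gamma> s \<in> chart_dom c" using M.cover M.smooth_into_carrier[OF \<Gamma> s] by blast
    obtain U where U: "open U" "s \<in> U" "\<Gamma> ` (S \<inter> U) \<subseteq> chart_dom c"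
      "smooth_on (S \<inter> U) (\<lambda>s. chart_map c (\<Gamma> s))" using M.smooth_intoD[OF \<Gamma> s c] by blast
    have "openin (manifold_topology M A) {x \<in> topspace (manifold_topology M A). F x \<in> chart_dom d}"
      using F openin_continuous_map_preimage N.openin_chart_dom[OF d(1)] unfolding smooth_map_def by blast
    then have op: "open (chart_map c ` ({x \<in> M. F x \<in> chart_dom d} \<inter> chart_dom c))" (is "open ?O")
      unfolding M.topspace_manifold M.openin_iff using c by blast
    obtain W where W: "open W" "(S \<inter> U) \<inter> (\<lambda>s. chart_map c (\<Gamma> s)) -` ?O = S \<inter> U \<inter> W"
      using continuous_openin_preimage_gen[OF smooth_on_continuous[OF U(4)] op] unfolding openin_open by blast
    have sm: "smooth_on (chart_map c ` (chart_dom c \<inter> F -` chart_dom d)) (chart_map d \<circ> F \<circ> chart_inv c)"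
      using F c d unfolding smooth_map_def by blast
    have dom: "\<Gamma> t \<in> chart_dom c" if "t \<in> S \<inter> (U \<inter> W)" for t using that U(3) by blast
    have dom2: "F (\<Gamma> t) \<in> chart_dom d" if t: "t \<in> S \<inter> (U \<inter> W)" for t
    proof -
      have "chart_map c (\<Gamma> t) \<in> ?O" using t W(2) by blast
      then show ?thesis using M.inj[OF c(1)] dom[OF t] by (auto dest: inj_onD)
    qed
    have "smooth_on (S \<inter> (U \<inter> W)) (\<lambda>t. (chart_map d \<circ> F \<circ> chart_inv c) (chart_map c (\<Gamma> t)))"
      by (rule smooth_on_compose[OF fd sm smooth_on_subset[OF U(4)]]) (use dom dom2 in auto)
    then have "smooth_on (S \<inter> (U \<inter> W)) (\<lambda>t. chart_map d (F (\<Gamma> t)))"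
      by (rule smooth_on_cong[rotated]) (simp add: M.chart_inv_map[OF c(1)] dom)
    moreover have "s \<in> W"
    proof -
      have "\<Gamma> s \<in> {x \<in> M. F x \<in> chart_dom d} \<inter> chart_dom c"
        using M.smooth_into_carrier[OF \<Gamma> s] d c by blast
      then show ?thesis using W(2) s U(2) by blast
    qed
    ultimately show "\<exists>U. open U \<and> s \<in> U \<and> (\<lambda>s. F (\<Gamma> s)) ` (S \<inter> U) \<subseteq> chart_dom d \<and>
        smooth_on (S \<inter> U) (\<lambda>s. chart_map d (F (\<Gamma> s)))"
      using U W dom2 by (intro exI[of _ "U \<inter> W"]) auto
  qed
qed

lemma prod_atlas_iff: "k \<in> prod_atlas A B \<longleftrightarrow>
    (\<exists>c\<in>A. \<exists>d\<in>B. k = (chart_dom c \<times> chart_dom d, map_prod (chart_map c) (chart_map d)))"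
  unfolding prod_atlas_def by blast

lemma atlas_prod:
  assumes "atlas M A" "atlas N B"
  shows "atlas (M \<times> N) (prod_atlas A B)"
proof -
  interpret M: atlas M A by fact
  interpret N: atlas N B by fact
  show ?thesis
  proof
    show "chart_dom k \<subseteq> M \<times> N" if "k \<in> prod_atlas A B" for k
      using that M.dom_subset N.dom_subset by (fastforce simp: prod_atlas_iff)
    show "\<exists>k\<in>prod_atlas A B. z \<in> chart_dom k" if "z \<in> M \<times> N" for z
    proof -
      have "fst z \<in> M" "snd z \<in> N" using that by auto
      then obtain c d where "c \<in> A" "fst z \<in> chart_dom c" "d \<in> B" "snd z \<in> chart_dom d"
        using M.cover[of "fst z"] N.cover[of "snd z"] by blast
      then show ?thesis
        by (intro bexI[of _ "(chart_dom c \<times> chart_dom d, map_prod (chart_map c) (chart_map d))"])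
          (auto simp: prod_atlas_iff mem_Times_iff)
    qed
    show "inj_on (chart_map k) (chart_dom k)" if "k \<in> prod_atlas A B" for k
      using that M.inj N.inj by (auto simp: prod_atlas_iff intro!: map_prod_inj_on)
    show "open (chart_map k ` (chart_dom k \<inter> chart_dom l))" if "k \<in> prod_atlas A B" "l \<in> prod_atlas A B" for k l
    proof -
      obtain c d where k: "c \<in> A" "d \<in> B" "k = (chart_dom c \<times> chart_dom d, map_prod (chart_map c) (chart_map d))"
        using \<open>k \<in> prod_atlas A B\<close> by (auto simp: prod_atlas_iff)
      obtain c' d' where l: "c' \<in> A" "d' \<in> B" "l = (chart_dom c' \<times> chart_dom d', map_prod (chart_map c') (chart_map d'))"
        using \<open>l \<in> prod_atlas A B\<close> by (auto simp: prod_atlas_iff)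
      have "chart_map k ` (chart_dom k \<inter> chart_dom l) =
          (chart_map c ` (chart_dom c \<inter> chart_dom c')) \<times> (chart_map d ` (chart_dom d \<inter> chart_dom d'))"
        by (force simp: k(3) l(3))
      then show ?thesis using M.overlap_open[OF k(1) l(1)] N.overlap_open[OF k(2) l(2)] by (simp add: open_Times)
    qed
  qed
qed

lemma smooth_into_prod_iff:
  fixes A :: "('m, 'e::real_normed_vector) chart set" and B :: "('n, 'f::real_normed_vector) chart set"
  assumes "atlas M A" "atlas N B" and S: "thick S"
  shows "smooth_into S (M \<times> N) (prod_atlas A B) F \<longleftrightarrow>
    smooth_into S M A (\<lambda>s. fst (F s)) \<and> smooth_into S N B (\<lambda>s. snd (F s))"
proof -
  interpret M: atlas M A by fact
  interpret N: atlas N B by fact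
  interpret P: atlas "M \<times> N" "prod_atlas A B" by (rule atlas_prod) fact+
  \<comment> \<open>Both components are localized together: a product chart needs a chart of each
    factor, even when only one component is of interest.\<close>
  have 1: "\<exists>U. open U \<and> s \<in> U \<and> (\<lambda>s. fst (F s)) ` (S \<inter> U) \<subseteq> chart_dom c \<and>
       (\<lambda>s. snd (F s)) ` (S \<inter> U) \<subseteq> chart_dom d \<and>
       smooth_on (S \<inter> U) (\<lambda>s. chart_map c (fst (F s))) \<and> smooth_on (S \<inter> U) (\<lambda>s. chart_map d (snd (F s)))"
    if F: "smooth_into S (M \<times> N) (prod_atlas A B) F" and s: "s \<in> S"
      and cd: "c \<in> A" "d \<in> B" "fst (F s) \<in> chart_dom c" "snd (F s) \<in> chart_dom d" for s c d
  proof -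
    let ?k = "(chart_dom c \<times> chart_dom d, map_prod (chart_map c) (chart_map d))"
    have k: "?k \<in> prod_atlas A B" "F s \<in> chart_dom ?k" using cd by (auto simp: prod_atlas_iff mem_Times_iff)
    obtain U where U: "open U" "s \<in> U" "F ` (S \<inter> U) \<subseteq> chart_dom ?k"
      "smooth_on (S \<inter> U) (\<lambda>s. chart_map ?k (F s))" using P.smooth_intoD[OF F s k] by blast
    have "fst (F t) \<in> chart_dom c \<and> snd (F t) \<in> chart_dom d" if "t \<in> S \<inter> U" for t
      using U(3) that by fastforce
    moreover have "smooth_on (S \<inter> U) (\<lambda>s. chart_map c (fst (F s)))"
      using smooth_on_fst[OF U(4)] by (simp add: fst_map_prod)
    moreover have "smooth_on (S \<inter> U) (\<lambda>s. chart_map d (snd (F s)))"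
      using smooth_on_snd[OF U(4)] by (simp add: snd_map_prod)
    ultimately show ?thesis using U(1,2) by blast
  qed
  show ?thesis
  proof (intro iffI conjI)
    assume F: "smooth_into S (M \<times> N) (prod_atlas A B) F"
    have MN: "fst (F s) \<in> M" "snd (F s) \<in> N" if "s \<in> S" for s
      using P.smooth_into_carrier[OF F that] by (auto simp: mem_Times_iff)
    show "smooth_into S M A (\<lambda>s. fst (F s))"
    proof (rule M.smooth_intoI[OF S])
      fix s c assume s: "s \<in> S" "c \<in> A" "fst (F s) \<in> chart_dom c"
      obtain d where d: "d \<in> B" "snd (F s) \<in> chart_dom d" using MN[OF s(1)] N.cover by blast
      from 1[OF F s(1,2) d(1) s(3) d(2)] show "\<exists>U. open U \<and> s \<in> U \<and> (\<lambda>s. fst (F s)) ` (S \<inter> U) \<subseteq> chart_dom c \<and>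
        smooth_on (S \<inter> U) (\<lambda>s. chart_map c (fst (F s)))" by blast
    qed (rule MN)
    show "smooth_into S N B (\<lambda>s. snd (F s))"
    proof (rule N.smooth_intoI[OF S])
      fix s d assume s: "s \<in> S" "d \<in> B" "snd (F s) \<in> chart_dom d"
      obtain c where c: "c \<in> A" "fst (F s) \<in> chart_dom c" using MN[OF s(1)] M.cover by blast
      from 1[OF F s(1) c(1) s(2) c(2) s(3)] show "\<exists>U. open U \<and> s \<in> U \<and> (\<lambda>s. snd (F s)) ` (S \<inter> U) \<subseteq> chart_dom d \<and>
        smooth_on (S \<inter> U) (\<lambda>s. chart_map d (snd (F s)))" by blast
    qed (rule MN)
  next
    assume "smooth_into S M A (\<lambda>s. fst (F s)) \<and> smooth_into S N B (\<lambda>s. snd (F s))"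
    then have F1: "smooth_into S M A (\<lambda>s. fst (F s))" and F2: "smooth_into S N B (\<lambda>s. snd (F s))" by auto
    show "smooth_into S (M \<times> N) (prod_atlas A B) F"
    proof (rule P.smooth_intoI[OF S])
      fix s assume s: "s \<in> S"
      show "F s \<in> M \<times> N" using M.smooth_into_carrier[OF F1 s] N.smooth_into_carrier[OF F2 s]
        by (simp add: mem_Times_iff)
      fix k assume k: "k \<in> prod_atlas A B" "F s \<in> chart_dom k"
      then obtain c d where cd: "c \<in> A" "d \<in> B" "k = (chart_dom c \<times> chart_dom d, map_prod (chart_map c) (chart_map d))"
        by (auto simp: prod_atlas_iff)
      have sd: "fst (F s) \<in> chart_dom c" "snd (F s) \<in> chart_dom d"
        using k(2) by (auto simp: cd(3) mem_Times_iff)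
      obtain U where U: "open U" "s \<in> U" "(\<lambda>s. fst (F s)) ` (S \<inter> U) \<subseteq> chart_dom c"
        "smooth_on (S \<inter> U) (\<lambda>s. chart_map c (fst (F s)))" using M.smooth_intoD[OF F1 s cd(1) sd(1)] by blast
      obtain V where V: "open V" "s \<in> V" "(\<lambda>s. snd (F s)) ` (S \<inter> V) \<subseteq> chart_dom d"
        "smooth_on (S \<inter> V) (\<lambda>s. chart_map d (snd (F s)))" using N.smooth_intoD[OF F2 s cd(2) sd(2)] by blast
      have "smooth_on (S \<inter> (U \<inter> V)) (\<lambda>s. (chart_map c (fst (F s)), chart_map d (snd (F s))))"
        by (intro smooth_on_Pair smooth_on_subset[OF U(4)] smooth_on_subset[OF V(4)]) auto
      moreover have "(\<lambda>s. (chart_map c (fst (F s)), chart_map d (snd (F s)))) = (\<lambda>s. chart_map k (F s))"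
        by (auto simp: cd(3) map_prod_def split_beta)
      moreover have "F ` (S \<inter> (U \<inter> V)) \<subseteq> chart_dom k" using U(3) V(3)
        by (intro image_subsetI) (simp add: cd(3) mem_Times_iff image_subset_iff)
      ultimately show "\<exists>U. open U \<and> s \<in> U \<and> F ` (S \<inter> U) \<subseteq> chart_dom k \<and> smooth_on (S \<inter> U) (\<lambda>s. chart_map k (F s))"
        using U(1,2) V(1,2) by (intro exI[of _ "U \<inter> V"]) auto
    qed
  qed
qed

section \<open>Tangent vectors in local coordinates\<close>

lemma has_derivative_transform_local:
  assumes "open U" "s \<in> U" "s \<in> S" "\<And>x. x \<in> S \<inter> U \<Longrightarrow> f x = g x" "(f has_derivative D) (at s within S)"
  shows "(g has_derivative D) (at s within S)"
proof -
  have at: "at s within S \<inter> U = at s within S" by (rule at_within_nhd[OF assms(2,1)]) auto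
  have "(g has_derivative D) (at s within S \<inter> U)"
    by (rule has_derivative_transform[where f=f]) (use assms at in auto)
  then show ?thesis unfolding at .
qed

lemma smooth_on_open_has_derivative:
  assumes "smooth_on S f" "open S" "x \<in> S"
  shows "(f has_derivative frechet_derivative f (at x)) (at x)"
proof -
  obtain f' where "(f has_derivative f' x) (at x within S)"
    using smooth_on_derivative[OF thick_open[OF assms(2)] assms(1)] assms(3) by metis
  then have "(f has_derivative f' x) (at x)" using at_within_open[OF assms(3,2)] by simp
  then show ?thesis using frechet_derivative_at by metis
qed

lemma smooth_on_frechet_derivative:
  assumes "smooth_on S f" "open S"
  shows "smooth_on S (\<lambda>x. frechet_derivative f (at x) v)"
proof -
  obtain f' where f': "\<And>x. x \<in> S \<Longrightarrow> (f has_derivative f' x) (at x within S)"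
    "\<And>v. smooth_on S (\<lambda>x. f' x v)"
    using smooth_on_derivative[OF thick_open[OF assms(2)] assms(1)] by metis
  have "f' x v = frechet_derivative f (at x) v" if "x \<in> S" for x
    using f'(1)[OF that] at_within_open[OF that assms(2)] frechet_derivative_at by metis
  then show ?thesis by (rule smooth_on_cong[OF _ f'(2)[of v]])
qed

text \<open>\<open>vector_derivative\<close> picks some derivative; on a thick set there is only
  one, so the velocities built from it can be computed.\<close>

lemma thick_vector_derivative:
  assumes "thick J" "t \<in> J" "(f has_vector_derivative y) (at t within J)"
  shows "vector_derivative f (at t within J) = y"
proof -
  have "(f has_vector_derivative vector_derivative f (at t within J)) (at t within J)"
    unfolding vector_derivative_def by (rule someI) fact
  then have "(\<lambda>x. x *\<^sub>R vector_derivative f (at t within J)) = (\<lambda>x. x *\<^sub>R y)"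
    using thick_derivative_unique[OF assms(1,2)] assms(3) unfolding has_vector_derivative_def by blast
  then show ?thesis by (metis scaleR_one)
qed

sublocale smooth_manifold \<subseteq> atlas M A
proof
  show "\<exists>c\<in>A. x \<in> chart_dom c" if "x \<in> M" for x using that charts_cover by blast
qed (use chart_dom_subset chart_inj chart_overlap_open in auto)

context smooth_manifold
begin

lemma findim_model: "findim TYPE('e)"
  using finite_dimensional unfolding findim_def .

text \<open>The chain rule through a chart: as long as \<open>H\<close> stays in the chart domain,
  \<open>chart_inv d\<close> undoes \<open>chart_map d\<close>, and \<open>f\<close> after
  \<open>H\<close> is the coordinate form of \<open>f\<close> after that of
  \<open>H\<close>.\<close>

lemma has_derivative_via_chart:
  fixes H :: "'s::real_normed_vector \<Rightarrow> 'm" and f :: "'m \<Rightarrow> 'b::real_normed_vector"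
  assumes d: "d \<in> A" and U: "open U" "s \<in> U" "H ` (S \<inter> U) \<subseteq> chart_dom d" and s: "s \<in> S"
    and H: "((\<lambda>s. chart_map d (H s)) has_derivative D) (at s within S)"
    and f: "((f \<circ> chart_inv d) has_derivative D') (at (chart_map d (H s)))"
  shows "((\<lambda>s. f (H s)) has_derivative (\<lambda>v. D' (D v))) (at s within S)"
proof (rule has_derivative_transform_local[OF U(1,2) s])
  show "((\<lambda>s. (f \<circ> chart_inv d) (chart_map d (H s))) has_derivative (\<lambda>v. D' (D v))) (at s within S)"
    by (rule has_derivative_compose[OF H f])
  show "(f \<circ> chart_inv d) (chart_map d (H x)) = f (H x)" if "x \<in> S \<inter> U" for x
    using that U(3) chart_inv_map[OF d, of "H x"] by auto
qed

section \<open>Transition derivatives and coordinates of tangent vectors\<close>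

lemma transition_has_derivative:
  assumes "c \<in> A" "d \<in> A" "x \<in> chart_dom c" "x \<in> chart_dom d"
  shows "((chart_map d \<circ> chart_inv c) has_derivative
    frechet_derivative (chart_map d \<circ> chart_inv c) (at (chart_map c x))) (at (chart_map c x))"
  by (rule smooth_on_open_has_derivative[OF transition_smooth[OF assms(1,2)] overlap_open[OF assms(1,2)]])
    (use assms in auto)

lemma frechet_via_chart:
  fixes f :: "'m \<Rightarrow> 'b::real_normed_vector"
  assumes cd: "c \<in> A" "d \<in> A" "x \<in> chart_dom c" "x \<in> chart_dom d"
    and f: "((f \<circ> chart_inv d) has_derivative D') (at (chart_map d x))"
  shows "((f \<circ> chart_inv c) has_derivative
    (\<lambda>v. D' (frechet_derivative (chart_map d \<circ> chart_inv c) (at (chart_map c x)) v))) (at (chart_map c x))"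
proof -
  let ?U = "chart_map c ` (chart_dom c \<inter> chart_dom d)"
  have "((\<lambda>s. f (chart_inv c s)) has_derivative
    (\<lambda>v. D' (frechet_derivative (chart_map d \<circ> chart_inv c) (at (chart_map c x)) v))) (at (chart_map c x) within UNIV)"
  proof (rule has_derivative_via_chart[OF cd(2) overlap_open[OF cd(1,2)]])
    show "chart_map c x \<in> ?U" using cd by blast
    show "chart_inv c ` (UNIV \<inter> ?U) \<subseteq> chart_dom d"
      using chart_inv_map[OF cd(1)] by auto
    show "((\<lambda>s. chart_map d (chart_inv c s)) has_derivative
      frechet_derivative (chart_map d \<circ> chart_inv c) (at (chart_map c x))) (at (chart_map c x) within UNIV)"
      using transition_has_derivative[OF cd] by (simp add: o_def)
    show "((f \<circ> chart_inv d) has_derivative D') (at (chart_map d (chart_inv c (chart_map c x))))"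
      using f chart_inv_map[OF cd(1,3)] by simp
  qed simp
  then show ?thesis by (simp add: o_def)
qed

lemma transition_self:
  assumes "c \<in> A" "x \<in> chart_dom c"
  shows "frechet_derivative (chart_map c \<circ> chart_inv c) (at (chart_map c x)) u = u"
proof -
  have "((chart_map c \<circ> chart_inv c) has_derivative (\<lambda>v. v)) (at (chart_map c x) within UNIV)"
    by (rule has_derivative_transform_local[OF open_chart_image[OF assms(1)], where f="\<lambda>x. x"])
      (use assms chart_map_inv in \<open>auto simp: chart_inv_map\<close>)
  then show ?thesis using frechet_derivative_at by metis
qed

text \<open>The chain rule for transition maps. Through it \<open>tvec_of\<close>, built from a
  single chart, satisfies the compatibility condition between all pairs of charts.\<close>

lemma transition_cocycle:
  assumes "c \<in> A" "d \<in> A" "k \<in> A" "x \<in> chart_dom c" "x \<in> chart_dom d" "x \<in> chart_dom k"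
  shows "frechet_derivative (chart_map k \<circ> chart_inv d) (at (chart_map d x))
      (frechet_derivative (chart_map d \<circ> chart_inv c) (at (chart_map c x)) u) =
    frechet_derivative (chart_map k \<circ> chart_inv c) (at (chart_map c x)) u"
proof -
  have "((chart_map k \<circ> chart_inv c) has_derivative
    (\<lambda>v. frechet_derivative (chart_map k \<circ> chart_inv d) (at (chart_map d x))
      (frechet_derivative (chart_map d \<circ> chart_inv c) (at (chart_map c x)) v))) (at (chart_map c x))"
    by (rule frechet_via_chart[OF assms(1,2,4,5) transition_has_derivative[OF assms(2,3,5,6)]])
  then show ?thesis using frechet_derivative_at by metis
qed

lemma transition_linear:
  assumes "c \<in> A" "d \<in> A" "x \<in> chart_dom c" "x \<in> chart_dom d"
  shows "linear (frechet_derivative (chart_map d \<circ> chart_inv c) (at (chart_map c x)))"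
  using transition_has_derivative[OF assms] has_derivative_linear by blast

lemma tangent_space_coord:
  assumes "w \<in> tangent_space A x" "c \<in> A" "d \<in> A" "x \<in> chart_dom c" "x \<in> chart_dom d"
  shows "w d = frechet_derivative (chart_map d \<circ> chart_inv c) (at (chart_map c x)) (w c)"
  using assms unfolding tangent_space_def by blast

lemma tangent_space_outside:
  "w \<in> tangent_space A x \<Longrightarrow> \<not> (d \<in> A \<and> x \<in> chart_dom d) \<Longrightarrow> w d = 0"
  unfolding tangent_space_def by blast

lemma tangent_spaceI:
  assumes "\<And>c d. c \<in> A \<Longrightarrow> d \<in> A \<Longrightarrow> x \<in> chart_dom c \<Longrightarrow> x \<in> chart_dom d \<Longrightarrow>
      w d = frechet_derivative (chart_map d \<circ> chart_inv c) (at (chart_map c x)) (w c)"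
    and "\<And>d. \<not> (d \<in> A \<and> x \<in> chart_dom d) \<Longrightarrow> w d = 0"
  shows "w \<in> tangent_space A x"
  unfolding tangent_space_def by (intro CollectI conjI ballI allI impI) (fact assms)+

lemma tvec_of_coord:
  assumes "c \<in> A" "d \<in> A" "x \<in> chart_dom c" "x \<in> chart_dom d"
  shows "tvec_of A c x u d = frechet_derivative (chart_map d \<circ> chart_inv c) (at (chart_map c x)) u"
  using assms unfolding tvec_of_def by simp

lemma tvec_of_self: "c \<in> A \<Longrightarrow> x \<in> chart_dom c \<Longrightarrow> tvec_of A c x u c = u"
  by (simp add: tvec_of_coord transition_self)

lemma tvec_of_in:
  assumes "c \<in> A" "x \<in> chart_dom c"
  shows "tvec_of A c x u \<in> tangent_space A x"
proof (rule tangent_spaceI)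
  show "tvec_of A c x u k = frechet_derivative (chart_map k \<circ> chart_inv d) (at (chart_map d x)) (tvec_of A c x u d)"
    if dk: "d \<in> A" "k \<in> A" "x \<in> chart_dom d" "x \<in> chart_dom k" for d k
    using transition_cocycle[OF assms(1) dk(1,2) assms(2) dk(3,4), of u] assms dk
    by (simp add: tvec_of_coord)
qed (auto simp: tvec_of_def)

lemma tvec_of_eq:
  assumes "w \<in> tangent_space A x" "c \<in> A" "x \<in> chart_dom c"
  shows "tvec_of A c x (w c) = w"
proof
  fix d
  show "tvec_of A c x (w c) d = w d"
    using tangent_space_coord[OF assms(1,2) _ assms(3)] tangent_space_outside[OF assms(1)]
    by (auto simp: tvec_of_def)
qed

text \<open>One coordinate representation determines all the others. Equations between tangent
  vectors are therefore checked in a single convenient chart.\<close>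

lemma tvec_eqI:
  assumes "w \<in> tangent_space A x" "w' \<in> tangent_space A x" "c \<in> A" "x \<in> chart_dom c" "w c = w' c"
  shows "w = w'"
  using tvec_of_eq[OF assms(1,3,4)] tvec_of_eq[OF assms(2,3,4)] assms(5) by metis

lemma tvec_add_in: "v \<in> tangent_space A x \<Longrightarrow> w \<in> tangent_space A x \<Longrightarrow> tvec_add v w \<in> tangent_space A x"
  unfolding tvec_add_def
proof (rule tangent_spaceI)
  fix c d assume vw: "v \<in> tangent_space A x" "w \<in> tangent_space A x"
    and cd: "c \<in> A" "d \<in> A" "x \<in> chart_dom c" "x \<in> chart_dom d"
  show "v d + w d = frechet_derivative (chart_map d \<circ> chart_inv c) (at (chart_map c x)) (v c + w c)"
    unfolding linear_add[OF transition_linear[OF cd]]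
    using tangent_space_coord[OF vw(1) cd] tangent_space_coord[OF vw(2) cd] by simp
qed (simp add: tangent_space_outside)

lemma tvec_diff_in: "v \<in> tangent_space A x \<Longrightarrow> w \<in> tangent_space A x \<Longrightarrow> tvec_diff v w \<in> tangent_space A x"
  unfolding tvec_diff_def
proof (rule tangent_spaceI)
  fix c d assume vw: "v \<in> tangent_space A x" "w \<in> tangent_space A x"
    and cd: "c \<in> A" "d \<in> A" "x \<in> chart_dom c" "x \<in> chart_dom d"
  show "v d - w d = frechet_derivative (chart_map d \<circ> chart_inv c) (at (chart_map c x)) (v c - w c)"
    unfolding linear_diff[OF transition_linear[OF cd]]
    using tangent_space_coord[OF vw(1) cd] tangent_space_coord[OF vw(2) cd] by simp
qed (simp add: tangent_space_outside)

lemma tvec_scale_in: "v \<in> tangent_space A x \<Longrightarrow> tvec_scale r v \<in> tangent_space A x"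
  unfolding tvec_scale_def
proof (rule tangent_spaceI)
  fix c d assume v: "v \<in> tangent_space A x"
    and cd: "c \<in> A" "d \<in> A" "x \<in> chart_dom c" "x \<in> chart_dom d"
  show "r *\<^sub>R v d = frechet_derivative (chart_map d \<circ> chart_inv c) (at (chart_map c x)) (r *\<^sub>R v c)"
    unfolding linear_scale[OF transition_linear[OF cd]]
    using tangent_space_coord[OF v cd] by simp
qed (simp add: tangent_space_outside)

lemma tvec_of_add:
  assumes "c \<in> A" "x \<in> chart_dom c"
  shows "tvec_of A c x (u + v) = tvec_add (tvec_of A c x u) (tvec_of A c x v)"
  by (rule tvec_eqI[OF tvec_of_in[OF assms] tvec_add_in[OF tvec_of_in[OF assms] tvec_of_in[OF assms]] assms])
    (simp add: tvec_of_self[OF assms] tvec_add_def)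

lemma tvec_of_scale:
  assumes "c \<in> A" "x \<in> chart_dom c"
  shows "tvec_of A c x (r *\<^sub>R u) = tvec_scale r (tvec_of A c x u)"
  by (rule tvec_eqI[OF tvec_of_in[OF assms] tvec_scale_in[OF tvec_of_in[OF assms]] assms])
    (simp add: tvec_of_self[OF assms] tvec_scale_def)

section \<open>Covectors and their coordinates\<close>

lemma cotangent_add: "p \<in> cotangent_space A x \<Longrightarrow> v \<in> tangent_space A x \<Longrightarrow> w \<in> tangent_space A x \<Longrightarrow>
    p (tvec_add v w) = p v + p w"
  unfolding cotangent_space_def by blast

lemma cotangent_scale: "p \<in> cotangent_space A x \<Longrightarrow> v \<in> tangent_space A x \<Longrightarrow> p (tvec_scale r v) = r * p v"
  unfolding cotangent_space_def by blast

lemma cotangent_outside: "p \<in> cotangent_space A x \<Longrightarrow> v \<notin> tangent_space A x \<Longrightarrow> p v = 0"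
  unfolding cotangent_space_def by blast

lemma cotangent_coord_bounded_linear:
  assumes p: "p \<in> cotangent_space A x" and c: "c \<in> A" "x \<in> chart_dom c"
  shows "bounded_linear (\<lambda>u. p (tvec_of A c x u))"
  by (rule findim_linear_bounded[OF findim_model], rule linearI)
    (use assms in \<open>auto simp: tvec_of_add tvec_of_scale cotangent_add cotangent_scale tvec_of_in\<close>)

lemma covec_coord_apply:
  assumes "p \<in> cotangent_space A x" "c \<in> A" "x \<in> chart_dom c"
  shows "blinfun_apply (covec_coord A c x p) u = p (tvec_of A c x u)"
  unfolding covec_coord_def
  by (subst bounded_linear_Blinfun_apply[OF cotangent_coord_bounded_linear[OF assms]]) simp

lemma covec_eqI:
  assumes p: "p \<in> cotangent_space A x" "p' \<in> cotangent_space A x" and c: "c \<in> A" "x \<in> chart_dom c"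
    and eq: "covec_coord A c x p = covec_coord A c x p'"
  shows "p = p'"
proof
  fix w
  show "p w = p' w"
  proof (cases "w \<in> tangent_space A x")
    case True
    then show ?thesis
      using covec_coord_apply[OF p(1) c, of "w c"] covec_coord_apply[OF p(2) c, of "w c"] eq
      by (simp add: tvec_of_eq c)
  qed (simp add: cotangent_outside[OF p(1)] cotangent_outside[OF p(2)])
qed

text \<open>The inverse of \<open>covec_coord\<close>. The value 0 off the tangent space is the
  normalization that \<open>cotangent_space\<close> prescribes.\<close>

definition covec_of :: "('m, 'e) chart \<Rightarrow> 'm \<Rightarrow> ('e \<Rightarrow> real) \<Rightarrow> ('m, 'e) tvec \<Rightarrow> real" where
  "covec_of c x \<beta> w = (if w \<in> tangent_space A x then \<beta> (w c) else 0)"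

lemma covec_of_in:
  assumes "linear \<beta>"
  shows "covec_of c x \<beta> \<in> cotangent_space A x"
  unfolding cotangent_space_def
proof (intro CollectI conjI ballI allI impI)
  show "covec_of c x \<beta> (tvec_add v w) = covec_of c x \<beta> v + covec_of c x \<beta> w"
    if "v \<in> tangent_space A x" "w \<in> tangent_space A x" for v w
    using that tvec_add_in[OF that] by (simp add: covec_of_def tvec_add_def linear_add[OF assms])
  show "covec_of c x \<beta> (tvec_scale r v) = r * covec_of c x \<beta> v" if "v \<in> tangent_space A x" for r v
    using that tvec_scale_in[OF that] by (simp add: covec_of_def tvec_scale_def linear_scale[OF assms])
qed (simp add: covec_of_def)

lemma covec_coord_covec_of:
  assumes c: "c \<in> A" "x \<in> chart_dom c"
  shows "covec_coord A c x (covec_of c x (blinfun_apply \<beta>)) = \<beta>"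
proof (rule blinfun_eqI)
  have "covec_of c x (blinfun_apply \<beta>) \<in> cotangent_space A x"
    by (rule covec_of_in) (simp add: blinfun.bounded_linear_right bounded_linear.linear)
  then show "covec_coord A c x (covec_of c x (blinfun_apply \<beta>)) u = \<beta> u" for u
    using c by (simp add: covec_coord_apply covec_of_def tvec_of_in tvec_of_self)
qed

subsection \<open>Velocities and tangent maps\<close>

lemma velocity_has_vector_derivative:
  assumes J: "thick J" and t: "t \<in> J" and \<gamma>: "smooth_into J M A \<gamma>" and c: "c \<in> A" "\<gamma> t \<in> chart_dom c"
  shows "((\<lambda>t. chart_map c (\<gamma> t)) has_vector_derivative velocity A J \<gamma> t c) (at t within J)"
proof -
  obtain U where U: "open U" "t \<in> U" "\<gamma> ` (J \<inter> U) \<subseteq> chart_dom c"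
    "smooth_on (J \<inter> U) (\<lambda>t. chart_map c (\<gamma> t))" using smooth_intoD[OF \<gamma> t c] by blast
  have at: "at t within J \<inter> U = at t within J" by (rule at_within_nhd[OF U(2,1)]) auto
  obtain f' where f': "((\<lambda>t. chart_map c (\<gamma> t)) has_derivative f' t) (at t within J)"
    using smooth_on_derivative[OF thick_Int_open[OF J U(1)] U(4)] t U(2) at by (metis IntI)
  have "f' t = (\<lambda>x. x *\<^sub>R f' t 1)"
  proof
    show "f' t x = x *\<^sub>R f' t 1" for x
      using linear_scale[OF has_derivative_linear[OF f'], of x 1] by simp
  qed
  then have der: "((\<lambda>t. chart_map c (\<gamma> t)) has_vector_derivative f' t 1) (at t within J)"
    using f' unfolding has_vector_derivative_def by simp
  then have "velocity A J \<gamma> t c = f' t 1"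
    using thick_vector_derivative[OF J t der] c by (simp add: velocity_def o_def)
  with der show ?thesis by simp
qed

lemma velocity_in:
  assumes J: "thick J" and t: "t \<in> J" and \<gamma>: "smooth_into J M A \<gamma>"
  shows "velocity A J \<gamma> t \<in> tangent_space A (\<gamma> t)"
  unfolding tangent_space_def
proof (intro CollectI conjI ballI allI impI)
  fix c d assume cd: "c \<in> A" "d \<in> A" "\<gamma> t \<in> chart_dom c" "\<gamma> t \<in> chart_dom d"
  obtain U where U: "open U" "t \<in> U" "\<gamma> ` (J \<inter> U) \<subseteq> chart_dom c"
    using smooth_intoD[OF \<gamma> t cd(1,3)] by blast
  have "((\<lambda>t. chart_map d (\<gamma> t)) has_derivative
    (\<lambda>v. frechet_derivative (chart_map d \<circ> chart_inv c) (at (chart_map c (\<gamma> t))) (v *\<^sub>R velocity A J \<gamma> t c))) (at t within J)"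
    by (rule has_derivative_via_chart[OF cd(1) U t
          velocity_has_vector_derivative[OF J t \<gamma> cd(1,3), unfolded has_vector_derivative_def]
          transition_has_derivative[OF cd]])
  then have "((\<lambda>t. chart_map d (\<gamma> t)) has_vector_derivative
    frechet_derivative (chart_map d \<circ> chart_inv c) (at (chart_map c (\<gamma> t))) (velocity A J \<gamma> t c)) (at t within J)"
    unfolding has_vector_derivative_def by (simp add: linear_scale[OF transition_linear[OF cd]])
  then show "velocity A J \<gamma> t d =
      frechet_derivative (chart_map d \<circ> chart_inv c) (at (chart_map c (\<gamma> t))) (velocity A J \<gamma> t c)"
    using thick_vector_derivative[OF J t] cd by (simp add: velocity_def o_def)
qed (auto simp: velocity_def)

text \<open>The neighbourhood clause keeps the image of \<open>F\<close> in the target chart near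
  \<open>x\<close>. Outside its domain a coordinate map has arbitrary values, so differentiability
  of the coordinate expression alone would say little about \<open>F\<close>.\<close>

definition differentiable_map_at :: "('m \<Rightarrow> 'm) \<Rightarrow> 'm \<Rightarrow> bool" where
  "differentiable_map_at F x \<longleftrightarrow> x \<in> M \<and> F x \<in> M \<and>
     (\<forall>c\<in>A. \<forall>d\<in>A. x \<in> chart_dom c \<longrightarrow> F x \<in> chart_dom d \<longrightarrow>
       (\<exists>U. open U \<and> chart_map c x \<in> U \<and> U \<subseteq> chart_map c ` chart_dom c \<and> (\<forall>y\<in>U. F (chart_inv c y) \<in> chart_dom d)) \<and>
       (chart_map d \<circ> F \<circ> chart_inv c) differentiable at (chart_map c x))"

lemma differentiable_map_atD:
  assumes "differentiable_map_at F x" "c \<in> A" "d \<in> A" "x \<in> chart_dom c" "F x \<in> chart_dom d"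
  shows "(chart_map d \<circ> F \<circ> chart_inv c has_derivative
      frechet_derivative (chart_map d \<circ> F \<circ> chart_inv c) (at (chart_map c x))) (at (chart_map c x))"
    and "\<exists>U. open U \<and> chart_map c x \<in> U \<and> U \<subseteq> chart_map c ` chart_dom c \<and> (\<forall>y\<in>U. F (chart_inv c y) \<in> chart_dom d)"
  using assms unfolding differentiable_map_at_def frechet_derivative_works[symmetric] by blast+

text \<open>\<open>tangent_map\<close> computes in a chart picked by choice. Passing to
  \<open>c\<close> inserts a transition derivative into the derivative of \<open>F\<close>, which
  the transformation rule of \<open>w\<close> absorbs.\<close>

lemma tangent_map_coord:
  assumes F: "differentiable_map_at F x" and w: "w \<in> tangent_space A x"
    and c: "c \<in> A" "x \<in> chart_dom c" and d: "d \<in> A" "F x \<in> chart_dom d"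
  shows "tangent_map A A F x w d = frechet_derivative (chart_map d \<circ> F \<circ> chart_inv c) (at (chart_map c x)) (w c)"
proof -
  define b where "b = (SOME c. c \<in> A \<and> x \<in> chart_dom c)"
  have b: "b \<in> A" "x \<in> chart_dom b"
    using someI[of "\<lambda>c. c \<in> A \<and> x \<in> chart_dom c" c] c unfolding b_def by auto
  have "(((chart_map d \<circ> F) \<circ> chart_inv c) has_derivative
    (\<lambda>v. frechet_derivative (chart_map d \<circ> F \<circ> chart_inv b) (at (chart_map b x))
      (frechet_derivative (chart_map b \<circ> chart_inv c) (at (chart_map c x)) v))) (at (chart_map c x))"
    by (rule frechet_via_chart[OF c(1) b(1) c(2) b(2) differentiable_map_atD(1)[OF F b(1) d(1) b(2) d(2)]])
  then have "frechet_derivative (chart_map d \<circ> F \<circ> chart_inv c) (at (chart_map c x)) (w c) =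
      frechet_derivative (chart_map d \<circ> F \<circ> chart_inv b) (at (chart_map b x)) (w b)"
    using tangent_space_coord[OF w c(1) b(1) c(2) b(2)] frechet_derivative_at by metis
  then show ?thesis unfolding tangent_map_def Let_def b_def[symmetric] using d by simp
qed

text \<open>\<open>K\<close> has to agree with the composite on \<open>M\<close> only, because the
  group laws to which this is applied hold only on the carrier.\<close>

lemma differentiable_map_comp_has_derivative:
  assumes F: "differentiable_map_at F x" and H: "differentiable_map_at H (F x)"
    and K: "\<And>y. y \<in> M \<Longrightarrow> K y = H (F y)"
    and c: "c \<in> A" "x \<in> chart_dom c" and d: "d \<in> A" "F x \<in> chart_dom d" and k: "k \<in> A" "K x \<in> chart_dom k"
  shows "((chart_map k \<circ> K \<circ> chart_inv c) has_derivative
      (\<lambda>v. frechet_derivative (chart_map k \<circ> H \<circ> chart_inv d) (at (chart_map d (F x)))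
        (frechet_derivative (chart_map d \<circ> F \<circ> chart_inv c) (at (chart_map c x)) v))) (at (chart_map c x))"
proof -
  have x: "x \<in> M" using F unfolding differentiable_map_at_def by blast
  have Hk: "H (F x) \<in> chart_dom k" using k(2) K[OF x] by simp
  obtain U where U: "open U" "chart_map c x \<in> U" "U \<subseteq> chart_map c ` chart_dom c"
    "\<forall>y\<in>U. F (chart_inv c y) \<in> chart_dom d"
    using differentiable_map_atD(2)[OF F c(1) d(1) c(2) d(2)] by blast
  have *: "((\<lambda>s. (chart_map k \<circ> H) (F (chart_inv c s))) has_derivative
      (\<lambda>v. frechet_derivative (chart_map k \<circ> H \<circ> chart_inv d) (at (chart_map d (F x)))
        (frechet_derivative (chart_map d \<circ> F \<circ> chart_inv c) (at (chart_map c x)) v))) (at (chart_map c x) within UNIV)"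
  proof (rule has_derivative_via_chart[where f="chart_map k \<circ> H" and H="\<lambda>s. F (chart_inv c s)"
      and D="frechet_derivative (chart_map d \<circ> F \<circ> chart_inv c) (at (chart_map c x))", OF d(1) U(1,2)])
    show "(\<lambda>s. F (chart_inv c s)) ` (UNIV \<inter> U) \<subseteq> chart_dom d" using U(4) by blast
    show "((\<lambda>s. chart_map d (F (chart_inv c s))) has_derivative
        frechet_derivative (chart_map d \<circ> F \<circ> chart_inv c) (at (chart_map c x))) (at (chart_map c x) within UNIV)"
      using differentiable_map_atD(1)[OF F c(1) d(1) c(2) d(2)] by (simp add: o_def)
    show "(chart_map k \<circ> H \<circ> chart_inv d has_derivative
        frechet_derivative (chart_map k \<circ> H \<circ> chart_inv d) (at (chart_map d (F x))))
        (at (chart_map d (F (chart_inv c (chart_map c x)))))"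
      unfolding chart_inv_map[OF c] by (rule differentiable_map_atD(1)[OF H d(1) k(1) d(2) Hk])
  qed simp
  have "((chart_map k \<circ> K \<circ> chart_inv c) has_derivative
      (\<lambda>v. frechet_derivative (chart_map k \<circ> H \<circ> chart_inv d) (at (chart_map d (F x)))
        (frechet_derivative (chart_map d \<circ> F \<circ> chart_inv c) (at (chart_map c x)) v))) (at (chart_map c x) within UNIV)"
  proof (rule has_derivative_transform_local[OF U(1,2) _ _ *])
    fix y assume "y \<in> UNIV \<inter> U"
    then have "y \<in> chart_map c ` chart_dom c" using U(3) by blast
    then have "chart_inv c y \<in> M" using chart_inv_dom[of y c] dom_subset[OF c(1)] by blast
    from K[OF this] show "(chart_map k \<circ> H) (F (chart_inv c y)) = (chart_map k \<circ> K \<circ> chart_inv c) y" by simp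
  qed (rule UNIV_I)
  then show ?thesis .
qed

lemma differentiable_map_at_id:
  assumes "x \<in> M"
  shows "differentiable_map_at (\<lambda>x. x) x"
  unfolding differentiable_map_at_def
proof (intro conjI ballI impI)
  fix c d assume cd: "c \<in> A" "d \<in> A" "x \<in> chart_dom c" "x \<in> chart_dom d"
  let ?U = "chart_map c ` (chart_dom c \<inter> chart_dom d)"
  have "chart_inv c y \<in> chart_dom d" if "y \<in> ?U" for y
    using that chart_inv_map[OF cd(1)] by auto
  then have "open ?U \<and> chart_map c x \<in> ?U \<and> ?U \<subseteq> chart_map c ` chart_dom c \<and> (\<forall>y\<in>?U. chart_inv c y \<in> chart_dom d)"
    using cd overlap_open[OF cd(1,2)] by blast
  then show "\<exists>U. open U \<and> chart_map c x \<in> U \<and> U \<subseteq> chart_map c ` chart_dom c \<and> (\<forall>y\<in>U. chart_inv c y \<in> chart_dom d)"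
    by (rule exI)
  show "(chart_map d \<circ> (\<lambda>x. x) \<circ> chart_inv c) differentiable at (chart_map c x)"
    using differentiableI[OF transition_has_derivative[OF cd]] by (simp add: o_def)
qed (rule assms)+

lemma tangent_map_in:
  assumes F: "differentiable_map_at F x" and w: "w \<in> tangent_space A x"
  shows "tangent_map A A F x w \<in> tangent_space A (F x)"
  unfolding tangent_space_def
proof (intro CollectI conjI ballI allI impI)
  have x: "x \<in> M" "F x \<in> M" using F unfolding differentiable_map_at_def by auto
  obtain c where c: "c \<in> A" "x \<in> chart_dom c" using cover x by blast
  fix d k assume dk: "d \<in> A" "k \<in> A" "F x \<in> chart_dom d" "F x \<in> chart_dom k"
  \<comment> \<open>With the identity as second factor, the composition rule becomes the
    transformation rule between the charts \<open>d\<close> and \<open>k\<close>.\<close>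
  have "((chart_map k \<circ> F \<circ> chart_inv c) has_derivative
      (\<lambda>v. frechet_derivative (chart_map k \<circ> (\<lambda>x. x) \<circ> chart_inv d) (at (chart_map d (F x)))
        (frechet_derivative (chart_map d \<circ> F \<circ> chart_inv c) (at (chart_map c x)) v))) (at (chart_map c x))"
    by (rule differentiable_map_comp_has_derivative[OF F differentiable_map_at_id[OF x(2)]])
      (use c dk in auto)
  then have "frechet_derivative (chart_map k \<circ> F \<circ> chart_inv c) (at (chart_map c x)) (w c) =
      frechet_derivative (chart_map k \<circ> (\<lambda>x. x) \<circ> chart_inv d) (at (chart_map d (F x)))
        (frechet_derivative (chart_map d \<circ> F \<circ> chart_inv c) (at (chart_map c x)) (w c))"
    using frechet_derivative_at by metis
  then show "tangent_map A A F x w k = frechet_derivative (chart_map k \<circ> chart_inv d) (at (chart_map d (F x)))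
      (tangent_map A A F x w d)"
    using tangent_map_coord[OF F w c dk(1,3)] tangent_map_coord[OF F w c dk(2,4)] by (simp add: o_def)
qed (auto simp: tangent_map_def Let_def)

lemma tangent_map_id:
  assumes x: "x \<in> M" and w: "w \<in> tangent_space A x"
  shows "tangent_map A A (\<lambda>x. x) x w = w"
proof -
  obtain c where c: "c \<in> A" "x \<in> chart_dom c" using cover x by blast
  have "tangent_map A A (\<lambda>x. x) x w c = w c"
    using tangent_map_coord[OF differentiable_map_at_id[OF x] w c c] transition_self[OF c] by (simp add: o_def)
  then show ?thesis
    using tvec_eqI[OF tangent_map_in[OF differentiable_map_at_id[OF x] w] w c] by blast
qed

lemma tangent_map_comp:
  assumes F: "differentiable_map_at F x" and H: "differentiable_map_at H (F x)" and K: "differentiable_map_at K x"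
    and eq: "\<And>y. y \<in> M \<Longrightarrow> K y = H (F y)" and w: "w \<in> tangent_space A x"
  shows "tangent_map A A H (F x) (tangent_map A A F x w) = tangent_map A A K x w"
proof -
  have x: "x \<in> M" "F x \<in> M" "K x \<in> M" using F K unfolding differentiable_map_at_def by auto
  obtain c where c: "c \<in> A" "x \<in> chart_dom c" using cover x by blast
  obtain d where d: "d \<in> A" "F x \<in> chart_dom d" using cover x by blast
  obtain k where k: "k \<in> A" "K x \<in> chart_dom k" using cover x by blast
  have Hk: "H (F x) \<in> chart_dom k" using k eq x by simp
  have "frechet_derivative (chart_map k \<circ> K \<circ> chart_inv c) (at (chart_map c x)) (w c) =
      frechet_derivative (chart_map k \<circ> H \<circ> chart_inv d) (at (chart_map d (F x)))
        (frechet_derivative (chart_map d \<circ> F \<circ> chart_inv c) (at (chart_map c x)) (w c))"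
    using differentiable_map_comp_has_derivative[OF F H eq c d k] frechet_derivative_at by metis
  then have "tangent_map A A H (F x) (tangent_map A A F x w) k = tangent_map A A K x w k"
    using tangent_map_coord[OF H tangent_map_in[OF F w] d k(1) Hk] tangent_map_coord[OF F w c d]
      tangent_map_coord[OF K w c k] by simp
  moreover have "tangent_map A A H (F x) (tangent_map A A F x w) \<in> tangent_space A (K x)"
    using tangent_map_in[OF H tangent_map_in[OF F w]] eq[OF x(1)] by simp
  ultimately show ?thesis using tvec_eqI[OF _ tangent_map_in[OF K w] k] by blast
qed

text \<open>The chart picked inside \<open>tangent_map\<close> depends on \<open>x\<close> but not
  on the vector, so linearity holds for arbitrary families of coordinates, tangent or not.\<close>

lemma tangent_map_linear:
  assumes F: "differentiable_map_at F x"
  shows "tangent_map A A F x (tvec_add v w) = tvec_add (tangent_map A A F x v) (tangent_map A A F x w)"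
    and "tangent_map A A F x (tvec_diff v w) = tvec_diff (tangent_map A A F x v) (tangent_map A A F x w)"
    and "tangent_map A A F x (tvec_scale r v) = tvec_scale r (tangent_map A A F x v)"
    and "tangent_map A A F x tvec_zero = tvec_zero"
proof -
  define b where "b = (SOME c. c \<in> A \<and> x \<in> chart_dom c)"
  obtain c where c: "c \<in> A" "x \<in> chart_dom c"
    using F cover unfolding differentiable_map_at_def by blast
  have b: "b \<in> A" "x \<in> chart_dom b"
    using someI[of "\<lambda>c. c \<in> A \<and> x \<in> chart_dom c" c] c unfolding b_def by auto
  have lin: "linear (frechet_derivative (chart_map d \<circ> F \<circ> chart_inv b) (at (chart_map b x)))"
    if "d \<in> A" "F x \<in> chart_dom d" for d
    using differentiable_map_atD(1)[OF F b(1) that(1) b(2) that(2)] has_derivative_linear by blast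
  show "tangent_map A A F x (tvec_add v w) = tvec_add (tangent_map A A F x v) (tangent_map A A F x w)"
    and "tangent_map A A F x (tvec_diff v w) = tvec_diff (tangent_map A A F x v) (tangent_map A A F x w)"
    and "tangent_map A A F x (tvec_scale r v) = tvec_scale r (tangent_map A A F x v)"
    and "tangent_map A A F x tvec_zero = tvec_zero"
    unfolding tangent_map_def Let_def b_def[symmetric] tvec_add_def tvec_diff_def tvec_scale_def tvec_zero_def
    using lin by (auto intro!: ext simp: linear_add linear_diff linear_scale linear_0)
qed

lemma velocity_map:
  assumes J: "thick J" and t: "t \<in> J" and \<gamma>: "smooth_into J M A \<gamma>"
    and F: "differentiable_map_at F (\<gamma> t)" and F\<gamma>: "smooth_into J M A (\<lambda>t. F (\<gamma> t))"
  shows "velocity A J (\<lambda>t. F (\<gamma> t)) t = tangent_map A A F (\<gamma> t) (velocity A J \<gamma> t)"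
proof -
  have x: "\<gamma> t \<in> M" "F (\<gamma> t) \<in> M" using F unfolding differentiable_map_at_def by auto
  obtain c where c: "c \<in> A" "\<gamma> t \<in> chart_dom c" using cover x by blast
  obtain d where d: "d \<in> A" "F (\<gamma> t) \<in> chart_dom d" using cover x by blast
  obtain U where U: "open U" "t \<in> U" "\<gamma> ` (J \<inter> U) \<subseteq> chart_dom c"
    using smooth_intoD[OF \<gamma> t c] by blast
  have DF: "((chart_map d \<circ> F) \<circ> chart_inv c has_derivative
      frechet_derivative (chart_map d \<circ> F \<circ> chart_inv c) (at (chart_map c (\<gamma> t)))) (at (chart_map c (\<gamma> t)))"
    by (rule differentiable_map_atD(1)[OF F c(1) d(1) c(2) d(2)])
  have "((\<lambda>t. (chart_map d \<circ> F) (\<gamma> t)) has_derivative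
    (\<lambda>v. frechet_derivative (chart_map d \<circ> F \<circ> chart_inv c) (at (chart_map c (\<gamma> t))) (v *\<^sub>R velocity A J \<gamma> t c))) (at t within J)"
    by (rule has_derivative_via_chart[OF c(1) U t
          velocity_has_vector_derivative[OF J t \<gamma> c, unfolded has_vector_derivative_def] DF])
  then have "((\<lambda>t. chart_map d (F (\<gamma> t))) has_vector_derivative
    frechet_derivative (chart_map d \<circ> F \<circ> chart_inv c) (at (chart_map c (\<gamma> t))) (velocity A J \<gamma> t c)) (at t within J)"
    unfolding has_vector_derivative_def by (simp add: linear_scale[OF has_derivative_linear[OF DF]])
  from thick_vector_derivative[OF J t this]
  have "velocity A J (\<lambda>t. F (\<gamma> t)) t d = tangent_map A A F (\<gamma> t) (velocity A J \<gamma> t) d"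
    unfolding tangent_map_coord[OF F velocity_in[OF J t \<gamma>] c d] velocity_def[of A J "\<lambda>t. F (\<gamma> t)"]
    using d by (simp add: o_def)
  then show ?thesis
    using tvec_eqI[OF velocity_in[OF J t F\<gamma>] tangent_map_in[OF F velocity_in[OF J t \<gamma>]] d] by blast
qed

end

section \<open>Smooth fields along maps\<close>

context smooth_manifold
begin

text \<open>Produces manifold-valued maps from coordinate formulas: multiplication read in charts,
  left-invariant fields, and the variation with prescribed \<eta> are obtained in this way.\<close>

lemma smooth_into_chart_inv:
  assumes c: "c \<in> A" and T: "thick T" and f: "smooth_on T f" "f ` T \<subseteq> chart_map c ` chart_dom c"
  shows "smooth_into T M A (\<lambda>t. chart_inv c (f t))"
proof (rule smooth_intoI[OF T])
  fix t assume t: "t \<in> T"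
  have inv: "chart_inv c (f t) \<in> chart_dom c" "chart_map c (chart_inv c (f t)) = f t" if "t \<in> T" for t
  proof -
    have ft: "f t \<in> chart_map c ` chart_dom c" using f(2) that by blast
    show "chart_inv c (f t) \<in> chart_dom c" by (rule chart_inv_dom[OF ft])
    show "chart_map c (chart_inv c (f t)) = f t" by (rule chart_map_inv[OF ft])
  qed
  show "chart_inv c (f t) \<in> M" using inv(1)[OF t] dom_subset[OF c] by blast
  fix d assume d: "d \<in> A" "chart_inv c (f t) \<in> chart_dom d"
  let ?O = "chart_map c ` (chart_dom c \<inter> chart_dom d)"
  obtain W where W: "open W" "T \<inter> f -` ?O = T \<inter> W"
    using continuous_openin_preimage_gen[OF smooth_on_continuous[OF f(1)] overlap_open[OF c d(1)]]
    unfolding openin_open by blast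
  have "chart_map c (chart_inv c (f t)) \<in> ?O" using inv(1)[OF t] d(2) by blast
  then have tW: "t \<in> W" using W(2) t inv(2)[OF t] by auto
  have fW: "f ` (T \<inter> W) \<subseteq> ?O" using W(2) by blast
  have "smooth_on (T \<inter> W) (\<lambda>t. (chart_map d \<circ> chart_inv c) (f t))"
    by (rule smooth_on_compose[OF findim_model transition_smooth[OF c d(1)] smooth_on_subset[OF f(1)] fW]) simp
  moreover have "(\<lambda>t. chart_inv c (f t)) ` (T \<inter> W) \<subseteq> chart_dom d"
  proof (rule image_subsetI)
    fix u assume "u \<in> T \<inter> W"
    then have "f u \<in> ?O" using fW by blast
    then show "chart_inv c (f u) \<in> chart_dom d" using chart_inv_map[OF c] by auto
  qed
  ultimately show "\<exists>U. open U \<and> t \<in> U \<and> (\<lambda>t. chart_inv c (f t)) ` (T \<inter> U) \<subseteq> chart_dom d \<and>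
      smooth_on (T \<inter> U) (\<lambda>t. chart_map d (chart_inv c (f t)))"
    using W(1) tW by (intro exI[of _ W]) simp
qed

lemma smooth_into_const:
  assumes "thick S" "x \<in> M"
  shows "smooth_into S M A (\<lambda>_. x)"
  by (rule smooth_intoI[OF assms(1)]) (use assms(2) in \<open>auto intro!: exI[of _ UNIV] smooth_on_const\<close>)

text \<open>Vector fields along a map, that is, sections of the pulled-back tangent bundle. With a
  constant base map this is a curve or family in one tangent space, so that the trivialized and
  untrivialized principles share one notion.\<close>

definition smooth_field ::
    "'s::real_normed_vector set \<Rightarrow> ('s \<Rightarrow> 'm) \<Rightarrow> ('s \<Rightarrow> ('m, 'e) tvec) \<Rightarrow> bool" where
  "smooth_field S \<Gamma> w \<longleftrightarrow> (\<forall>s\<in>S. w s \<in> tangent_space A (\<Gamma> s)) \<and>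
     (\<forall>s\<in>S. \<forall>c\<in>A. \<Gamma> s \<in> chart_dom c \<longrightarrow>
       (\<exists>U. open U \<and> s \<in> U \<and> \<Gamma> ` (S \<inter> U) \<subseteq> chart_dom c \<and> smooth_on (S \<inter> U) (\<lambda>s. w s c)))"

text \<open>Smoothness is tested by pairing with vectors of constant coordinates, so that only
  real-valued functions occur.\<close>

definition smooth_cofield ::
    "'s::real_normed_vector set \<Rightarrow> ('s \<Rightarrow> 'm) \<Rightarrow> ('s \<Rightarrow> ('m, 'e) tvec \<Rightarrow> real) \<Rightarrow> bool" where
  "smooth_cofield S \<Gamma> q \<longleftrightarrow> (\<forall>s\<in>S. q s \<in> cotangent_space A (\<Gamma> s)) \<and>
     (\<forall>s\<in>S. \<forall>c\<in>A. \<Gamma> s \<in> chart_dom c \<longrightarrow>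
       (\<exists>U. open U \<and> s \<in> U \<and> \<Gamma> ` (S \<inter> U) \<subseteq> chart_dom c \<and>
         (\<forall>u. smooth_on (S \<inter> U) (\<lambda>s. q s (tvec_of A c (\<Gamma> s) u)))))"

lemma smooth_field_in: "smooth_field S \<Gamma> w \<Longrightarrow> s \<in> S \<Longrightarrow> w s \<in> tangent_space A (\<Gamma> s)"
  unfolding smooth_field_def by blast

lemma smooth_fieldD:
  "smooth_field S \<Gamma> w \<Longrightarrow> s \<in> S \<Longrightarrow> c \<in> A \<Longrightarrow> \<Gamma> s \<in> chart_dom c \<Longrightarrow>
    \<exists>U. open U \<and> s \<in> U \<and> \<Gamma> ` (S \<inter> U) \<subseteq> chart_dom c \<and> smooth_on (S \<inter> U) (\<lambda>s. w s c)"
  unfolding smooth_field_def by blast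

lemma smooth_cofield_in: "smooth_cofield S \<Gamma> q \<Longrightarrow> s \<in> S \<Longrightarrow> q s \<in> cotangent_space A (\<Gamma> s)"
  unfolding smooth_cofield_def by blast

lemma smooth_cofieldD:
  "smooth_cofield S \<Gamma> q \<Longrightarrow> s \<in> S \<Longrightarrow> c \<in> A \<Longrightarrow> \<Gamma> s \<in> chart_dom c \<Longrightarrow>
    \<exists>U. open U \<and> s \<in> U \<and> \<Gamma> ` (S \<inter> U) \<subseteq> chart_dom c \<and>
      (\<forall>u. smooth_on (S \<inter> U) (\<lambda>s. q s (tvec_of A c (\<Gamma> s) u)))"
  unfolding smooth_cofield_def by blast

text \<open>One chart around each point suffices: in any other chart the coordinates are obtained by
  applying the transition derivative at the moving base point, which is smooth jointly in point and
  vector.\<close>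

lemma smooth_field_chartI:
  assumes \<Gamma>: "smooth_into S M A \<Gamma>" and w: "\<And>s. s \<in> S \<Longrightarrow> w s \<in> tangent_space A (\<Gamma> s)"
    and loc: "\<And>s. s \<in> S \<Longrightarrow> \<exists>c\<in>A. \<exists>U. open U \<and> s \<in> U \<and> \<Gamma> ` (S \<inter> U) \<subseteq> chart_dom c \<and>
      smooth_on (S \<inter> U) (\<lambda>s. w s c)"
  shows "smooth_field S \<Gamma> w"
  unfolding smooth_field_def
proof (intro conjI ballI impI)
  show "w s \<in> tangent_space A (\<Gamma> s)" if "s \<in> S" for s by (rule w[OF that])
  fix s d assume s: "s \<in> S" and d: "d \<in> A" "\<Gamma> s \<in> chart_dom d"
  obtain c U where c: "c \<in> A" and U: "open U" "s \<in> U" "\<Gamma> ` (S \<inter> U) \<subseteq> chart_dom c"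
    "smooth_on (S \<inter> U) (\<lambda>s. w s c)" using loc[OF s] by blast
  have "\<Gamma> s \<in> chart_dom c" using U s by blast
  then obtain U' where U': "open U'" "s \<in> U'" "smooth_on (S \<inter> U') (\<lambda>s. chart_map c (\<Gamma> s))"
    using smooth_intoD[OF \<Gamma> s c] by blast
  obtain V where V: "open V" "s \<in> V" "\<Gamma> ` (S \<inter> V) \<subseteq> chart_dom d"
    using smooth_intoD[OF \<Gamma> s d] by blast
  let ?W = "U \<inter> U' \<inter> V"
  let ?D = "\<lambda>x. frechet_derivative (chart_map d \<circ> chart_inv c) (at x)"
  have dom: "\<Gamma> t \<in> chart_dom c" "\<Gamma> t \<in> chart_dom d" if "t \<in> S \<inter> ?W" for t
    using that U(3) V(3) by auto
  have "smooth_on (S \<inter> ?W) (\<lambda>t. ?D (chart_map c (\<Gamma> t)) (w t c))"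
  proof (rule smooth_on_derivative_apply[OF findim_model, where S="chart_map c ` (chart_dom c \<inter> chart_dom d)"
        and f'="?D" and x="\<lambda>t. chart_map c (\<Gamma> t)" and u="\<lambda>t. w t c"])
    show "smooth_on (chart_map c ` (chart_dom c \<inter> chart_dom d)) (\<lambda>x. ?D x v)" for v
      by (rule smooth_on_frechet_derivative[OF transition_smooth[OF c d(1)] overlap_open[OF c d(1)]])
    show "linear (?D x)" if "x \<in> chart_map c ` (chart_dom c \<inter> chart_dom d)" for x
      using that transition_linear[OF c d(1)] by auto
    show "smooth_on (S \<inter> ?W) (\<lambda>t. chart_map c (\<Gamma> t))" by (rule smooth_on_subset[OF U'(3)]) auto
    show "(\<lambda>t. chart_map c (\<Gamma> t)) ` (S \<inter> ?W) \<subseteq> chart_map c ` (chart_dom c \<inter> chart_dom d)"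
      using dom by blast
    show "smooth_on (S \<inter> ?W) (\<lambda>t. w t c)" by (rule smooth_on_subset[OF U(4)]) auto
  qed
  then have "smooth_on (S \<inter> ?W) (\<lambda>t. w t d)"
  proof (rule smooth_on_cong[rotated])
    show "?D (chart_map c (\<Gamma> t)) (w t c) = w t d" if t: "t \<in> S \<inter> ?W" for t
      using tangent_space_coord[OF w c d(1) dom[OF t]] t by simp
  qed
  moreover have "\<Gamma> ` (S \<inter> ?W) \<subseteq> chart_dom d" using V(3) by blast
  ultimately show "\<exists>U. open U \<and> s \<in> U \<and> \<Gamma> ` (S \<inter> U) \<subseteq> chart_dom d \<and> smooth_on (S \<inter> U) (\<lambda>s. w s d)"
    using U U' V by (intro exI[of _ ?W]) auto
qed

lemma smooth_cofield_subset:
  assumes q: "smooth_cofield S \<Gamma> q" and T: "T \<subseteq> S"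
  shows "smooth_cofield T \<Gamma> q"
  unfolding smooth_cofield_def
proof (intro conjI ballI impI)
  show "q s \<in> cotangent_space A (\<Gamma> s)" if "s \<in> T" for s using smooth_cofield_in[OF q] that T by blast
  fix s c assume s: "s \<in> T" and c: "c \<in> A" "\<Gamma> s \<in> chart_dom c"
  have "s \<in> S" using s T by blast
  then obtain U where U: "open U" "s \<in> U" "\<Gamma> ` (S \<inter> U) \<subseteq> chart_dom c"
    "\<And>u. smooth_on (S \<inter> U) (\<lambda>s. q s (tvec_of A c (\<Gamma> s) u))"
    using smooth_cofieldD[OF q _ c] by blast
  have "smooth_on (T \<inter> U) (\<lambda>s. q s (tvec_of A c (\<Gamma> s) u))" for u
    by (rule smooth_on_subset[OF U(4)]) (use T in blast)
  moreover have "\<Gamma> ` (T \<inter> U) \<subseteq> chart_dom c" using U(3) T by blast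
  ultimately show "\<exists>U. open U \<and> s \<in> U \<and> \<Gamma> ` (T \<inter> U) \<subseteq> chart_dom c \<and>
      (\<forall>u. smooth_on (T \<inter> U) (\<lambda>s. q s (tvec_of A c (\<Gamma> s) u)))"
    using U(1,2) by (intro exI[of _ U]) simp
qed

lemma smooth_field_compose:
  fixes \<phi> :: "'t::real_normed_vector \<Rightarrow> 's::real_normed_vector"
  assumes fd: "findim TYPE('s)" and w: "smooth_field S \<Gamma> w"
    and \<phi>: "smooth_on T \<phi>" "\<phi> ` T \<subseteq> S"
  shows "smooth_field T (\<lambda>t. \<Gamma> (\<phi> t)) (\<lambda>t. w (\<phi> t))"
  unfolding smooth_field_def
proof (intro conjI ballI impI)
  show "w (\<phi> t) \<in> tangent_space A (\<Gamma> (\<phi> t))" if "t \<in> T" for t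
    using smooth_field_in[OF w] that \<phi>(2) by blast
  fix t c assume t: "t \<in> T" and c: "c \<in> A" "\<Gamma> (\<phi> t) \<in> chart_dom c"
  have "\<phi> t \<in> S" using t \<phi>(2) by blast
  then obtain U where U: "open U" "\<phi> t \<in> U" "\<Gamma> ` (S \<inter> U) \<subseteq> chart_dom c" "smooth_on (S \<inter> U) (\<lambda>s. w s c)"
    using smooth_fieldD[OF w _ c] by blast
  obtain W where W: "open W" "T \<inter> \<phi> -` U = T \<inter> W"
    using continuous_openin_preimage_gen[OF smooth_on_continuous[OF \<phi>(1)] U(1)]
    unfolding openin_open by blast
  have sub: "\<phi> ` (T \<inter> W) \<subseteq> S \<inter> U" using \<phi>(2) W(2) by blast
  have "smooth_on (T \<inter> W) (\<lambda>t. w (\<phi> t) c)"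
    by (rule smooth_on_compose[OF fd U(4) smooth_on_subset[OF \<phi>(1)] sub]) simp
  moreover have "t \<in> W" using t U(2) W(2) by blast
  moreover have "(\<lambda>t. \<Gamma> (\<phi> t)) ` (T \<inter> W) \<subseteq> chart_dom c" using sub U(3) by blast
  ultimately show "\<exists>U. open U \<and> t \<in> U \<and> (\<lambda>t. \<Gamma> (\<phi> t)) ` (T \<inter> U) \<subseteq> chart_dom c \<and>
      smooth_on (T \<inter> U) (\<lambda>t. w (\<phi> t) c)" using W(1) by blast
qed

lemma smooth_field_cong:
  assumes eq: "\<And>s. s \<in> S \<Longrightarrow> \<Gamma> s = \<Gamma>' s" "\<And>s. s \<in> S \<Longrightarrow> w s = w' s" and w: "smooth_field S \<Gamma> w"
  shows "smooth_field S \<Gamma>' w'"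
  unfolding smooth_field_def
proof (intro conjI ballI impI)
  show "w' s \<in> tangent_space A (\<Gamma>' s)" if "s \<in> S" for s using smooth_field_in[OF w that] eq that by simp
  fix s c assume s: "s \<in> S" and c: "c \<in> A" "\<Gamma>' s \<in> chart_dom c"
  then obtain U where U: "open U" "s \<in> U" "\<Gamma> ` (S \<inter> U) \<subseteq> chart_dom c" "smooth_on (S \<inter> U) (\<lambda>s. w s c)"
    using smooth_fieldD[OF w s c(1)] eq(1)[OF s] by auto
  have "smooth_on (S \<inter> U) (\<lambda>s. w' s c)" by (rule smooth_on_cong[OF _ U(4)]) (simp add: eq)
  moreover have "\<Gamma>' ` (S \<inter> U) \<subseteq> chart_dom c" using U(3) eq(1) by auto
  ultimately show "\<exists>U. open U \<and> s \<in> U \<and> \<Gamma>' ` (S \<inter> U) \<subseteq> chart_dom c \<and> smooth_on (S \<inter> U) (\<lambda>s. w' s c)"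
    using U by blast
qed

lemma smooth_field_tvec_of:
  assumes \<Gamma>: "smooth_into S M A \<Gamma>" and c: "c \<in> A" "\<Gamma> ` S \<subseteq> chart_dom c" and u: "smooth_on S u"
  shows "smooth_field S \<Gamma> (\<lambda>s. tvec_of A c (\<Gamma> s) (u s))"
proof (rule smooth_field_chartI[OF \<Gamma>])
  have dom: "\<Gamma> s \<in> chart_dom c" if "s \<in> S" for s using that c(2) by blast
  show "tvec_of A c (\<Gamma> s) (u s) \<in> tangent_space A (\<Gamma> s)" if "s \<in> S" for s
    by (rule tvec_of_in[OF c(1) dom[OF that]])
  fix s assume "s \<in> S"
  have "smooth_on S (\<lambda>s. tvec_of A c (\<Gamma> s) (u s) c)"
    by (rule smooth_on_cong[OF _ u]) (simp add: tvec_of_self c(1) dom)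
  then show "\<exists>c'\<in>A. \<exists>U. open U \<and> s \<in> U \<and> \<Gamma> ` (S \<inter> U) \<subseteq> chart_dom c' \<and>
      smooth_on (S \<inter> U) (\<lambda>s. tvec_of A c (\<Gamma> s) (u s) c')"
    by (intro bexI[OF _ c(1)] exI[of _ UNIV]) (use c(2) in simp)
qed

text \<open>In a chart the vector is a combination of constant coordinate vectors with smooth
  coefficients, and the pairings with those are smooth by definition of a cofield.\<close>

lemma smooth_on_pairing:
  assumes S: "thick S" and \<Gamma>: "smooth_into S M A \<Gamma>"
    and q: "smooth_cofield S \<Gamma> q" and w: "smooth_field S \<Gamma> w"
  shows "smooth_on S (\<lambda>s. q s (w s))"
proof (rule smooth_on_local[OF S])
  fix s assume s: "s \<in> S"
  obtain B :: "'e set" and \<kappa> where B: "finite B" "\<And>b. bounded_linear (\<kappa> b)"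
    "\<And>x. (\<Sum>b\<in>B. \<kappa> b x *\<^sub>R b) = x" using findim_coords[OF findim_model] by blast
  obtain c where c: "c \<in> A" "\<Gamma> s \<in> chart_dom c" using cover[OF smooth_into_carrier[OF \<Gamma> s]] by blast
  obtain U where U: "open U" "s \<in> U" "\<Gamma> ` (S \<inter> U) \<subseteq> chart_dom c"
    "\<And>u. smooth_on (S \<inter> U) (\<lambda>s. q s (tvec_of A c (\<Gamma> s) u))" using smooth_cofieldD[OF q s c] by blast
  obtain V where V: "open V" "s \<in> V" "smooth_on (S \<inter> V) (\<lambda>s. w s c)"
    using smooth_fieldD[OF w s c] by blast
  have "smooth_on (S \<inter> (U \<inter> V)) (\<lambda>s. \<Sum>b\<in>B. \<kappa> b (w s c) *\<^sub>R q s (tvec_of A c (\<Gamma> s) b))"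
    by (intro smooth_on_sum smooth_on_scaleR smooth_on_bounded_linear[OF B(2)]
        smooth_on_subset[OF V(3)] smooth_on_subset[OF U(4)]) auto
  then have "smooth_on (S \<inter> (U \<inter> V)) (\<lambda>s. q s (w s))"
  proof (rule smooth_on_cong[rotated])
    fix t assume t: "t \<in> S \<inter> (U \<inter> V)"
    then have dom: "\<Gamma> t \<in> chart_dom c" using U(3) by blast
    have l: "linear (\<lambda>u. q t (tvec_of A c (\<Gamma> t) u))"
      using cotangent_coord_bounded_linear[OF smooth_cofield_in[OF q] c(1) dom] t
      by (simp add: bounded_linear.linear)
    have "q t (w t) = q t (tvec_of A c (\<Gamma> t) (w t c))"
      using tvec_of_eq[OF smooth_field_in[OF w] c(1) dom] t by simp
    also have "\<dots> = q t (tvec_of A c (\<Gamma> t) (\<Sum>b\<in>B. \<kappa> b (w t c) *\<^sub>R b))" by (simp add: B(3))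
    also have "\<dots> = (\<Sum>b\<in>B. \<kappa> b (w t c) *\<^sub>R q t (tvec_of A c (\<Gamma> t) b))"
      using linear_sum[OF l, of "\<lambda>b. \<kappa> b (w t c) *\<^sub>R b" B] linear_scale[OF l] by simp
    finally show "(\<Sum>b\<in>B. \<kappa> b (w t c) *\<^sub>R q t (tvec_of A c (\<Gamma> t) b)) = q t (w t)" ..
  qed
  then show "\<exists>U. open U \<and> s \<in> U \<and> smooth_on (S \<inter> U) (\<lambda>s. q s (w s))"
    using U V by (intro exI[of _ "U \<inter> V"]) auto
qed

subsection \<open>Tangent, cotangent and Pontryagin atlases\<close>

lemma atlas_tangent_space:
  assumes x: "x \<in> M"
  shows "atlas (tangent_space A x) (tangent_space_atlas A x)"
proof
  show "chart_dom k \<subseteq> tangent_space A x" if "k \<in> tangent_space_atlas A x" for k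
    using that unfolding tangent_space_atlas_def by auto
  show "\<exists>k\<in>tangent_space_atlas A x. w \<in> chart_dom k" if "w \<in> tangent_space A x" for w
    using that cover[OF x] unfolding tangent_space_atlas_def by auto
  show "inj_on (chart_map k) (chart_dom k)" if k: "k \<in> tangent_space_atlas A x" for k
  proof -
    obtain c where c: "c \<in> A" "x \<in> chart_dom c" "k = (tangent_space A x, \<lambda>v. v c)"
      using k unfolding tangent_space_atlas_def by blast
    show ?thesis unfolding c(3) fst_conv snd_conv by (rule inj_onI) (rule tvec_eqI[OF _ _ c(1,2)])
  qed
  have "(\<lambda>v. v c) ` tangent_space A x = UNIV" if "c \<in> A" "x \<in> chart_dom c" for c
    using tvec_of_in[OF that] tvec_of_self[OF that] by (metis (no_types, lifting) UNIV_eq_I image_eqI)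
  then show "open (chart_map k ` (chart_dom k \<inter> chart_dom l))"
    if "k \<in> tangent_space_atlas A x" "l \<in> tangent_space_atlas A x" for k l
    using that unfolding tangent_space_atlas_def by auto
qed

lemma smooth_into_tangent_space_iff:
  assumes x: "x \<in> M" and S: "thick S"
  shows "smooth_into S (tangent_space A x) (tangent_space_atlas A x) w \<longleftrightarrow> smooth_field S (\<lambda>_. x) w"
proof -
  interpret T: atlas "tangent_space A x" "tangent_space_atlas A x" by (rule atlas_tangent_space[OF x])
  have k: "(tangent_space A x, \<lambda>v. v c) \<in> tangent_space_atlas A x" if "c \<in> A" "x \<in> chart_dom c" for c
    using that unfolding tangent_space_atlas_def by blast
  show ?thesis
  proof
    assume w: "smooth_into S (tangent_space A x) (tangent_space_atlas A x) w"
    have "\<exists>U. open U \<and> s \<in> U \<and> (\<lambda>_. x) ` (S \<inter> U) \<subseteq> chart_dom c \<and> smooth_on (S \<inter> U) (\<lambda>s. w s c)"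
      if "s \<in> S" "c \<in> A" "x \<in> chart_dom c" for s c
      using T.smooth_intoD[OF w that(1) k[OF that(2,3)]] T.smooth_into_carrier[OF w that(1)] that(3) by auto
    then show "smooth_field S (\<lambda>_. x) w"
      unfolding smooth_field_def using T.smooth_into_carrier[OF w] by blast
  next
    assume w: "smooth_field S (\<lambda>_. x) w"
    show "smooth_into S (tangent_space A x) (tangent_space_atlas A x) w"
    proof (rule T.smooth_intoI[OF S smooth_field_in[OF w]])
      fix s k assume s: "s \<in> S" and "k \<in> tangent_space_atlas A x"
      then obtain c where c: "c \<in> A" "x \<in> chart_dom c" "k = (tangent_space A x, \<lambda>v. v c)"
        unfolding tangent_space_atlas_def by blast
      obtain U where "open U" "s \<in> U" "smooth_on (S \<inter> U) (\<lambda>s. w s c)"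
        using smooth_fieldD[OF w s c(1,2)] by blast
      then show "\<exists>U. open U \<and> s \<in> U \<and> w ` (S \<inter> U) \<subseteq> chart_dom k \<and> smooth_on (S \<inter> U) (\<lambda>s. chart_map k (w s))"
        using smooth_field_in[OF w] by (intro exI[of _ U]) (auto simp: c(3))
    qed
  qed
qed

lemma covec_coord_image:
  assumes "c \<in> A" "x \<in> chart_dom c"
  shows "covec_coord A c x ` cotangent_space A x = UNIV"
proof -
  have "\<beta> \<in> covec_coord A c x ` cotangent_space A x" for \<beta>
  proof (rule image_eqI)
    show "\<beta> = covec_coord A c x (covec_of c x (blinfun_apply \<beta>))" by (simp add: covec_coord_covec_of[OF assms])
    show "covec_of c x (blinfun_apply \<beta>) \<in> cotangent_space A x"
      by (rule covec_of_in) (simp add: blinfun.bounded_linear_right bounded_linear.linear)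
  qed
  then show ?thesis by blast
qed

text \<open>Translates between the coordinates used by the cotangent and Pontryagin atlases, which
  are bounded linear forms, and the real-valued tests in \<open>smooth_cofield\<close>.\<close>

lemma smooth_on_covec_coord_iff:
  assumes q: "\<And>s. s \<in> S \<Longrightarrow> q s \<in> cotangent_space A (\<Gamma> s)" and c: "c \<in> A" "\<And>s. s \<in> S \<Longrightarrow> \<Gamma> s \<in> chart_dom c"
  shows "smooth_on S (\<lambda>s. covec_coord A c (\<Gamma> s) (q s)) \<longleftrightarrow> (\<forall>u. smooth_on S (\<lambda>s. q s (tvec_of A c (\<Gamma> s) u)))"
proof -
  have eq: "blinfun_apply (covec_coord A c (\<Gamma> s) (q s)) u = q s (tvec_of A c (\<Gamma> s) u)" if "s \<in> S" for s u
    by (rule covec_coord_apply[OF q[OF that] c(1) c(2)[OF that]])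
  show ?thesis
  proof (intro iffI allI)
    fix u assume "smooth_on S (\<lambda>s. covec_coord A c (\<Gamma> s) (q s))"
    then have "smooth_on S (\<lambda>s. blinfun_apply (covec_coord A c (\<Gamma> s) (q s)) u)"
      by (rule smooth_on_bounded_linear[OF blinfun.bounded_linear_left])
    then show "smooth_on S (\<lambda>s. q s (tvec_of A c (\<Gamma> s) u))" by (rule smooth_on_cong[rotated]) (rule eq)
  next
    assume *: "\<forall>u. smooth_on S (\<lambda>s. q s (tvec_of A c (\<Gamma> s) u))"
    show "smooth_on S (\<lambda>s. covec_coord A c (\<Gamma> s) (q s))"
    proof (rule smooth_on_blinfun[OF findim_model])
      fix u show "smooth_on S (\<lambda>s. blinfun_apply (covec_coord A c (\<Gamma> s) (q s)) u)"
        by (rule smooth_on_cong[OF _ *[rule_format, of u]]) (rule eq[symmetric])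
    qed
  qed
qed

lemma atlas_cotangent_space:
  assumes x: "x \<in> M"
  shows "atlas (cotangent_space A x) (cotangent_space_atlas A x)"
proof
  show "chart_dom k \<subseteq> cotangent_space A x" if "k \<in> cotangent_space_atlas A x" for k
    using that unfolding cotangent_space_atlas_def by auto
  show "\<exists>k\<in>cotangent_space_atlas A x. w \<in> chart_dom k" if "w \<in> cotangent_space A x" for w
    using that cover[OF x] unfolding cotangent_space_atlas_def by auto
  show "inj_on (chart_map k) (chart_dom k)" if k: "k \<in> cotangent_space_atlas A x" for k
  proof -
    obtain c where c: "c \<in> A" "x \<in> chart_dom c" "k = (cotangent_space A x, covec_coord A c x)"
      using k unfolding cotangent_space_atlas_def by blast
    show ?thesis unfolding c(3) fst_conv snd_conv by (rule inj_onI) (rule covec_eqI[OF _ _ c(1,2)])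
  qed
  show "open (chart_map k ` (chart_dom k \<inter> chart_dom l))"
    if "k \<in> cotangent_space_atlas A x" "l \<in> cotangent_space_atlas A x" for k l
    using that covec_coord_image unfolding cotangent_space_atlas_def by auto
qed

lemma smooth_into_cotangent_space_iff:
  assumes x: "x \<in> M" and S: "thick S"
  shows "smooth_into S (cotangent_space A x) (cotangent_space_atlas A x) q \<longleftrightarrow> smooth_cofield S (\<lambda>_. x) q"
proof -
  interpret T: atlas "cotangent_space A x" "cotangent_space_atlas A x" by (rule atlas_cotangent_space[OF x])
  have k: "(cotangent_space A x, covec_coord A c x) \<in> cotangent_space_atlas A x" if "c \<in> A" "x \<in> chart_dom c" for c
    using that unfolding cotangent_space_atlas_def by blast
  show ?thesis
  proof
    assume q: "smooth_into S (cotangent_space A x) (cotangent_space_atlas A x) q"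
    note qin = T.smooth_into_carrier[OF q]
    have "\<exists>U. open U \<and> s \<in> U \<and> (\<lambda>_. x) ` (S \<inter> U) \<subseteq> chart_dom c \<and>
        (\<forall>u. smooth_on (S \<inter> U) (\<lambda>s. q s (tvec_of A c x u)))"
      if s: "s \<in> S" and c: "c \<in> A" "x \<in> chart_dom c" for s c
    proof -
      obtain U where U: "open U" "s \<in> U" "smooth_on (S \<inter> U) (\<lambda>s. covec_coord A c x (q s))"
        using T.smooth_intoD[OF q s k[OF c]] qin[OF s] by auto
      have "\<forall>u. smooth_on (S \<inter> U) (\<lambda>s. q s (tvec_of A c x u))"
        using U(3) smooth_on_covec_coord_iff[of "S \<inter> U" q "\<lambda>_. x" c] qin c by auto
      then show ?thesis using U c by (intro exI[of _ U]) auto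
    qed
    then show "smooth_cofield S (\<lambda>_. x) q" unfolding smooth_cofield_def using qin by auto
  next
    assume q: "smooth_cofield S (\<lambda>_. x) q"
    show "smooth_into S (cotangent_space A x) (cotangent_space_atlas A x) q"
    proof (rule T.smooth_intoI[OF S smooth_cofield_in[OF q]])
      fix s k assume s: "s \<in> S" and "k \<in> cotangent_space_atlas A x"
      then obtain c where c: "c \<in> A" "x \<in> chart_dom c" "k = (cotangent_space A x, covec_coord A c x)"
        unfolding cotangent_space_atlas_def by blast
      obtain U where U: "open U" "s \<in> U" "\<forall>u. smooth_on (S \<inter> U) (\<lambda>s. q s (tvec_of A c x u))"
        using smooth_cofieldD[OF q s c(1,2)] by blast
      have "smooth_on (S \<inter> U) (\<lambda>s. covec_coord A c x (q s))"
        using U(3) smooth_on_covec_coord_iff[of "S \<inter> U" q "\<lambda>_. x" c] smooth_cofield_in[OF q] c by auto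
      then show "\<exists>U. open U \<and> s \<in> U \<and> q ` (S \<inter> U) \<subseteq> chart_dom k \<and> smooth_on (S \<inter> U) (\<lambda>s. chart_map k (q s))"
        using U smooth_cofield_in[OF q] by (intro exI[of _ U]) (auto simp: c(3))
    qed
  qed
qed

lemma pontryagin_atlas_iff: "k \<in> pontryagin_bundle_atlas A \<longleftrightarrow>
    (\<exists>c\<in>A. k = (pontryagin_bundle (chart_dom c) A, \<lambda>(x, v, p). (chart_map c x, v c, covec_coord A c x p)))"
  unfolding pontryagin_bundle_atlas_def by blast

text \<open>In coordinates each fibre is the whole model space times its whole dual. Hence chart
  overlaps have open images as soon as they do on the base.\<close>

lemma pontryagin_chart_image:
  assumes c: "c \<in> A" and N: "N \<subseteq> chart_dom c"
  shows "(\<lambda>(x, v, p). (chart_map c x, v c, covec_coord A c x p)) ` pontryagin_bundle N A =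
    (chart_map c ` N) \<times> UNIV"
proof (rule equalityI; rule subsetI)
  fix z assume "z \<in> (chart_map c ` N) \<times> (UNIV :: ('e \<times> ('e \<Rightarrow>\<^sub>L real)) set)"
  then obtain x u \<beta> where z: "x \<in> N" "z = (chart_map c x, u, \<beta>)" by auto
  have x: "x \<in> chart_dom c" using z N by blast
  obtain p where p: "p \<in> cotangent_space A x" "\<beta> = covec_coord A c x p"
    using covec_coord_image[OF c x] by blast
  have "(x, tvec_of A c x u, p) \<in> pontryagin_bundle N A"
    using z p tvec_of_in[OF c x] unfolding pontryagin_bundle_def by blast
  then show "z \<in> (\<lambda>(x, v, p). (chart_map c x, v c, covec_coord A c x p)) ` pontryagin_bundle N A"
    by (rule rev_image_eqI) (simp add: z(2) p(2) tvec_of_self[OF c x])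
qed (auto simp: pontryagin_bundle_def)

lemma atlas_pontryagin: "atlas (pontryagin_bundle M A) (pontryagin_bundle_atlas A)"
proof
  show "chart_dom k \<subseteq> pontryagin_bundle M A" if "k \<in> pontryagin_bundle_atlas A" for k
    using that dom_subset by (fastforce simp: pontryagin_atlas_iff pontryagin_bundle_def)
  show "\<exists>k\<in>pontryagin_bundle_atlas A. z \<in> chart_dom k" if z: "z \<in> pontryagin_bundle M A" for z
  proof -
    obtain c where c: "c \<in> A" "fst z \<in> chart_dom c"
      using z cover unfolding pontryagin_bundle_def by fastforce
    then have "z \<in> pontryagin_bundle (chart_dom c) A" using z unfolding pontryagin_bundle_def by auto
    moreover have "(pontryagin_bundle (chart_dom c) A, \<lambda>(x, v, p). (chart_map c x, v c, covec_coord A c x p))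
        \<in> pontryagin_bundle_atlas A" using c(1) unfolding pontryagin_atlas_iff by blast
    ultimately show ?thesis by (intro bexI) simp_all
  qed
  show "inj_on (chart_map k) (chart_dom k)" if k: "k \<in> pontryagin_bundle_atlas A" for k
  proof -
    obtain c where c: "c \<in> A" "k = (pontryagin_bundle (chart_dom c) A, \<lambda>(x, v, p). (chart_map c x, v c, covec_coord A c x p))"
      using k unfolding pontryagin_atlas_iff by blast
    show ?thesis
    proof (rule inj_onI)
      fix y z assume yz: "y \<in> chart_dom k" "z \<in> chart_dom k" "chart_map k y = chart_map k z"
      obtain x v p where y: "y = (x, v, p)" by (cases y)
      obtain x' v' p' where z: "z = (x', v', p')" by (cases z)
      have xx: "x = x'" using yz inj[OF c(1)] by (auto simp: c(2) y z pontryagin_bundle_def dest: inj_onD)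
      have v: "v = v'" by (rule tvec_eqI[of _ x _ c]) (use yz c(1) xx in \<open>auto simp: c(2) y z pontryagin_bundle_def\<close>)
      have "p = p'" by (rule covec_eqI[of _ x _ c]) (use yz c(1) xx in \<open>auto simp: c(2) y z pontryagin_bundle_def\<close>)
      with xx v show "y = z" by (simp add: y z)
    qed
  qed
  show "open (chart_map k ` (chart_dom k \<inter> chart_dom l))"
    if kl: "k \<in> pontryagin_bundle_atlas A" "l \<in> pontryagin_bundle_atlas A" for k l
  proof -
    obtain c where c: "c \<in> A" "k = (pontryagin_bundle (chart_dom c) A, \<lambda>(x, v, p). (chart_map c x, v c, covec_coord A c x p))"
      using kl(1) unfolding pontryagin_atlas_iff by blast
    obtain d where d: "d \<in> A" "chart_dom l = pontryagin_bundle (chart_dom d) A"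
      using kl(2) unfolding pontryagin_atlas_iff by auto
    have "chart_dom k \<inter> chart_dom l = pontryagin_bundle (chart_dom c \<inter> chart_dom d) A"
      unfolding c(2) d(2) pontryagin_bundle_def by auto
    then have "chart_map k ` (chart_dom k \<inter> chart_dom l) = (chart_map c ` (chart_dom c \<inter> chart_dom d)) \<times> UNIV"
      using pontryagin_chart_image[OF c(1), of "chart_dom c \<inter> chart_dom d"] by (simp add: c(2))
    then show ?thesis using overlap_open[OF c(1) d(1)] by (simp add: open_Times)
  qed
qed

text \<open>Splits a bundle-valued family into a base map with a field and a cofield along it; the
  variational arguments use only these components.\<close>

lemma smooth_into_pontryagin_iff:
  assumes S: "thick S"
  shows "smooth_into S (pontryagin_bundle M A) (pontryagin_bundle_atlas A) (\<lambda>s. (\<Gamma> s, w s, q s)) \<longleftrightarrow>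
    smooth_into S M A \<Gamma> \<and> smooth_field S \<Gamma> w \<and> smooth_cofield S \<Gamma> q"
proof -
  interpret P: atlas "pontryagin_bundle M A" "pontryagin_bundle_atlas A" by (rule atlas_pontryagin)
  let ?k = "\<lambda>c. (pontryagin_bundle (chart_dom c) A, \<lambda>(x, v, p). (chart_map c x, v c, covec_coord A c x p))"
  show ?thesis
  proof
    assume F: "smooth_into S (pontryagin_bundle M A) (pontryagin_bundle_atlas A) (\<lambda>s. (\<Gamma> s, w s, q s))"
    have mem: "\<Gamma> s \<in> M" "w s \<in> tangent_space A (\<Gamma> s)" "q s \<in> cotangent_space A (\<Gamma> s)" if "s \<in> S" for s
      using P.smooth_into_carrier[OF F that] by (auto simp: pontryagin_bundle_def)
    have loc: "\<exists>U. open U \<and> s \<in> U \<and> \<Gamma> ` (S \<inter> U) \<subseteq> chart_dom c \<and> smooth_on (S \<inter> U) (\<lambda>s. chart_map c (\<Gamma> s)) \<and>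
        smooth_on (S \<inter> U) (\<lambda>s. w s c) \<and> (\<forall>u. smooth_on (S \<inter> U) (\<lambda>s. q s (tvec_of A c (\<Gamma> s) u)))"
      if s: "s \<in> S" and c: "c \<in> A" "\<Gamma> s \<in> chart_dom c" for s c
    proof -
      have k: "?k c \<in> pontryagin_bundle_atlas A" "(\<Gamma> s, w s, q s) \<in> chart_dom (?k c)"
        using c mem[OF s] by (auto simp: pontryagin_atlas_iff pontryagin_bundle_def)
      obtain U where U: "open U" "s \<in> U" "(\<lambda>s. (\<Gamma> s, w s, q s)) ` (S \<inter> U) \<subseteq> chart_dom (?k c)"
        "smooth_on (S \<inter> U) (\<lambda>s. chart_map (?k c) (\<Gamma> s, w s, q s))"
        using P.smooth_intoD[OF F s k] by blast
      have dom: "\<Gamma> t \<in> chart_dom c" if "t \<in> S \<inter> U" for t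
        using U(3) that by (auto simp: pontryagin_bundle_def)
      have 1: "smooth_on (S \<inter> U) (\<lambda>s. chart_map c (\<Gamma> s))" using smooth_on_fst[OF U(4)] by simp
      have 2: "smooth_on (S \<inter> U) (\<lambda>s. w s c)" using smooth_on_fst[OF smooth_on_snd[OF U(4)]] by simp
      have "smooth_on (S \<inter> U) (\<lambda>s. covec_coord A c (\<Gamma> s) (q s))" using smooth_on_snd[OF smooth_on_snd[OF U(4)]] by simp
      then have "\<forall>u. smooth_on (S \<inter> U) (\<lambda>s. q s (tvec_of A c (\<Gamma> s) u))"
        using smooth_on_covec_coord_iff[of "S \<inter> U" q \<Gamma> c] mem(3) c(1) dom by auto
      then show ?thesis using U(1,2) 1 2 dom by blast
    qed
    have "smooth_into S M A \<Gamma>"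
    proof (rule smooth_intoI[OF S mem(1)])
      fix s c assume "s \<in> S" "c \<in> A" "\<Gamma> s \<in> chart_dom c"
      from loc[OF this] show "\<exists>U. open U \<and> s \<in> U \<and> \<Gamma> ` (S \<inter> U) \<subseteq> chart_dom c \<and>
        smooth_on (S \<inter> U) (\<lambda>s. chart_map c (\<Gamma> s))" by blast
    qed
    moreover have "smooth_field S \<Gamma> w"
      unfolding smooth_field_def
    proof (intro conjI ballI impI)
      fix s c assume "s \<in> S" "c \<in> A" "\<Gamma> s \<in> chart_dom c"
      from loc[OF this] show "\<exists>U. open U \<and> s \<in> U \<and> \<Gamma> ` (S \<inter> U) \<subseteq> chart_dom c \<and>
        smooth_on (S \<inter> U) (\<lambda>s. w s c)" by blast
    qed (rule mem)
    moreover have "smooth_cofield S \<Gamma> q"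
      unfolding smooth_cofield_def
    proof (intro conjI ballI impI)
      fix s c assume "s \<in> S" "c \<in> A" "\<Gamma> s \<in> chart_dom c"
      from loc[OF this] show "\<exists>U. open U \<and> s \<in> U \<and> \<Gamma> ` (S \<inter> U) \<subseteq> chart_dom c \<and>
        (\<forall>u. smooth_on (S \<inter> U) (\<lambda>s. q s (tvec_of A c (\<Gamma> s) u)))" by blast
    qed (rule mem)
    ultimately show "smooth_into S M A \<Gamma> \<and> smooth_field S \<Gamma> w \<and> smooth_cofield S \<Gamma> q" by blast
  next
    assume "smooth_into S M A \<Gamma> \<and> smooth_field S \<Gamma> w \<and> smooth_cofield S \<Gamma> q"
    then have \<Gamma>: "smooth_into S M A \<Gamma>" and w: "smooth_field S \<Gamma> w" and q: "smooth_cofield S \<Gamma> q" by auto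
    note mem = smooth_into_carrier[OF \<Gamma>] smooth_field_in[OF w] smooth_cofield_in[OF q]
    show "smooth_into S (pontryagin_bundle M A) (pontryagin_bundle_atlas A) (\<lambda>s. (\<Gamma> s, w s, q s))"
    proof (rule P.smooth_intoI[OF S])
      show "(\<Gamma> s, w s, q s) \<in> pontryagin_bundle M A" if "s \<in> S" for s
        using mem that unfolding pontryagin_bundle_def by simp
      fix s k assume s: "s \<in> S" and k: "k \<in> pontryagin_bundle_atlas A" "(\<Gamma> s, w s, q s) \<in> chart_dom k"
      obtain c where c: "c \<in> A" "k = ?k c" using k(1) unfolding pontryagin_atlas_iff by blast
      have dc: "\<Gamma> s \<in> chart_dom c" using k(2) by (simp add: c(2) pontryagin_bundle_def)
      obtain U1 where U1: "open U1" "s \<in> U1" "\<Gamma> ` (S \<inter> U1) \<subseteq> chart_dom c" "smooth_on (S \<inter> U1) (\<lambda>s. chart_map c (\<Gamma> s))"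
        using smooth_intoD[OF \<Gamma> s c(1) dc] by blast
      obtain U2 where U2: "open U2" "s \<in> U2" "smooth_on (S \<inter> U2) (\<lambda>s. w s c)"
        using smooth_fieldD[OF w s c(1) dc] by blast
      obtain U3 where U3: "open U3" "s \<in> U3" "\<forall>u. smooth_on (S \<inter> U3) (\<lambda>s. q s (tvec_of A c (\<Gamma> s) u))"
        using smooth_cofieldD[OF q s c(1) dc] by blast
      let ?U = "U1 \<inter> U2 \<inter> U3"
      have dom: "\<Gamma> t \<in> chart_dom c" if "t \<in> S \<inter> ?U" for t using U1(3) that by blast
      have "smooth_on (S \<inter> ?U) (\<lambda>s. q s (tvec_of A c (\<Gamma> s) u))" for u
        by (rule smooth_on_subset[OF U3(3)[rule_format]]) blast
      then have "smooth_on (S \<inter> ?U) (\<lambda>s. covec_coord A c (\<Gamma> s) (q s))"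
        using smooth_on_covec_coord_iff[of "S \<inter> ?U" q \<Gamma> c] mem(3) c(1) dom by simp
      moreover have "smooth_on (S \<inter> ?U) (\<lambda>s. chart_map c (\<Gamma> s))" by (rule smooth_on_subset[OF U1(4)]) blast
      moreover have "smooth_on (S \<inter> ?U) (\<lambda>s. w s c)" by (rule smooth_on_subset[OF U2(3)]) blast
      ultimately have "smooth_on (S \<inter> ?U) (\<lambda>s. (chart_map c (\<Gamma> s), w s c, covec_coord A c (\<Gamma> s) (q s)))"
        by (intro smooth_on_Pair)
      moreover have "(\<lambda>s. (\<Gamma> s, w s, q s)) ` (S \<inter> ?U) \<subseteq> chart_dom k"
        using mem dom by (auto simp: c(2) pontryagin_bundle_def)
      moreover have "open ?U" "s \<in> ?U" using U1 U2 U3 by auto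
      ultimately show "\<exists>U. open U \<and> s \<in> U \<and> (\<lambda>s. (\<Gamma> s, w s, q s)) ` (S \<inter> U) \<subseteq> chart_dom k \<and>
          smooth_on (S \<inter> U) (\<lambda>s. chart_map k (\<Gamma> s, w s, q s))" by (intro exI[of _ ?U]) (simp add: c(2))
    qed
  qed
qed

subsection \<open>Velocity fields of families and functions on the tangent bundle\<close>

text \<open>The velocity of \<Gamma> along a path through the parameter domain is a directional
  derivative of its coordinates. This turns a derivative along a one-dimensional slice into a value
  of the full derivative, whose smooth dependence on the point is known.\<close>

lemma velocity_path_coord:
  assumes "thick J" "t \<in> J" "\<phi> t = s" "\<phi> ` J \<subseteq> S" "(\<phi> has_vector_derivative v) (at t within J)"
    and "c \<in> A" "\<Gamma> s \<in> chart_dom c" "((\<lambda>s. chart_map c (\<Gamma> s)) has_derivative D) (at s within S)"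
  shows "velocity A J (\<lambda>\<tau>. \<Gamma> (\<phi> \<tau>)) t c = D v"
proof -
  have "((\<lambda>s. chart_map c (\<Gamma> s)) has_derivative D) (at (\<phi> t) within \<phi> ` J)"
    using has_derivative_subset[OF assms(8,4)] assms(3) by simp
  then have "((\<lambda>\<tau>. chart_map c (\<Gamma> (\<phi> \<tau>))) has_derivative (\<lambda>x. D (x *\<^sub>R v))) (at t within J)"
    by (rule has_derivative_in_compose[OF assms(5)[unfolded has_vector_derivative_def]])
  then have "((\<lambda>\<tau>. chart_map c (\<Gamma> (\<phi> \<tau>))) has_vector_derivative D v) (at t within J)"
    unfolding has_vector_derivative_def by (simp add: linear_scale[OF has_derivative_linear[OF assms(8)]])
  from thick_vector_derivative[OF assms(1,2) this] show ?thesis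
    using assms(3,6,7) by (simp add: velocity_def o_def)
qed

text \<open>Through every \<open>s\<close> there is given a path \<open>\<phi> s\<close> with the
  same velocity \<open>v\<close>. The horizontal and the vertical lines of a strip are the two
  instances used.\<close>

lemma smooth_field_velocity:
  fixes S :: "'s::real_normed_vector set"
  assumes fd: "findim TYPE('s)" and S: "thick S" and \<Gamma>: "smooth_into S M A \<Gamma>"
    and J: "\<And>s. s \<in> S \<Longrightarrow> thick (J s)" "\<And>s. s \<in> S \<Longrightarrow> t s \<in> J s" "\<And>s. s \<in> S \<Longrightarrow> \<phi> s (t s) = s"
      "\<And>s. s \<in> S \<Longrightarrow> \<phi> s ` J s \<subseteq> S" "\<And>s. s \<in> S \<Longrightarrow> (\<phi> s has_vector_derivative v) (at (t s) within J s)"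
      "\<And>s. s \<in> S \<Longrightarrow> smooth_on (J s) (\<phi> s)"
  shows "smooth_field S \<Gamma> (\<lambda>s. velocity A (J s) (\<lambda>\<tau>. \<Gamma> (\<phi> s \<tau>)) (t s))"
proof (rule smooth_field_chartI[OF \<Gamma>])
  fix s assume s: "s \<in> S"
  show "velocity A (J s) (\<lambda>\<tau>. \<Gamma> (\<phi> s \<tau>)) (t s) \<in> tangent_space A (\<Gamma> s)"
    using velocity_in[OF J(1)[OF s] J(2)[OF s] smooth_into_compose[OF fd \<Gamma> J(6)[OF s] J(4)[OF s] J(1)[OF s]]]
      J(3)[OF s] by simp
  obtain c where c: "c \<in> A" "\<Gamma> s \<in> chart_dom c" using cover[OF smooth_into_carrier[OF \<Gamma> s]] by blast
  obtain U where U: "open U" "s \<in> U" "\<Gamma> ` (S \<inter> U) \<subseteq> chart_dom c" "smooth_on (S \<inter> U) (\<lambda>s. chart_map c (\<Gamma> s))"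
    using smooth_intoD[OF \<Gamma> s c] by blast
  obtain f' where f': "\<And>x. x \<in> S \<inter> U \<Longrightarrow> ((\<lambda>s. chart_map c (\<Gamma> s)) has_derivative f' x) (at x within S \<inter> U)"
    "\<And>v. smooth_on (S \<inter> U) (\<lambda>x. f' x v)"
    using smooth_on_derivative[OF thick_Int_open[OF S U(1)] U(4)] by metis
  have "f' x v = velocity A (J x) (\<lambda>\<tau>. \<Gamma> (\<phi> x \<tau>)) (t x) c" if x: "x \<in> S \<inter> U" for x
  proof -
    have "at x within S \<inter> U = at x within S" by (rule at_within_nhd[of _ U]) (use x U(1) in auto)
    then have der: "((\<lambda>s. chart_map c (\<Gamma> s)) has_derivative f' x) (at x within S)" using f'(1)[OF x] by simp
    have xS: "x \<in> S" using x by simp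
    have xc: "\<Gamma> x \<in> chart_dom c" using x U(3) by blast
    show ?thesis
      by (rule velocity_path_coord[OF J(1)[OF xS] J(2)[OF xS] J(3)[OF xS] J(4)[OF xS] J(5)[OF xS] c(1) xc der, symmetric])
  qed
  then have "smooth_on (S \<inter> U) (\<lambda>x. velocity A (J x) (\<lambda>\<tau>. \<Gamma> (\<phi> x \<tau>)) (t x) c)"
    by (rule smooth_on_cong[OF _ f'(2)])
  with c(1) U show "\<exists>c\<in>A. \<exists>U. open U \<and> s \<in> U \<and> \<Gamma> ` (S \<inter> U) \<subseteq> chart_dom c \<and>
      smooth_on (S \<inter> U) (\<lambda>s. velocity A (J s) (\<lambda>\<tau>. \<Gamma> (\<phi> s \<tau>)) (t s) c)" by blast
qed

lemma smooth_on_bundle_function: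
  fixes L :: "'m \<times> ('m, 'e) tvec \<Rightarrow> real"
  assumes L: "smooth_map (tangent_bundle M A) (tangent_bundle_atlas A) UNIV std_atlas L"
    and S: "thick S" and \<Gamma>: "smooth_into S M A \<Gamma>" and w: "smooth_field S \<Gamma> w"
  shows "smooth_on S (\<lambda>s. L (\<Gamma> s, w s))"
proof (rule smooth_on_local[OF S])
  fix s assume s: "s \<in> S"
  obtain c where c: "c \<in> A" "\<Gamma> s \<in> chart_dom c" using cover[OF smooth_into_carrier[OF \<Gamma> s]] by blast
  obtain U where U: "open U" "s \<in> U" "\<Gamma> ` (S \<inter> U) \<subseteq> chart_dom c" "smooth_on (S \<inter> U) (\<lambda>s. chart_map c (\<Gamma> s))"
    using smooth_intoD[OF \<Gamma> s c] by blast
  obtain V where V: "open V" "s \<in> V" "smooth_on (S \<inter> V) (\<lambda>s. w s c)"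
    using smooth_fieldD[OF w s c] by blast
  define k where "k = (tangent_bundle (chart_dom c) A, \<lambda>(x, v :: ('m, 'e) tvec). (chart_map c x, v c))"
  have k: "k \<in> tangent_bundle_atlas A" using c(1) unfolding k_def tangent_bundle_atlas_def by blast
  have d: "(UNIV, \<lambda>x. x) \<in> (std_atlas :: (real, real) chart set)" unfolding std_atlas_def by simp
  have "smooth_on (chart_map k ` (chart_dom k \<inter> L -` chart_dom (UNIV, \<lambda>x. x))) (chart_map (UNIV, \<lambda>x. x) \<circ> L \<circ> chart_inv k)"
    by (rule L[unfolded smooth_map_def, THEN conjunct2, THEN conjunct2, rule_format, OF k d])
  then have sm: "smooth_on (chart_map k ` chart_dom k) (\<lambda>z. L (chart_inv k z))" by (simp add: o_def)
  \<comment> \<open>Injectivity of the bundle chart lets \<open>chart_inv k\<close> recover the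
    point of the bundle from its coordinates.\<close>
  have inj: "inj_on (chart_map k) (chart_dom k)"
  proof (rule inj_onI)
    fix y z assume yz: "y \<in> chart_dom k" "z \<in> chart_dom k" "chart_map k y = chart_map k z"
    obtain x v where y: "y = (x, v)" by (cases y)
    obtain x' v' where z: "z = (x', v')" by (cases z)
    have xx: "x = x'" using yz inj[OF c(1)] by (auto simp: k_def y z tangent_bundle_def dest: inj_onD)
    have v: "v = v'" by (rule tvec_eqI[of _ x _ c]) (use yz c(1) xx in \<open>auto simp: k_def y z tangent_bundle_def\<close>)
    with xx show "y = z" by (simp add: y z)
  qed
  have mem: "(\<Gamma> t, w t) \<in> chart_dom k" if t: "t \<in> S \<inter> (U \<inter> V)" for t
    using t U(3) smooth_field_in[OF w] by (auto simp: k_def tangent_bundle_def)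
  have map: "(chart_map c (\<Gamma> t), w t c) = chart_map k (\<Gamma> t, w t)" for t by (simp add: k_def)
  have "smooth_on (S \<inter> (U \<inter> V)) (\<lambda>t. L (chart_inv k (chart_map c (\<Gamma> t), w t c)))"
  proof (rule smooth_on_compose[OF findim_prod[OF findim_model findim_model] sm])
    show "smooth_on (S \<inter> (U \<inter> V)) (\<lambda>t. (chart_map c (\<Gamma> t), w t c))"
      by (intro smooth_on_Pair smooth_on_subset[OF U(4)] smooth_on_subset[OF V(3)]) auto
    show "(\<lambda>t. (chart_map c (\<Gamma> t), w t c)) ` (S \<inter> (U \<inter> V)) \<subseteq> chart_map k ` chart_dom k"
      unfolding map using mem by blast
  qed
  then have "smooth_on (S \<inter> (U \<inter> V)) (\<lambda>t. L (\<Gamma> t, w t))"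
  proof (rule smooth_on_cong[rotated])
    show "L (chart_inv k (chart_map c (\<Gamma> t), w t c)) = L (\<Gamma> t, w t)" if "t \<in> S \<inter> (U \<inter> V)" for t
      unfolding map chart_inv_def using inv_into_f_f[OF inj mem[OF that]] by simp
  qed
  then show "\<exists>U. open U \<and> s \<in> U \<and> smooth_on (S \<inter> U) (\<lambda>s. L (\<Gamma> s, w s))"
    using U V by (intro exI[of _ "U \<inter> V"]) auto
qed

end

section \<open>Calculus on strips\<close>

lemma thick_strip: "a < b \<Longrightarrow> thick ({-r<..<r::real} \<times> {a..b::real})"
  by (intro thick_Times thick_open thick_Icc) auto

lemma has_vector_derivative_fst_slice:
  fixes f :: "real \<times> real \<Rightarrow> 'a::real_normed_vector"
  assumes "(f has_derivative f') (at (x, y) within I \<times> J)" "y \<in> J"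
  shows "((\<lambda>x. f (x, y)) has_vector_derivative f' (1, 0)) (at x within I)"
proof -
  have l: "linear f'" using assms(1) by (rule has_derivative_linear)
  have "(f has_derivative f') (at (x, y) within (\<lambda>x. (x, y)) ` I)"
    by (rule has_derivative_subset[OF assms(1)]) (use assms(2) in auto)
  moreover have "((\<lambda>x. (x, y)) has_derivative (\<lambda>h. (h, 0))) (at x within I)"
    by (intro has_derivative_Pair has_derivative_ident has_derivative_const)
  ultimately have "((\<lambda>x. f (x, y)) has_derivative (\<lambda>h. f' (h, 0))) (at x within I)"
    by (rule has_derivative_in_compose[rotated])
  moreover have "(\<lambda>h. f' (h, 0)) = (\<lambda>h. h *\<^sub>R f' (1, 0))"
  proof
    show "f' (h, 0) = h *\<^sub>R f' (1, 0)" for h using linear_scale[OF l, of h "(1, 0)"] by simp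
  qed
  ultimately show ?thesis unfolding has_vector_derivative_def by (simp only:)
qed

lemma has_vector_derivative_snd_slice:
  fixes f :: "real \<times> real \<Rightarrow> 'a::real_normed_vector"
  assumes "(f has_derivative f') (at (x, y) within I \<times> J)" "x \<in> I"
  shows "((\<lambda>y. f (x, y)) has_vector_derivative f' (0, 1)) (at y within J)"
proof -
  have l: "linear f'" using assms(1) by (rule has_derivative_linear)
  have "(f has_derivative f') (at (x, y) within (\<lambda>y. (x, y)) ` J)"
    by (rule has_derivative_subset[OF assms(1)]) (use assms(2) in auto)
  moreover have "((\<lambda>y. (x, y)) has_derivative (\<lambda>h. (0, h))) (at y within J)"
    by (intro has_derivative_Pair has_derivative_ident has_derivative_const)
  ultimately have "((\<lambda>y. f (x, y)) has_derivative (\<lambda>h. f' (0, h))) (at y within J)"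
    by (rule has_derivative_in_compose[rotated])
  moreover have "(\<lambda>h. f' (0, h)) = (\<lambda>h. h *\<^sub>R f' (0, 1))"
  proof
    show "f' (0, h) = h *\<^sub>R f' (0, 1)" for h using linear_scale[OF l, of h "(0, 1)"] by simp
  qed
  ultimately show ?thesis unfolding has_vector_derivative_def by (simp only:)
qed

text \<open>Differentiation under the integral sign. The partial derivative is continuous on the
  strip and equals the given \<open>d\<close> by uniqueness, so the first variation of an integral
  is determined by the pointwise \<epsilon>-derivatives of the integrand at 0.\<close>

lemma leibniz_strip:
  fixes f :: "real \<times> real \<Rightarrow> real"
  assumes r: "0 < r" and ab: "a < b" and f: "smooth_on ({-r<..<r} \<times> {a..b}) f"
    and d: "\<And>t. t \<in> {a..b} \<Longrightarrow> ((\<lambda>\<epsilon>. f (\<epsilon>, t)) has_vector_derivative d t) (at 0 within {-r<..<r})"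
  shows "((\<lambda>\<epsilon>. integral {a..b} (\<lambda>t. f (\<epsilon>, t))) has_vector_derivative integral {a..b} d) (at 0)"
proof -
  let ?I = "{-r<..<r}"
  obtain f' where f': "\<And>x. x \<in> ?I \<times> {a..b} \<Longrightarrow> (f has_derivative f' x) (at x within ?I \<times> {a..b})"
    "\<And>v. smooth_on (?I \<times> {a..b}) (\<lambda>x. f' x v)"
    using smooth_on_derivative[OF thick_strip[OF ab] f] by metis
  have der: "((\<lambda>\<epsilon>. f (\<epsilon>, t)) has_vector_derivative f' (\<epsilon>, t) (1, 0)) (at \<epsilon> within ?I)"
    if "\<epsilon> \<in> ?I" "t \<in> {a..b}" for \<epsilon> t
    by (rule has_vector_derivative_fst_slice[OF f'(1)]) (use that in auto)
  have "((\<lambda>\<epsilon>. integral (cbox a b) (\<lambda>t. f (\<epsilon>, t))) has_vector_derivative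
      integral (cbox a b) (\<lambda>t. f' (0, t) (1, 0))) (at 0 within ?I)"
  proof (rule leibniz_rule_vector_derivative[where fx="\<lambda>\<epsilon> t. f' (\<epsilon>, t) (1, 0)"])
    show "((\<lambda>\<epsilon>. f (\<epsilon>, t)) has_vector_derivative f' (\<epsilon>, t) (1, 0)) (at \<epsilon> within ?I)"
      if "\<epsilon> \<in> ?I" "t \<in> cbox a b" for \<epsilon> t using der that by simp
    show "(\<lambda>t. f (\<epsilon>, t)) integrable_on cbox a b" if "\<epsilon> \<in> ?I" for \<epsilon>
    proof (rule integrable_continuous)
      show "continuous_on (cbox a b) (\<lambda>t. f (\<epsilon>, t))"
        by (rule continuous_on_compose2[OF smooth_on_continuous[OF f]])
          (use that in \<open>auto intro!: continuous_intros\<close>)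
    qed
    show "continuous_on (?I \<times> cbox a b) (\<lambda>(\<epsilon>, t). f' (\<epsilon>, t) (1, 0))"
      using smooth_on_continuous[OF f'(2)] by (simp add: split_beta)
  qed (use r in auto)
  moreover have "integral {a..b} (\<lambda>t. f' (0, t) (1, 0)) = integral {a..b} d"
  proof (rule integral_cong)
    fix t assume t: "t \<in> {a..b}"
    have 0: "0 \<in> ?I" using r by simp
    have th: "thick ?I" by (rule thick_open) simp
    show "f' (0, t) (1, 0) = d t"
      using thick_vector_derivative[OF th 0 der[OF 0 t]] thick_vector_derivative[OF th 0 d[OF t]] by simp
  qed
  moreover have "at 0 within ?I = at (0::real)" by (rule at_within_open) (use r in auto)
  ultimately show ?thesis by simp
qed

text \<open>Symmetry of second derivatives through integration:
  \<open>g (\<epsilon>, u) - g (\<epsilon>, p)\<close> is the integral of the time derivative.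
  Differentiating under the integral in \<epsilon>, and then in \<open>u\<close> by the fundamental
  theorem, gives the equality also at the ends of the time interval.\<close>

lemma mixed_partials_real:
  fixes g :: "real \<times> real \<Rightarrow> real"
  assumes r: "0 < r" and pq: "p < q" and t: "t \<in> {p..q}" and g: "smooth_on ({-r<..<r} \<times> {p..q}) g"
    and g': "\<And>s. s \<in> {-r<..<r} \<times> {p..q} \<Longrightarrow> (g has_derivative g' s) (at s within {-r<..<r} \<times> {p..q})"
    and D2: "((\<lambda>\<epsilon>. g' (\<epsilon>, t) (0, 1)) has_vector_derivative D2) (at 0 within {-r<..<r})"
    and D1: "((\<lambda>t. g' (0, t) (1, 0)) has_vector_derivative D1) (at t within {p..q})"
  shows "D1 = D2"
proof -
  let ?I = "{-r<..<r}" and ?J = "{p..q}"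
  have 0: "0 \<in> ?I" using r by simp
  have th: "thick ?I" by (rule thick_open) simp
  have at0: "at 0 within ?I = at (0::real)" by (rule at_within_open) (use r in auto)
  define h where "h = (\<lambda>s. g' s (0, 1))"
  obtain f' where f': "\<And>x. x \<in> ?I \<times> ?J \<Longrightarrow> (g has_derivative f' x) (at x within ?I \<times> ?J)"
    "\<And>v. smooth_on (?I \<times> ?J) (\<lambda>x. f' x v)"
    using smooth_on_derivative[OF thick_strip[OF pq] g] by metis
  \<comment> \<open>No smoothness is assumed of \<open>g'\<close>; it inherits it by agreeing with
    the smooth derivative \<open>f'\<close>.\<close>
  have "f' x (0, 1) = h x" if "x \<in> ?I \<times> ?J" for x
    using thick_derivative_unique[OF thick_strip[OF pq] that f'(1)[OF that] g'[OF that]] by (simp add: h_def)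
  then have h: "smooth_on (?I \<times> ?J) h" by (rule smooth_on_cong[OF _ f'(2)[of "(0, 1)"]])
  obtain h' where h': "\<And>x. x \<in> ?I \<times> ?J \<Longrightarrow> (h has_derivative h' x) (at x within ?I \<times> ?J)"
    "\<And>v. smooth_on (?I \<times> ?J) (\<lambda>x. h' x v)"
    using smooth_on_derivative[OF thick_strip[OF pq] h] by metis
  have hd: "((\<lambda>\<epsilon>. h (\<epsilon>, s)) has_vector_derivative h' (0, s) (1, 0)) (at 0 within ?I)" if "s \<in> ?J" for s
    by (rule has_vector_derivative_fst_slice[OF h'(1)]) (use that 0 in auto)
  have "D2 = h' (0, t) (1, 0)"
    using thick_vector_derivative[OF th 0 D2] thick_vector_derivative[OF th 0 hd[OF t]] by (simp add: h_def)
  have ftc: "integral {p..u} (\<lambda>s. h (\<epsilon>, s)) = g (\<epsilon>, u) - g (\<epsilon>, p)" if e: "\<epsilon> \<in> ?I" and u: "u \<in> ?J" for \<epsilon> u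
  proof (rule integral_unique, rule fundamental_theorem_of_calculus)
    show "p \<le> u" using u by simp
    fix s assume s: "s \<in> {p..u}"
    have "((\<lambda>s. g (\<epsilon>, s)) has_vector_derivative g' (\<epsilon>, s) (0, 1)) (at s within ?J)"
      by (rule has_vector_derivative_snd_slice[OF g']) (use s u e in auto)
    then show "((\<lambda>s. g (\<epsilon>, s)) has_vector_derivative h (\<epsilon>, s)) (at s within {p..u})"
      unfolding h_def by (rule has_vector_derivative_within_subset) (use u in auto)
  qed
  \<comment> \<open>The \<epsilon>-derivative of \<open>ftc\<close> at 0, computed once under the
    integral and once from the boundary values. The degenerate interval \<open>u = p\<close> is
    split off because \<open>leibniz_strip\<close> needs a proper one.\<close>
  have eq: "g' (0, u) (1, 0) = g' (0, p) (1, 0) + integral {p..u} (\<lambda>s. h' (0, s) (1, 0))" if u: "u \<in> ?J" for u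
  proof (cases "u = p")
    case False
    then have pu: "p < u" using u by simp
    have "smooth_on (?I \<times> {p..u}) h" by (rule smooth_on_subset[OF h]) (use u in auto)
    then have 1: "((\<lambda>\<epsilon>. integral {p..u} (\<lambda>s. h (\<epsilon>, s))) has_vector_derivative
        integral {p..u} (\<lambda>s. h' (0, s) (1, 0))) (at 0 within ?I)"
      unfolding at0 by (rule leibniz_strip[OF r pu]) (use hd u in auto)
    have gd: "((\<lambda>\<epsilon>. g (\<epsilon>, s)) has_vector_derivative g' (0, s) (1, 0)) (at 0 within ?I)" if "s \<in> ?J" for s
      by (rule has_vector_derivative_fst_slice[OF g']) (use that 0 in auto)
    have p: "p \<in> ?J" using pq by simp
    have "((\<lambda>\<epsilon>. g (\<epsilon>, u) - g (\<epsilon>, p)) has_vector_derivative (g' (0, u) (1, 0) - g' (0, p) (1, 0))) (at 0 within ?I)"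
      by (rule has_vector_derivative_diff[OF gd[OF u] gd[OF p]])
    then have 2: "((\<lambda>\<epsilon>. integral {p..u} (\<lambda>s. h (\<epsilon>, s))) has_vector_derivative
        (g' (0, u) (1, 0) - g' (0, p) (1, 0))) (at 0 within ?I)"
      by (rule has_vector_derivative_transform[OF 0 _, rotated]) (rule ftc[OF _ u])
    show ?thesis using thick_vector_derivative[OF th 0 1] thick_vector_derivative[OF th 0 2] by simp
  qed simp
  have "continuous_on ?J (\<lambda>s. h' (0, s) (1, 0))"
    by (rule continuous_on_compose2[OF smooth_on_continuous[OF h'(2)[of "(1, 0)"]]])
      (use 0 in \<open>auto intro!: continuous_intros\<close>)
  then have "((\<lambda>u. integral {p..u} (\<lambda>s. h' (0, s) (1, 0))) has_vector_derivative h' (0, t) (1, 0)) (at t within ?J)"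
    using integral_has_vector_derivative t by blast
  then have "((\<lambda>u. g' (0, p) (1, 0) + integral {p..u} (\<lambda>s. h' (0, s) (1, 0))) has_vector_derivative h' (0, t) (1, 0)) (at t within ?J)"
    using has_vector_derivative_add[OF has_vector_derivative_const] by fastforce
  then have "((\<lambda>u. g' (0, u) (1, 0)) has_vector_derivative h' (0, t) (1, 0)) (at t within ?J)"
    by (rule has_vector_derivative_transform[OF t _, rotated]) (rule eq)
  then have "D1 = h' (0, t) (1, 0)"
    using thick_vector_derivative[OF thick_Icc[OF pq] t] D1 by metis
  with \<open>D2 = _\<close> show ?thesis by simp
qed

text \<open>Reduces to the scalar case by shrinking the domain to a box inside \<open>U\<close> and
  applying the coefficient functionals, which separate points.\<close>

lemma mixed_partials:
  fixes f :: "real \<times> real \<Rightarrow> 'a::real_normed_vector"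
  assumes fd: "findim TYPE('a)" and r: "0 < r" and ab: "a < b" and t: "t \<in> {a..b}"
    and U: "open U" "(0, t) \<in> U" and f: "smooth_on (({-r<..<r} \<times> {a..b}) \<inter> U) f"
    and f': "\<And>s. s \<in> ({-r<..<r} \<times> {a..b}) \<inter> U \<Longrightarrow> (f has_derivative f' s) (at s within {-r<..<r} \<times> {a..b})"
    and D2: "((\<lambda>\<epsilon>. f' (\<epsilon>, t) (0, 1)) has_vector_derivative D2) (at 0 within {-r<..<r})"
    and D1: "((\<lambda>t. f' (0, t) (1, 0)) has_vector_derivative D1) (at t within {a..b})"
  shows "D1 = D2"
proof -
  obtain I0 J0 where IJ: "open I0" "0 \<in> I0" "open J0" "t \<in> J0" "I0 \<times> J0 \<subseteq> U"
    using U by (rule open_prod_elim) auto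
  obtain d1 where d1: "d1 > 0" "ball 0 d1 \<subseteq> I0" using IJ(1,2) open_contains_ball by blast
  obtain d2 where d2: "d2 > 0" "ball t d2 \<subseteq> J0" using IJ(3,4) open_contains_ball by blast
  define \<rho> where "\<rho> = min r d1"
  \<comment> \<open>Clipping to \<open>{a..b}\<close> keeps the end point when \<open>t\<close> is
    one; the half radius puts the closed interval inside the open ball.\<close>
  define p where "p = max a (t - d2 / 2)"
  define q where "q = min b (t + d2 / 2)"
  have pq: "p < q" "t \<in> {p..q}" "{p..q} \<subseteq> {a..b}" "p < t \<or> p = a" "t < q \<or> q = b"
    using ab t d2(1) by (auto simp: p_def q_def)
  have \<rho>: "0 < \<rho>" "{-\<rho><..<\<rho>} \<subseteq> {-r<..<r}" using r d1(1) by (auto simp: \<rho>_def)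
  have "{-\<rho><..<\<rho>} \<subseteq> I0" using d1(2) by (auto simp: \<rho>_def dist_real_def subset_iff)
  moreover have "{p..q} \<subseteq> J0"
  proof
    fix x assume "x \<in> {p..q}"
    then have "x \<in> ball t d2" using d2(1) by (auto simp: p_def q_def dist_real_def)
    then show "x \<in> J0" using d2(2) by blast
  qed
  ultimately have box: "{-\<rho><..<\<rho>} \<times> {p..q} \<subseteq> ({-r<..<r} \<times> {a..b}) \<inter> U"
    using \<rho>(2) pq(3) IJ(5) by blast
  obtain B :: "'a set" and \<kappa> where B: "finite B" "\<And>b. bounded_linear (\<kappa> b)"
    "\<And>x. (\<Sum>b\<in>B. \<kappa> b x *\<^sub>R b) = x" using findim_coords[OF fd] by blast
  have "\<kappa> b D1 = \<kappa> b D2" for b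
  proof (rule mixed_partials_real[OF \<rho>(1) pq(1,2), where g="\<lambda>s. \<kappa> b (f s)" and g'="\<lambda>s v. \<kappa> b (f' s v)"])
    show "smooth_on ({-\<rho><..<\<rho>} \<times> {p..q}) (\<lambda>s. \<kappa> b (f s))"
      by (rule smooth_on_bounded_linear[OF B(2) smooth_on_subset[OF f box]])
    show "((\<lambda>s. \<kappa> b (f s)) has_derivative (\<lambda>v. \<kappa> b (f' s v))) (at s within {-\<rho><..<\<rho>} \<times> {p..q})"
      if "s \<in> {-\<rho><..<\<rho>} \<times> {p..q}" for s
      by (rule has_derivative_subset[OF bounded_linear.has_derivative[OF B(2) f']]) (use that box in auto)
    show "((\<lambda>\<epsilon>. \<kappa> b (f' (\<epsilon>, t) (0, 1))) has_vector_derivative \<kappa> b D2) (at 0 within {-\<rho><..<\<rho>})"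
      by (rule has_vector_derivative_within_subset[OF bounded_linear.has_vector_derivative[OF B(2) D2] \<rho>(2)])
    show "((\<lambda>t. \<kappa> b (f' (0, t) (1, 0))) has_vector_derivative \<kappa> b D1) (at t within {p..q})"
      by (rule has_vector_derivative_within_subset[OF bounded_linear.has_vector_derivative[OF B(2) D1] pq(3)])
  qed
  then have "(\<Sum>b\<in>B. \<kappa> b D1 *\<^sub>R b) = (\<Sum>b\<in>B. \<kappa> b D2 *\<^sub>R b)" by (simp only:)
  then show ?thesis unfolding B(3) .
qed

text \<open>A product rule for a linear map \<open>X z\<close> depending on a point \<open>z\<close>
  and applied to a moving vector, given the derivative in \<open>z\<close> only for each fixed
  vector. The vector is expanded so that finitely many fixed vectors suffice.\<close>

lemma has_vector_derivative_parametric_linear: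
  fixes X :: "'a::real_normed_vector \<Rightarrow> 'b::real_normed_vector \<Rightarrow> 'c::real_normed_vector"
  assumes fd: "findim TYPE('b)" and Y: "open Y" "\<And>z. z \<in> Y \<Longrightarrow> linear (X z)"
    and V: "open V" "\<tau> \<in> V" "y ` (J \<inter> V) \<subseteq> Y" and \<tau>: "\<tau> \<in> J"
    and D: "\<And>u. ((\<lambda>z. X z u) has_derivative D u) (at (y \<tau>))"
    and y: "(y has_vector_derivative y1) (at \<tau> within J)" and u: "(u has_vector_derivative u1) (at \<tau> within J)"
  shows "((\<lambda>\<tau>. X (y \<tau>) (u \<tau>)) has_vector_derivative D (u \<tau>) y1 + X (y \<tau>) u1) (at \<tau> within J)"
proof -
  obtain B :: "'b set" and \<kappa> where B: "finite B" "\<And>b. bounded_linear (\<kappa> b)"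
    "\<And>x. (\<Sum>b\<in>B. \<kappa> b x *\<^sub>R b) = x" using findim_coords[OF fd] by blast
  have exp: "X z v = (\<Sum>b\<in>B. \<kappa> b v *\<^sub>R X z b)" if "z \<in> Y" for z v
    using linear_sum[OF Y(2)[OF that], of "\<lambda>b. \<kappa> b v *\<^sub>R b" B]
    by (simp add: B(3) linear_scale[OF Y(2)[OF that]])
  have yY: "y \<tau> \<in> Y" using V \<tau> by blast
  have "((\<lambda>z. \<Sum>b\<in>B. \<kappa> b (u \<tau>) *\<^sub>R X z b) has_derivative (\<lambda>h. \<Sum>b\<in>B. \<kappa> b (u \<tau>) *\<^sub>R D b h)) (at (y \<tau>))"
    by (intro has_derivative_sum has_derivative_scaleR_right D)
  then have "((\<lambda>z. X z (u \<tau>)) has_derivative (\<lambda>h. \<Sum>b\<in>B. \<kappa> b (u \<tau>) *\<^sub>R D b h)) (at (y \<tau>))"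
    by (rule has_derivative_transform_within_open[OF _ Y(1) yY]) (simp add: exp)
  \<comment> \<open>The maps \<open>D u\<close> are given separately for each \<open>u\<close>;
    uniqueness expresses the one needed through those of the elements of \<open>B\<close>.\<close>
  then have Du: "D (u \<tau>) h = (\<Sum>b\<in>B. \<kappa> b (u \<tau>) *\<^sub>R D b h)" for h
    using has_derivative_unique[OF D] by metis
  have ud: "(u has_derivative (\<lambda>h. h *\<^sub>R u1)) (at \<tau> within J)" using u unfolding has_vector_derivative_def .
  have yd: "(y has_derivative (\<lambda>h. h *\<^sub>R y1)) (at \<tau> within J)" using y unfolding has_vector_derivative_def .
  have Xd: "((\<lambda>\<tau>. X (y \<tau>) b) has_derivative (\<lambda>h. D b (h *\<^sub>R y1))) (at \<tau> within J)" for b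
    by (rule has_derivative_compose[OF yd D])
  have "((\<lambda>\<tau>. \<Sum>b\<in>B. \<kappa> b (u \<tau>) *\<^sub>R X (y \<tau>) b) has_derivative
      (\<lambda>h. \<Sum>b\<in>B. \<kappa> b (u \<tau>) *\<^sub>R D b (h *\<^sub>R y1) + \<kappa> b (h *\<^sub>R u1) *\<^sub>R X (y \<tau>) b)) (at \<tau> within J)"
    by (intro has_derivative_sum has_derivative_scaleR bounded_linear.has_derivative[OF B(2) ud] Xd)
  then have "((\<lambda>\<tau>. X (y \<tau>) (u \<tau>)) has_derivative
      (\<lambda>h. \<Sum>b\<in>B. \<kappa> b (u \<tau>) *\<^sub>R D b (h *\<^sub>R y1) + \<kappa> b (h *\<^sub>R u1) *\<^sub>R X (y \<tau>) b)) (at \<tau> within J)"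
    by (rule has_derivative_transform_local[OF V(1,2) \<tau>, rotated]) (use exp V(3) in auto)
  moreover have "(\<Sum>b\<in>B. \<kappa> b (u \<tau>) *\<^sub>R D b (h *\<^sub>R y1) + \<kappa> b (h *\<^sub>R u1) *\<^sub>R X (y \<tau>) b) =
      h *\<^sub>R (D (u \<tau>) y1 + X (y \<tau>) u1)" for h
  proof -
    have "D (u \<tau>) (h *\<^sub>R y1) = h *\<^sub>R D (u \<tau>) y1" by (rule linear_scale[OF has_derivative_linear[OF D]])
    moreover have "X (y \<tau>) (h *\<^sub>R u1) = h *\<^sub>R X (y \<tau>) u1" by (rule linear_scale[OF Y(2)[OF yY]])
    ultimately show ?thesis
      by (simp add: sum.distrib exp[OF yY, symmetric] Du[symmetric] scaleR_add_right)
  qed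
  ultimately show ?thesis unfolding has_vector_derivative_def by simp
qed

section \<open>Left translation on a Lie group\<close>

context lie_group
begin

section \<open>Multiplication and left translation in charts\<close>

lemma smooth_into_mult:
  assumes S: "thick S" and H: "smooth_into S (carrier G) A H" and K: "smooth_into S (carrier G) A K"
  shows "smooth_into S (carrier G) A (\<lambda>s. H s \<otimes> K s)"
proof -
  have at: "atlas (carrier G) A" by unfold_locales
  have "smooth_into S (carrier G \<times> carrier G) (prod_atlas A A) (\<lambda>s. (H s, K s))"
    unfolding smooth_into_prod_iff[OF at at S] using H K by simp
  from smooth_into_map[OF atlas_prod[OF at at] at findim_prod[OF findim_model findim_model] mult_smooth this S]
  show ?thesis by simp
qed

lemma smooth_into_inv:
  assumes S: "thick S" and H: "smooth_into S (carrier G) A H"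
  shows "smooth_into S (carrier G) A (\<lambda>s. inv (H s))"
proof -
  have at: "atlas (carrier G) A" by unfold_locales
  from smooth_into_map[OF at at findim_model inv_smooth H S] show ?thesis .
qed

text \<open>On a product of chart images the two inverse charts are smooth maps into the group,
  hence so is their product; \<open>Q\<close> is a neighbourhood on which this product remains in
  the third chart.\<close>

lemma mult_chart:
  assumes c: "c1 \<in> A" "c2 \<in> A" "c \<in> A" and h: "h \<in> chart_dom c1" and k: "k \<in> chart_dom c2"
    and hk: "h \<otimes> k \<in> chart_dom c"
  shows "\<exists>Q. open Q \<and> (chart_map c1 h, chart_map c2 k) \<in> Q \<and>
    Q \<subseteq> (chart_map c1 ` chart_dom c1) \<times> (chart_map c2 ` chart_dom c2) \<and>
    (\<forall>z\<in>Q. chart_inv c1 (fst z) \<otimes> chart_inv c2 (snd z) \<in> chart_dom c) \<and>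
    smooth_on Q (\<lambda>z. chart_map c (chart_inv c1 (fst z) \<otimes> chart_inv c2 (snd z)))"
proof -
  let ?S = "(chart_map c1 ` chart_dom c1) \<times> (chart_map c2 ` chart_dom c2)"
  let ?F = "\<lambda>z. chart_inv c1 (fst z) \<otimes> chart_inv c2 (snd z)"
  have op: "open ?S" by (intro open_Times open_chart_image c)
  have S: "thick ?S" by (rule thick_open[OF op])
  have 1: "smooth_into ?S (carrier G) A (\<lambda>z. chart_inv c1 (fst z))"
    by (rule smooth_into_chart_inv[OF c(1) S smooth_on_fst[OF smooth_on_id]]) auto
  have 2: "smooth_into ?S (carrier G) A (\<lambda>z. chart_inv c2 (snd z))"
    by (rule smooth_into_chart_inv[OF c(2) S smooth_on_snd[OF smooth_on_id]]) auto
  have F: "smooth_into ?S (carrier G) A ?F" by (rule smooth_into_mult[OF S 1 2])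
  have s: "(chart_map c1 h, chart_map c2 k) \<in> ?S" using h k by blast
  have val: "?F (chart_map c1 h, chart_map c2 k) \<in> chart_dom c"
    using hk by (simp add: chart_inv_map c h k)
  obtain U where U: "open U" "(chart_map c1 h, chart_map c2 k) \<in> U" "?F ` (?S \<inter> U) \<subseteq> chart_dom c"
    "smooth_on (?S \<inter> U) (\<lambda>z. chart_map c (?F z))"
    using smooth_intoD[OF F s c(3) val] by blast
  have "open (?S \<inter> U)" using op U(1) by blast
  moreover have "(chart_map c1 h, chart_map c2 k) \<in> ?S \<inter> U" using s U(2) by blast
  moreover have "\<forall>z\<in>?S \<inter> U. ?F z \<in> chart_dom c" using U(3) by (rule image_subset_iff[THEN iffD1])
  ultimately show ?thesis using U(4) by (intro exI[of _ "?S \<inter> U"]) simp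
qed

text \<open>Left translation is multiplication with its first argument frozen. Writing its
  derivative as a partial derivative of multiplication makes the smooth dependence on
  \<open>h\<close> visible.\<close>

lemma left_translation_has_derivative:
  assumes c: "c1 \<in> A" "c2 \<in> A" and h: "h \<in> chart_dom c1" and k: "k \<in> chart_dom c2"
    and Q: "open Q" "(chart_map c1 h, chart_map c2 k) \<in> Q"
    and M: "smooth_on Q (\<lambda>z. chart_map c (chart_inv c1 (fst z) \<otimes> chart_inv c2 (snd z)))"
  shows "((chart_map c \<circ> (\<lambda>x. h \<otimes> x) \<circ> chart_inv c2) has_derivative
    (\<lambda>u. frechet_derivative (\<lambda>z. chart_map c (chart_inv c1 (fst z) \<otimes> chart_inv c2 (snd z)))
      (at (chart_map c1 h, chart_map c2 k)) (0, u))) (at (chart_map c2 k))"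
proof -
  have "((\<lambda>y. (chart_map c1 h, y)) has_derivative (\<lambda>u. (0, u))) (at (chart_map c2 k))"
    by (intro has_derivative_Pair has_derivative_ident has_derivative_const)
  from has_derivative_compose[OF this smooth_on_open_has_derivative[OF M Q]]
  show ?thesis by (simp add: o_def chart_inv_map c h)
qed

lemma differentiable_left_translation:
  assumes h: "h \<in> carrier G" and k: "k \<in> carrier G"
  shows "differentiable_map_at (\<lambda>x. h \<otimes> x) k"
  unfolding differentiable_map_at_def
proof (intro conjI ballI impI)
  show "k \<in> carrier G" by (rule k)
  show "h \<otimes> k \<in> carrier G" using h k by simp
  obtain c1 where c1: "c1 \<in> A" "h \<in> chart_dom c1" using cover[OF h] by blast
  fix c2 c assume c: "c2 \<in> A" "c \<in> A" "k \<in> chart_dom c2" "h \<otimes> k \<in> chart_dom c"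
  obtain Q where Q: "open Q" "(chart_map c1 h, chart_map c2 k) \<in> Q"
    "Q \<subseteq> (chart_map c1 ` chart_dom c1) \<times> (chart_map c2 ` chart_dom c2)"
    "\<And>z. z \<in> Q \<Longrightarrow> chart_inv c1 (fst z) \<otimes> chart_inv c2 (snd z) \<in> chart_dom c"
    "smooth_on Q (\<lambda>z. chart_map c (chart_inv c1 (fst z) \<otimes> chart_inv c2 (snd z)))"
    using mult_chart[OF c1(1) c(1,2) c1(2) c(3,4)] by blast
  show "(chart_map c \<circ> (\<lambda>x. h \<otimes> x) \<circ> chart_inv c2) differentiable at (chart_map c2 k)"
    by (rule differentiableI[OF left_translation_has_derivative[OF c1(1) c(1) c1(2) c(3) Q(1,2,5)]])
  let ?U = "(\<lambda>y. (chart_map c1 h, y)) -` Q"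
  have op: "open ?U" by (rule open_vimage[OF Q(1)]) (intro continuous_intros)
  have sub: "?U \<subseteq> chart_map c2 ` chart_dom c2" using Q(3) by blast
  have dom: "h \<otimes> chart_inv c2 y \<in> chart_dom c" if "y \<in> ?U" for y
    using Q(4)[of "(chart_map c1 h, y)"] that by (simp add: chart_inv_map c1)
  show "\<exists>U. open U \<and> chart_map c2 k \<in> U \<and> U \<subseteq> chart_map c2 ` chart_dom c2 \<and>
      (\<forall>y\<in>U. h \<otimes> chart_inv c2 y \<in> chart_dom c)"
    using op sub dom Q(2) by (intro exI[of _ ?U]) simp
qed

text \<open>The translating element, the base point and the vector all depend on \<open>s\<close>.
  In charts the result is the derivative of multiplication at a moving point, applied to a moving
  vector. The choice \<open>K = \<one>\<close> gives \<open>left_act\<close>, and \<open>H\<close>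
  the inverse of \<open>K\<close> gives \<open>left_triv\<close>.\<close>

lemma smooth_field_left_translation:
  assumes S: "thick S" and H: "smooth_into S (carrier G) A H" and K: "smooth_into S (carrier G) A K"
    and w: "smooth_field S K w"
  shows "smooth_field S (\<lambda>s. H s \<otimes> K s) (\<lambda>s. tangent_map A A (\<lambda>x. H s \<otimes> x) (K s) (w s))"
proof (rule smooth_field_chartI[OF smooth_into_mult[OF S H K]])
  fix s assume s: "s \<in> S"
  note Hc = smooth_into_carrier[OF H] and Kc = smooth_into_carrier[OF K]
  note diff = differentiable_left_translation[OF Hc Kc]
  show "tangent_map A A (\<lambda>x. H s \<otimes> x) (K s) (w s) \<in> tangent_space A (H s \<otimes> K s)"
    by (rule tangent_map_in[OF diff[OF s s] smooth_field_in[OF w s]])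
  obtain c1 where c1: "c1 \<in> A" "H s \<in> chart_dom c1" using cover[OF Hc[OF s]] by blast
  obtain c2 where c2: "c2 \<in> A" "K s \<in> chart_dom c2" using cover[OF Kc[OF s]] by blast
  have "H s \<otimes> K s \<in> carrier G" using Hc[OF s] Kc[OF s] by simp
  then obtain c where c: "c \<in> A" "H s \<otimes> K s \<in> chart_dom c" using cover by blast
  let ?M = "\<lambda>z. chart_map c (chart_inv c1 (fst z) \<otimes> chart_inv c2 (snd z))"
  let ?D = "\<lambda>z. frechet_derivative ?M (at z)"
  obtain Q where Q: "open Q" "(chart_map c1 (H s), chart_map c2 (K s)) \<in> Q"
    "Q \<subseteq> (chart_map c1 ` chart_dom c1) \<times> (chart_map c2 ` chart_dom c2)"
    "\<And>z. z \<in> Q \<Longrightarrow> chart_inv c1 (fst z) \<otimes> chart_inv c2 (snd z) \<in> chart_dom c"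
    "smooth_on Q ?M"
    using mult_chart[OF c1(1) c2(1) c(1) c1(2) c2(2) c(2)] by blast
  obtain U1 where U1: "open U1" "s \<in> U1" "H ` (S \<inter> U1) \<subseteq> chart_dom c1" "smooth_on (S \<inter> U1) (\<lambda>s. chart_map c1 (H s))"
    using smooth_intoD[OF H s c1] by blast
  obtain U2 where U2: "open U2" "s \<in> U2" "K ` (S \<inter> U2) \<subseteq> chart_dom c2" "smooth_on (S \<inter> U2) (\<lambda>s. chart_map c2 (K s))"
    using smooth_intoD[OF K s c2] by blast
  obtain U3 where U3: "open U3" "s \<in> U3" "smooth_on (S \<inter> U3) (\<lambda>s. w s c2)"
    using smooth_fieldD[OF w s c2] by blast
  let ?U = "U1 \<inter> U2 \<inter> U3"
  let ?p = "\<lambda>t. (chart_map c1 (H t), chart_map c2 (K t))"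
  have p: "smooth_on (S \<inter> ?U) ?p"
    by (intro smooth_on_Pair smooth_on_subset[OF U1(4)] smooth_on_subset[OF U2(4)]) auto
  obtain W where W: "open W" "(S \<inter> ?U) \<inter> ?p -` Q = S \<inter> ?U \<inter> W"
    using continuous_openin_preimage_gen[OF smooth_on_continuous[OF p] Q(1)] unfolding openin_open by blast
  let ?V = "?U \<inter> W"
  have sV: "open ?V" "s \<in> ?V" using U1 U2 U3 W Q(2) s by auto
  have dom: "H t \<in> chart_dom c1" "K t \<in> chart_dom c2" "?p t \<in> Q" "t \<in> S" if "t \<in> S \<inter> ?V" for t
    using that U1(3) U2(3) W(2) by auto
  have prod: "H t \<otimes> K t \<in> chart_dom c" if t: "t \<in> S \<inter> ?V" for t
    using Q(4)[OF dom(3)[OF t]] by (simp add: chart_inv_map c1 c2 dom[OF t])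
  have "smooth_on (S \<inter> ?V) (\<lambda>t. ?D (?p t) (0, w t c2))"
  proof (rule smooth_on_derivative_apply[OF findim_prod[OF findim_model findim_model], where S=Q
        and f'="?D" and x="?p" and u="\<lambda>t. (0, w t c2)"])
    show "smooth_on Q (\<lambda>z. ?D z v)" for v by (rule smooth_on_frechet_derivative[OF Q(5,1)])
    show "linear (?D z)" if "z \<in> Q" for z
      by (rule has_derivative_linear[OF smooth_on_open_has_derivative[OF Q(5,1) that]])
    show "smooth_on (S \<inter> ?V) ?p" by (rule smooth_on_subset[OF p]) blast
    show "?p ` (S \<inter> ?V) \<subseteq> Q" using dom(3) by blast
    show "smooth_on (S \<inter> ?V) (\<lambda>t. (0, w t c2))"
      by (intro smooth_on_Pair smooth_on_const smooth_on_subset[OF U3(3)]) auto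
  qed
  then have "smooth_on (S \<inter> ?V) (\<lambda>t. tangent_map A A (\<lambda>x. H t \<otimes> x) (K t) (w t) c)"
  proof (rule smooth_on_cong[rotated])
    fix t assume t: "t \<in> S \<inter> ?V"
    have "frechet_derivative (chart_map c \<circ> (\<lambda>x. H t \<otimes> x) \<circ> chart_inv c2) (at (chart_map c2 (K t))) =
        (\<lambda>u. ?D (?p t) (0, u))"
      using left_translation_has_derivative[OF c1(1) c2(1) dom(1,2)[OF t] Q(1) dom(3)[OF t] Q(5)]
      by (rule frechet_derivative_at[symmetric])
    then show "?D (?p t) (0, w t c2) = tangent_map A A (\<lambda>x. H t \<otimes> x) (K t) (w t) c"
      using tangent_map_coord[OF diff[OF dom(4)[OF t] dom(4)[OF t]] smooth_field_in[OF w dom(4)[OF t]]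
          c2(1) dom(2)[OF t] c(1) prod[OF t]] by simp
  qed
  moreover have "(\<lambda>s. H s \<otimes> K s) ` (S \<inter> ?V) \<subseteq> chart_dom c" using prod by blast
  ultimately show "\<exists>c\<in>A. \<exists>U. open U \<and> s \<in> U \<and> (\<lambda>s. H s \<otimes> K s) ` (S \<inter> U) \<subseteq> chart_dom c \<and>
      smooth_on (S \<inter> U) (\<lambda>t. tangent_map A A (\<lambda>x. H t \<otimes> x) (K t) (w t) c)"
    using sV by (intro bexI[OF _ c(1)] exI[of _ ?V]) blast
qed

subsection \<open>The left trivialization of the tangent and cotangent bundles\<close>

lemma left_act_in:
  assumes g: "g \<in> carrier G" and \<xi>: "\<xi> \<in> tangent_space A \<one>"
  shows "left_act G A g \<xi> \<in> tangent_space A g"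
  unfolding left_act_def using tangent_map_in[OF differentiable_left_translation[OF g one_closed] \<xi>] g by simp

lemma left_triv_in:
  assumes g: "g \<in> carrier G" and w: "w \<in> tangent_space A g"
  shows "left_triv G A g w \<in> tangent_space A \<one>"
  unfolding left_triv_def
  using tangent_map_in[OF differentiable_left_translation[OF inv_closed[OF g] g] w] g by simp

text \<open>The field \<open>g \<mapsto> g \<xi>\<close> is left-invariant: the chain rule for
  translation by \<open>g\<close> followed by translation by \<open>h\<close>.\<close>

lemma tangent_map_left_act:
  assumes h: "h \<in> carrier G" and g: "g \<in> carrier G" and \<xi>: "\<xi> \<in> tangent_space A \<one>"
  shows "tangent_map A A (\<lambda>x. h \<otimes> x) g (left_act G A g \<xi>) = left_act G A (h \<otimes> g) \<xi>"
proof -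
  have "tangent_map A A (\<lambda>x. h \<otimes> x) (g \<otimes> \<one>) (tangent_map A A (\<lambda>x. g \<otimes> x) \<one> \<xi>) =
      tangent_map A A (\<lambda>x. (h \<otimes> g) \<otimes> x) \<one> \<xi>"
    by (rule tangent_map_comp) (use h g \<xi> in \<open>auto intro!: differentiable_left_translation simp: m_assoc\<close>)
  then show ?thesis unfolding left_act_def using g by simp
qed

lemma left_act_one:
  assumes \<xi>: "\<xi> \<in> tangent_space A \<one>"
  shows "left_act G A \<one> \<xi> = \<xi>"
proof -
  have "tangent_map A A (\<lambda>x. x) \<one> (tangent_map A A (\<lambda>x. x) \<one> \<xi>) = tangent_map A A (\<lambda>x. \<one> \<otimes> x) \<one> \<xi>"
    by (rule tangent_map_comp)
      (use \<xi> in \<open>auto intro!: differentiable_left_translation differentiable_map_at_id\<close>)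
  then show ?thesis unfolding left_act_def by (simp add: tangent_map_id[OF one_closed \<xi>])
qed

lemma left_triv_left_act:
  assumes g: "g \<in> carrier G" and \<xi>: "\<xi> \<in> tangent_space A \<one>"
  shows "left_triv G A g (left_act G A g \<xi>) = \<xi>"
  unfolding left_triv_def using tangent_map_left_act[OF inv_closed[OF g] g \<xi>] g by (simp add: left_act_one[OF \<xi>])

lemma left_act_left_triv:
  assumes g: "g \<in> carrier G" and w: "w \<in> tangent_space A g"
  shows "left_act G A g (left_triv G A g w) = w"
proof -
  have "tangent_map A A (\<lambda>x. g \<otimes> x) (inv g \<otimes> g) (tangent_map A A (\<lambda>x. inv g \<otimes> x) g w) = tangent_map A A (\<lambda>x. x) g w"
    by (rule tangent_map_comp)
      (use g w in \<open>auto intro!: differentiable_left_translation differentiable_map_at_id simp: m_assoc[symmetric]\<close>)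
  then show ?thesis unfolding left_act_def left_triv_def using g by (simp add: tangent_map_id[OF g w])
qed

lemma left_triv_diff:
  "g \<in> carrier G \<Longrightarrow> left_triv G A g (tvec_diff v w) = tvec_diff (left_triv G A g v) (left_triv G A g w)"
  unfolding left_triv_def by (rule tangent_map_linear(2)[OF differentiable_left_translation]) auto

lemma left_triv_zero: "g \<in> carrier G \<Longrightarrow> left_triv G A g tvec_zero = tvec_zero"
  unfolding left_triv_def by (rule tangent_map_linear(4)[OF differentiable_left_translation]) auto

lemma smooth_field_left_act:
  assumes S: "thick S" and \<Gamma>: "smooth_into S (carrier G) A \<Gamma>" and \<zeta>: "smooth_field S (\<lambda>_. \<one>) \<zeta>"
  shows "smooth_field S \<Gamma> (\<lambda>s. left_act G A (\<Gamma> s) (\<zeta> s))"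
proof (rule smooth_field_cong)
  show "smooth_field S (\<lambda>s. \<Gamma> s \<otimes> \<one>) (\<lambda>s. tangent_map A A (\<lambda>x. \<Gamma> s \<otimes> x) \<one> (\<zeta> s))"
    by (rule smooth_field_left_translation[OF S \<Gamma> smooth_into_const[OF S one_closed] \<zeta>])
qed (use smooth_into_carrier[OF \<Gamma>] in \<open>simp_all add: left_act_def\<close>)

lemma smooth_field_left_triv:
  assumes S: "thick S" and \<Gamma>: "smooth_into S (carrier G) A \<Gamma>" and w: "smooth_field S \<Gamma> w"
  shows "smooth_field S (\<lambda>_. \<one>) (\<lambda>s. left_triv G A (\<Gamma> s) (w s))"
proof (rule smooth_field_cong)
  show "smooth_field S (\<lambda>s. inv (\<Gamma> s) \<otimes> \<Gamma> s) (\<lambda>s. tangent_map A A (\<lambda>x. inv (\<Gamma> s) \<otimes> x) (\<Gamma> s) (w s))"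
    by (rule smooth_field_left_translation[OF S smooth_into_inv[OF S \<Gamma>] \<Gamma> w])
qed (use smooth_into_carrier[OF \<Gamma>] in \<open>simp_all add: left_triv_def\<close>)

text \<open>The transpose of \<open>left_act G A g\<close>, taking a covector at \<open>g\<close> to
  the dual of the Lie algebra, with the zero normalization off the tangent space.\<close>

definition left_act_dual :: "'g \<Rightarrow> (('g, 'e) tvec \<Rightarrow> real) \<Rightarrow> ('g, 'e) tvec \<Rightarrow> real" where
  "left_act_dual g q \<xi> = (if \<xi> \<in> tangent_space A \<one> then q (left_act G A g \<xi>) else 0)"

text \<open>The transpose of \<open>left_triv G A g\<close>, inverse to
  \<open>left_act_dual g\<close> on covectors.\<close>

definition left_triv_dual :: "'g \<Rightarrow> (('g, 'e) tvec \<Rightarrow> real) \<Rightarrow> ('g, 'e) tvec \<Rightarrow> real" where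
  "left_triv_dual g \<nu> w = (if w \<in> tangent_space A g then \<nu> (left_triv G A g w) else 0)"

lemma left_act_dual_in:
  assumes g: "g \<in> carrier G" and q: "q \<in> cotangent_space A g"
  shows "left_act_dual g q \<in> cotangent_space A \<one>"
proof -
  note lin = tangent_map_linear[OF differentiable_left_translation[OF g one_closed], folded left_act_def]
  show ?thesis unfolding cotangent_space_def
    by (auto simp: left_act_dual_def tvec_add_in tvec_scale_in lin left_act_in[OF g]
        cotangent_add[OF q] cotangent_scale[OF q])
qed

lemma left_triv_dual_in:
  assumes g: "g \<in> carrier G" and \<nu>: "\<nu> \<in> cotangent_space A \<one>"
  shows "left_triv_dual g \<nu> \<in> cotangent_space A g"
proof -
  note lin = tangent_map_linear[OF differentiable_left_translation[OF inv_closed[OF g] g], folded left_triv_def]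
  show ?thesis unfolding cotangent_space_def
    by (auto simp: left_triv_dual_def tvec_add_in tvec_scale_in lin left_triv_in[OF g]
        cotangent_add[OF \<nu>] cotangent_scale[OF \<nu>])
qed

lemma left_triv_dual_left_act_dual:
  assumes g: "g \<in> carrier G" and q: "q \<in> cotangent_space A g"
  shows "left_triv_dual g (left_act_dual g q) = q"
  by (rule ext) (auto simp: left_triv_dual_def left_act_dual_def left_triv_in[OF g] left_act_left_triv[OF g]
      cotangent_outside[OF q])

lemma left_act_dual_left_triv_dual:
  assumes g: "g \<in> carrier G" and \<nu>: "\<nu> \<in> cotangent_space A \<one>"
  shows "left_act_dual g (left_triv_dual g \<nu>) = \<nu>"
  by (rule ext) (auto simp: left_triv_dual_def left_act_dual_def left_act_in[OF g] left_triv_left_act[OF g]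
      cotangent_outside[OF \<nu>])

text \<open>Testing on a fixed vector at the identity amounts to pairing \<open>q\<close> with the
  left-invariant field it generates, taken along \<Gamma>.\<close>

lemma smooth_cofield_left_act_dual:
  assumes S: "thick S" and \<Gamma>: "smooth_into S (carrier G) A \<Gamma>" and q: "smooth_cofield S \<Gamma> q"
  shows "smooth_cofield S (\<lambda>_. \<one>) (\<lambda>s. left_act_dual (\<Gamma> s) (q s))"
  unfolding smooth_cofield_def
proof (intro conjI ballI impI)
  show "left_act_dual (\<Gamma> s) (q s) \<in> cotangent_space A \<one>" if "s \<in> S" for s
    by (rule left_act_dual_in[OF smooth_into_carrier[OF \<Gamma> that] smooth_cofield_in[OF q that]])
  fix s d assume d: "d \<in> A" "\<one> \<in> chart_dom d"
  have "smooth_on S (\<lambda>s. left_act_dual (\<Gamma> s) (q s) (tvec_of A d \<one> u))" for u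
  proof -
    have "smooth_field S (\<lambda>_. \<one>) (\<lambda>_. tvec_of A d \<one> u)"
      by (rule smooth_field_tvec_of[OF smooth_into_const[OF S one_closed] d(1) _ smooth_on_const]) (use d in auto)
    from smooth_on_pairing[OF S \<Gamma> q smooth_field_left_act[OF S \<Gamma> this]]
    show ?thesis by (simp add: left_act_dual_def tvec_of_in d)
  qed
  then show "\<exists>U. open U \<and> s \<in> U \<and> (\<lambda>_. \<one>) ` (S \<inter> U) \<subseteq> chart_dom d \<and>
      (\<forall>u. smooth_on (S \<inter> U) (\<lambda>s. left_act_dual (\<Gamma> s) (q s) (tvec_of A d \<one> u)))"
    using d(2) by (intro exI[of _ UNIV]) auto
qed

text \<open>Here the test vectors belong to a chart around the moving base point, so the argument
  runs on a piece of \<open>S\<close> where \<Gamma> stays in that chart.\<close>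

lemma smooth_cofield_left_triv_dual:
  assumes S: "thick S" and \<Gamma>: "smooth_into S (carrier G) A \<Gamma>" and \<nu>: "smooth_cofield S (\<lambda>_. \<one>) \<nu>"
  shows "smooth_cofield S \<Gamma> (\<lambda>s. left_triv_dual (\<Gamma> s) (\<nu> s))"
  unfolding smooth_cofield_def
proof (intro conjI ballI impI)
  show "left_triv_dual (\<Gamma> s) (\<nu> s) \<in> cotangent_space A (\<Gamma> s)" if "s \<in> S" for s
    by (rule left_triv_dual_in[OF smooth_into_carrier[OF \<Gamma> that] smooth_cofield_in[OF \<nu> that]])
  fix s c assume s: "s \<in> S" and c: "c \<in> A" "\<Gamma> s \<in> chart_dom c"
  obtain U where U: "open U" "s \<in> U" "\<Gamma> ` (S \<inter> U) \<subseteq> chart_dom c" using smooth_intoD[OF \<Gamma> s c] by blast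
  note SU = thick_Int_open[OF S U(1)] and \<Gamma>U = smooth_into_subset[OF \<Gamma> S U(1)]
  have dom: "\<Gamma> t \<in> chart_dom c" if "t \<in> S \<inter> U" for t using that U(3) by blast
  have "smooth_on (S \<inter> U) (\<lambda>s. left_triv_dual (\<Gamma> s) (\<nu> s) (tvec_of A c (\<Gamma> s) u))" for u
  proof -
    have "smooth_field (S \<inter> U) \<Gamma> (\<lambda>s. tvec_of A c (\<Gamma> s) u)"
      by (rule smooth_field_tvec_of[OF \<Gamma>U c(1) U(3) smooth_on_const])
    from smooth_on_pairing[OF SU smooth_into_const[OF SU one_closed] smooth_cofield_subset[OF \<nu> Int_lower1]
        smooth_field_left_triv[OF SU \<Gamma>U this]]
    show ?thesis
      by (rule smooth_on_cong[rotated]) (simp add: left_triv_dual_def tvec_of_in[OF c(1) dom])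
  qed
  with U show "\<exists>U. open U \<and> s \<in> U \<and> \<Gamma> ` (S \<inter> U) \<subseteq> chart_dom c \<and>
      (\<forall>u. smooth_on (S \<inter> U) (\<lambda>s. left_triv_dual (\<Gamma> s) (\<nu> s) (tvec_of A c (\<Gamma> s) u)))"
    by (intro exI[of _ U]) simp
qed

end

section \<open>Variations of curves\<close>

lemma has_vector_derivative_transform_local:
  assumes "open U" "s \<in> U" "s \<in> S" "\<And>x. x \<in> S \<inter> U \<Longrightarrow> f x = g x" "(f has_vector_derivative D) (at s within S)"
  shows "(g has_vector_derivative D) (at s within S)"
  unfolding has_vector_derivative_def
proof (rule has_derivative_transform_local[OF assms(1-3), of f])
  show "f x = g x" if "x \<in> S \<inter> U" for x by (rule assms(4)[OF that])
  show "(f has_derivative (\<lambda>x. x *\<^sub>R D)) (at s within S)" using assms(5) unfolding has_vector_derivative_def .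
qed

lemma has_vector_derivative_snd_path: "((\<lambda>\<tau>. (x, \<tau>)) has_vector_derivative (0, 1)) (at t within J)"
proof -
  have "((\<lambda>\<tau>. (x, \<tau>)) has_derivative (\<lambda>h. (0, h))) (at t within J)"
    by (intro has_derivative_Pair has_derivative_ident has_derivative_const)
  then show ?thesis unfolding has_vector_derivative_def by simp
qed

lemma has_vector_derivative_fst_path: "((\<lambda>\<tau>. (\<tau>, x)) has_vector_derivative (1, 0)) (at t within J)"
proof -
  have "((\<lambda>\<tau>. (\<tau>, x)) has_derivative (\<lambda>h. (h, 0))) (at t within J)"
    by (intro has_derivative_Pair has_derivative_ident has_derivative_const)
  then show ?thesis unfolding has_vector_derivative_def by simp
qed

lemma vector_derivative_cong_within:
  assumes "t \<in> J" "\<And>x. x \<in> J \<Longrightarrow> f x = g x"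
  shows "vector_derivative f (at t within J) = vector_derivative g (at t within J)"
proof -
  have "(f has_vector_derivative y) (at t within J) \<longleftrightarrow> (g has_vector_derivative y) (at t within J)" for y
    using has_vector_derivative_transform[OF assms(1), of g f] has_vector_derivative_transform[OF assms(1), of f g]
      assms(2) by metis
  then show ?thesis unfolding vector_derivative_def by simp
qed

lemma velocity_cong:
  fixes A :: "('m, 'e::real_normed_vector) chart set"
  assumes "t \<in> J" "\<And>x. x \<in> J \<Longrightarrow> \<gamma> x = \<gamma>' x"
  shows "velocity A J \<gamma> t = velocity A J \<gamma>' t"
proof
  fix d :: "('m, 'e) chart"
  have "vector_derivative (chart_map d \<circ> \<gamma>) (at t within J) = vector_derivative (chart_map d \<circ> \<gamma>') (at t within J)"
    by (rule vector_derivative_cong_within[OF assms(1)]) (simp add: assms(2))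
  then show "velocity A J \<gamma> t d = velocity A J \<gamma>' t d"
    unfolding velocity_def using assms by simp
qed

lemma tvec_deriv_cong:
  assumes "t \<in> J" "\<And>x. x \<in> J \<Longrightarrow> w x = w' x"
  shows "tvec_deriv J w t = tvec_deriv J w' t"
  unfolding tvec_deriv_def by (intro ext vector_derivative_cong_within[OF assms(1)]) (simp add: assms(2))

lemma velocity_const:
  fixes A :: "('m, 'e::real_normed_vector) chart set"
  assumes "thick J" "t \<in> J" "\<And>x. x \<in> J \<Longrightarrow> \<gamma> x = y"
  shows "velocity A J \<gamma> t = tvec_zero"
proof
  fix d :: "('m, 'e) chart"
  have "((chart_map d \<circ> \<gamma>) has_vector_derivative 0) (at t within J)"
    by (rule has_vector_derivative_transform[OF assms(2), of _ "\<lambda>_. chart_map d y"]) (auto simp: assms(3))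
  from thick_vector_derivative[OF assms(1,2) this] show "velocity A J \<gamma> t d = tvec_zero d"
    by (simp add: velocity_def tvec_zero_def)
qed

context smooth_manifold
begin

lemma cotangent_diff:
  assumes "p \<in> cotangent_space A x" "v \<in> tangent_space A x" "w \<in> tangent_space A x"
  shows "p (tvec_diff v w) = p v - p w"
proof -
  have "tvec_diff v w = tvec_add v (tvec_scale (- 1) w)"
    unfolding tvec_diff_def tvec_add_def tvec_scale_def by auto
  then show ?thesis
    using cotangent_add[OF assms(1,2) tvec_scale_in[OF assms(3)], of "- 1"] cotangent_scale[OF assms(1,3), of "- 1"]
    by simp
qed

lemma smooth_on_const_field_coord:
  assumes S: "thick S" and w: "smooth_field S (\<lambda>_. x) w" and c: "c \<in> A" "x \<in> chart_dom c"
  shows "smooth_on S (\<lambda>s. w s c)"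
proof (rule smooth_on_local[OF S])
  show "\<exists>U. open U \<and> s \<in> U \<and> smooth_on (S \<inter> U) (\<lambda>s. w s c)" if "s \<in> S" for s
    using smooth_fieldD[OF w that c] by blast
qed

section \<open>Partial velocities and slices of families\<close>

lemma smooth_field_velocity_snd:
  fixes I J :: "real set"
  assumes "thick I" "thick J" "smooth_into (I \<times> J) M A \<Gamma>"
  shows "smooth_field (I \<times> J) \<Gamma> (\<lambda>s. velocity A J (\<lambda>\<tau>. \<Gamma> (fst s, \<tau>)) (snd s))"
  by (rule smooth_field_velocity[where J="\<lambda>_. J" and t=snd and \<phi>="\<lambda>s \<tau>. (fst s, \<tau>)" and v="(0, 1)",
        OF findim_prod[OF findim_real findim_real] thick_Times[OF assms(1,2)] assms(3)])
    (auto intro!: has_vector_derivative_snd_path smooth_on_Pair smooth_on_const smooth_on_id assms)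

lemma smooth_field_velocity_fst:
  fixes I J :: "real set"
  assumes "thick I" "thick J" "smooth_into (I \<times> J) M A \<Gamma>"
  shows "smooth_field (I \<times> J) \<Gamma> (\<lambda>s. velocity A I (\<lambda>\<epsilon>. \<Gamma> (\<epsilon>, snd s)) (fst s))"
  by (rule smooth_field_velocity[where J="\<lambda>_. I" and t=fst and \<phi>="\<lambda>s \<tau>. (\<tau>, snd s)" and v="(1, 0)",
        OF findim_prod[OF findim_real findim_real] thick_Times[OF assms(1,2)] assms(3)])
    (auto intro!: has_vector_derivative_fst_path smooth_on_Pair smooth_on_const smooth_on_id assms)

lemma smooth_into_slice_snd:
  fixes I J :: "real set"
  assumes "thick J" "smooth_into (I \<times> J) M A \<Gamma>" "\<epsilon> \<in> I"
  shows "smooth_into J M A (\<lambda>t. \<Gamma> (\<epsilon>, t))"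
  by (rule smooth_into_compose[OF findim_prod[OF findim_real findim_real] assms(2) _ _ assms(1)])
    (use assms(3) in \<open>auto intro!: smooth_on_Pair smooth_on_const smooth_on_id\<close>)

lemma smooth_into_slice_fst:
  fixes I J :: "real set"
  assumes "thick I" "smooth_into (I \<times> J) M A \<Gamma>" "t \<in> J"
  shows "smooth_into I M A (\<lambda>\<epsilon>. \<Gamma> (\<epsilon>, t))"
  by (rule smooth_into_compose[OF findim_prod[OF findim_real findim_real] assms(2) _ _ assms(1)])
    (use assms(3) in \<open>auto intro!: smooth_on_Pair smooth_on_const smooth_on_id\<close>)

lemma smooth_field_slice_snd:
  fixes I J :: "real set"
  assumes "smooth_field (I \<times> J) \<Gamma> w" "\<epsilon> \<in> I"
  shows "smooth_field J (\<lambda>t. \<Gamma> (\<epsilon>, t)) (\<lambda>t. w (\<epsilon>, t))"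
  by (rule smooth_field_compose[OF findim_prod[OF findim_real findim_real] assms(1)])
    (use assms(2) in \<open>auto intro!: smooth_on_Pair smooth_on_const smooth_on_id\<close>)

lemma smooth_field_slice_fst:
  fixes I J :: "real set"
  assumes "smooth_field (I \<times> J) \<Gamma> w" "t \<in> J"
  shows "smooth_field I (\<lambda>\<epsilon>. \<Gamma> (\<epsilon>, t)) (\<lambda>\<epsilon>. w (\<epsilon>, t))"
  by (rule smooth_field_compose[OF findim_prod[OF findim_real findim_real] assms(1)])
    (use assms(2) in \<open>auto intro!: smooth_on_Pair smooth_on_const smooth_on_id\<close>)

lemma const_field_has_vector_derivative:
  fixes J :: "real set"
  assumes "thick J" "t \<in> J" "smooth_field J (\<lambda>_. x) w" "c \<in> A" "x \<in> chart_dom c"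
  shows "((\<lambda>t. w t c) has_vector_derivative tvec_deriv J w t c) (at t within J)"
proof -
  obtain f' where f': "((\<lambda>t. w t c) has_derivative f') (at t within J)"
    using smooth_on_derivative[OF assms(1) smooth_on_const_field_coord[OF assms(1,3-5)]] assms(2) by metis
  have "(\<lambda>h. h *\<^sub>R f' 1) = f'"
  proof
    show "h *\<^sub>R f' 1 = f' h" for h using linear_scale[OF has_derivative_linear[OF f'], of h 1] by simp
  qed
  then have der: "((\<lambda>t. w t c) has_vector_derivative f' 1) (at t within J)"
    unfolding has_vector_derivative_def using f' by (simp only:)
  then show ?thesis unfolding tvec_deriv_def thick_vector_derivative[OF assms(1,2) der] .
qed

end

context lie_group
begin

section \<open>Trivialized partial velocities and left-invariant fields\<close>

definition body_velocity :: "real set \<Rightarrow> (real \<times> real \<Rightarrow> 'g) \<Rightarrow> real \<times> real \<Rightarrow> ('g, 'e) tvec" where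
  "body_velocity J \<Gamma> s = left_triv G A (\<Gamma> s) (velocity A J (\<lambda>\<tau>. \<Gamma> (fst s, \<tau>)) (snd s))"

definition body_variation :: "real set \<Rightarrow> (real \<times> real \<Rightarrow> 'g) \<Rightarrow> real \<times> real \<Rightarrow> ('g, 'e) tvec" where
  "body_variation I \<Gamma> s = left_triv G A (\<Gamma> s) (velocity A I (\<lambda>\<epsilon>. \<Gamma> (\<epsilon>, snd s)) (fst s))"

lemma smooth_field_body_velocity:
  assumes "thick I" "thick J" "smooth_into (I \<times> J) (carrier G) A \<Gamma>"
  shows "smooth_field (I \<times> J) (\<lambda>_. \<one>) (body_velocity J \<Gamma>)"
  using smooth_field_left_triv[OF thick_Times[OF assms(1,2)] assms(3) smooth_field_velocity_snd[OF assms]]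
  unfolding body_velocity_def[abs_def] .

lemma smooth_field_body_variation:
  assumes "thick I" "thick J" "smooth_into (I \<times> J) (carrier G) A \<Gamma>"
  shows "smooth_field (I \<times> J) (\<lambda>_. \<one>) (body_variation I \<Gamma>)"
  using smooth_field_left_triv[OF thick_Times[OF assms(1,2)] assms(3) smooth_field_velocity_fst[OF assms]]
  unfolding body_variation_def[abs_def] .

text \<open>Translating a curve by a constant does not change its trivialized velocity, since
  left-invariant fields are carried to themselves. Hence a family may be moved to the identity
  without changing \<zeta> or \<eta>.\<close>

lemma velocity_left_translation:
  assumes J: "thick J" and t: "t \<in> J" and \<gamma>: "smooth_into J (carrier G) A \<gamma>" and h: "h \<in> carrier G"
  shows "velocity A J (\<lambda>t. h \<otimes> \<gamma> t) t =
    left_act G A (h \<otimes> \<gamma> t) (left_triv G A (\<gamma> t) (velocity A J \<gamma> t))"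
proof -
  note \<gamma>t = smooth_into_carrier[OF \<gamma> t] and v = velocity_in[OF J t \<gamma>]
  have "velocity A J (\<lambda>t. h \<otimes> \<gamma> t) t = tangent_map A A (\<lambda>x. h \<otimes> x) (\<gamma> t) (velocity A J \<gamma> t)"
    by (rule velocity_map[OF J t \<gamma> differentiable_left_translation[OF h \<gamma>t]
          smooth_into_mult[OF J smooth_into_const[OF J h] \<gamma>]])
  also have "velocity A J \<gamma> t = left_act G A (\<gamma> t) (left_triv G A (\<gamma> t) (velocity A J \<gamma> t))"
    by (rule left_act_left_triv[OF \<gamma>t v, symmetric])
  also have "tangent_map A A (\<lambda>x. h \<otimes> x) (\<gamma> t) \<dots> =
      left_act G A (h \<otimes> \<gamma> t) (left_triv G A (\<gamma> t) (velocity A J \<gamma> t))"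
    by (rule tangent_map_left_act[OF h \<gamma>t left_triv_in[OF \<gamma>t v]])
  finally show ?thesis .
qed

text \<open>In the chart \<open>d\<close>, the value at the point with coordinates \<open>y\<close>
  of the left-invariant field whose value at the identity has coordinates \<open>u\<close>. Its
  derivatives in \<open>y\<close> at the identity give the bracket.\<close>

definition left_field_coord :: "('g, 'e) chart \<Rightarrow> 'e \<Rightarrow> 'e \<Rightarrow> 'e" where
  "left_field_coord d y u = left_act G A (chart_inv d y) (tvec_of A d \<one> u) d"

lemma left_field_coord_eq:
  assumes "d \<in> A" "\<one> \<in> chart_dom d" "h \<in> chart_dom d" "\<xi> \<in> tangent_space A \<one>"
  shows "left_act G A h \<xi> d = left_field_coord d (chart_map d h) (\<xi> d)"
  unfolding left_field_coord_def chart_inv_map[OF assms(1,3)] tvec_of_eq[OF assms(4,1,2)] ..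

lemma left_field_coord_one:
  assumes d: "d \<in> A" "\<one> \<in> chart_dom d"
  shows "left_field_coord d (chart_map d \<one>) u = u"
  unfolding left_field_coord_def chart_inv_map[OF d] left_act_one[OF tvec_of_in[OF d]] by (rule tvec_of_self[OF d])

lemma left_field_coord_linear:
  assumes d: "d \<in> A" "\<one> \<in> chart_dom d" and y: "y \<in> chart_map d ` chart_dom d"
  shows "linear (left_field_coord d y)"
proof -
  have h: "chart_inv d y \<in> carrier G" using chart_inv_dom[OF y] dom_subset[OF d(1)] by blast
  note lin = tangent_map_linear[OF differentiable_left_translation[OF h one_closed], folded left_act_def]
  show ?thesis
    by (rule linearI; simp only: left_field_coord_def tvec_of_add[OF d] tvec_of_scale[OF d] lin(1,3))
      (simp_all add: tvec_add_def tvec_scale_def)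
qed

lemma smooth_on_left_field_coord:
  assumes d: "d \<in> A" "\<one> \<in> chart_dom d"
  shows "smooth_on (chart_map d ` chart_dom d) (\<lambda>y. left_field_coord d y u)"
proof -
  let ?Y = "chart_map d ` chart_dom d"
  have Y: "thick ?Y" by (rule thick_open[OF open_chart_image[OF d(1)]])
  have inv: "smooth_into ?Y (carrier G) A (chart_inv d)"
    by (rule smooth_into_chart_inv[OF d(1) Y smooth_on_id]) auto
  have "smooth_field ?Y (\<lambda>_. \<one>) (\<lambda>_. tvec_of A d \<one> u)"
    by (rule smooth_field_tvec_of[OF smooth_into_const[OF Y one_closed] d(1) _ smooth_on_const]) (use d in auto)
  from smooth_field_left_act[OF Y inv this]
  have w: "smooth_field ?Y (chart_inv d) (\<lambda>y. left_act G A (chart_inv d y) (tvec_of A d \<one> u))" .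
  show ?thesis
  proof (rule smooth_on_local[OF Y])
    show "\<exists>U. open U \<and> y \<in> U \<and> smooth_on (?Y \<inter> U) (\<lambda>y. left_field_coord d y u)" if y: "y \<in> ?Y" for y
      using smooth_fieldD[OF w y d(1) chart_inv_dom[OF y]] unfolding left_field_coord_def by blast
  qed
qed

lemma lie_ad_coord:
  assumes d: "d \<in> A" "\<one> \<in> chart_dom d" and \<xi>: "\<xi> \<in> tangent_space A \<one>" and \<eta>: "\<eta> \<in> tangent_space A \<one>"
  shows "lie_ad G A \<xi> \<eta> d =
    frechet_derivative (\<lambda>y. left_field_coord d y (\<eta> d)) (at (chart_map d \<one>)) (\<xi> d) -
    frechet_derivative (\<lambda>y. left_field_coord d y (\<xi> d)) (at (chart_map d \<one>)) (\<eta> d)"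
  unfolding lie_ad_def vf_bracket_def left_field_coord_def tvec_of_eq[OF \<xi> d] tvec_of_eq[OF \<eta> d]
    left_act_one[OF \<xi>] left_act_one[OF \<eta>]
  using d by simp

text \<open>
  Both sides are invariant under left translation of the family, so the family may be moved to
  the identity; there the equation is the symmetry of the mixed partial derivatives of the family
  in a chart.
\<close>

lemma structure_equation_coord:
  assumes r: "0 < r" and ab: "a < b" and t: "t \<in> {a..b}"
    and \<Gamma>: "smooth_into ({-r<..<r} \<times> {a..b}) (carrier G) A \<Gamma>" and d: "d \<in> A" "\<one> \<in> chart_dom d"
  shows "tvec_deriv {-r<..<r} (\<lambda>\<epsilon>. body_velocity {a..b} \<Gamma> (\<epsilon>, t)) 0 d =
    tvec_deriv {a..b} (\<lambda>t. body_variation {-r<..<r} \<Gamma> (0, t)) t d +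
    lie_ad G A (body_velocity {a..b} \<Gamma> (0, t)) (body_variation {-r<..<r} \<Gamma> (0, t)) d"
proof -
  let ?I = "{-r<..<r}" and ?J = "{a..b}"
  let ?S = "?I \<times> ?J"
  let ?\<zeta> = "body_velocity ?J \<Gamma>" and ?\<eta> = "body_variation ?I \<Gamma>"
  have I: "thick ?I" by (rule thick_open) simp
  have J: "thick ?J" by (rule thick_Icc[OF ab])
  have S: "thick ?S" by (rule thick_Times[OF I J])
  have 0: "0 \<in> ?I" using r by simp
  have s0: "(0, t) \<in> ?S" using 0 t by simp
  \<comment> \<open>Translation by this element brings the family to the identity at the parameter
    \<open>(0, t)\<close>.\<close>
  define h where "h = inv (\<Gamma> (0, t))"
  have h: "h \<in> carrier G" unfolding h_def using smooth_into_carrier[OF \<Gamma> s0] by simp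
  have h\<Gamma>: "smooth_into ?S (carrier G) A (\<lambda>s. h \<otimes> \<Gamma> s)"
    by (rule smooth_into_mult[OF S smooth_into_const[OF S h] \<Gamma>])
  have one: "h \<otimes> \<Gamma> (0, t) = \<one>" unfolding h_def using smooth_into_carrier[OF \<Gamma> s0] by simp
  have "h \<otimes> \<Gamma> (0, t) \<in> chart_dom d" using one d by simp
  then obtain U where U: "open U" "(0, t) \<in> U" "(\<lambda>s. h \<otimes> \<Gamma> s) ` (?S \<inter> U) \<subseteq> chart_dom d"
    "smooth_on (?S \<inter> U) (\<lambda>s. chart_map d (h \<otimes> \<Gamma> s))"
    using smooth_intoD[OF h\<Gamma> s0 d(1)] by blast
  define x where "x = (\<lambda>s. chart_map d (h \<otimes> \<Gamma> s))"
  have x: "smooth_on (?S \<inter> U) x" unfolding x_def by (rule U(4))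
  have dom: "h \<otimes> \<Gamma> s \<in> chart_dom d" if "s \<in> ?S \<inter> U" for s using U(3) that by blast
  obtain x' where x'U: "\<And>s. s \<in> ?S \<inter> U \<Longrightarrow> (x has_derivative x' s) (at s within ?S \<inter> U)"
    using smooth_on_derivative[OF thick_Int_open[OF S U(1)] x] by metis
  have x': "(x has_derivative x' s) (at s within ?S)" if "s \<in> ?S \<inter> U" for s
  proof -
    have "at s within ?S \<inter> U = at s within ?S" by (rule at_within_nhd[of _ U]) (use that U(1) in auto)
    then show ?thesis using x'U[OF that] by simp
  qed
  note \<zeta> = smooth_field_body_velocity[OF I J \<Gamma>] and \<eta> = smooth_field_body_variation[OF I J \<Gamma>]
  let ?X = "left_field_coord d"
  \<comment> \<open>The coordinate curves follow left-invariant fields: the time derivative of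
    \<open>x\<close> is \<open>?X (x s)\<close> applied to \<zeta>. By invariance this is the
    \<zeta> of the untranslated family.\<close>
  have x2: "x' s (0, 1) = ?X (x s) (?\<zeta> s d)" if s: "s \<in> ?S \<inter> U" for s
  proof -
    obtain \<epsilon> \<tau> where st: "s = (\<epsilon>, \<tau>)" "\<epsilon> \<in> ?I" "\<tau> \<in> ?J" using s by auto
    have "velocity A ?J (\<lambda>\<tau>. h \<otimes> \<Gamma> (\<epsilon>, \<tau>)) \<tau> d = x' s (0, 1)"
      by (rule velocity_path_coord[OF J st(3), where \<Gamma>="\<lambda>s. h \<otimes> \<Gamma> s" and S="?S" and s=s])
        (use st s x'[OF s] dom[OF s] d in \<open>auto intro: has_vector_derivative_snd_path simp: x_def\<close>)
    moreover have "velocity A ?J (\<lambda>\<tau>. h \<otimes> \<Gamma> (\<epsilon>, \<tau>)) \<tau> = left_act G A (h \<otimes> \<Gamma> s) (?\<zeta> s)"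
      using velocity_left_translation[OF J st(3) smooth_into_slice_snd[OF J \<Gamma> st(2)] h]
      by (simp add: body_velocity_def st(1))
    moreover have "left_act G A (h \<otimes> \<Gamma> s) (?\<zeta> s) d = ?X (x s) (?\<zeta> s d)"
      unfolding x_def by (rule left_field_coord_eq[OF d dom[OF s] smooth_field_in[OF \<zeta>]]) (use s in auto)
    ultimately show ?thesis by simp
  qed
  have x1: "x' s (1, 0) = ?X (x s) (?\<eta> s d)" if s: "s \<in> ?S \<inter> U" for s
  proof -
    obtain \<epsilon> \<tau> where st: "s = (\<epsilon>, \<tau>)" "\<epsilon> \<in> ?I" "\<tau> \<in> ?J" using s by auto
    have "velocity A ?I (\<lambda>\<epsilon>. h \<otimes> \<Gamma> (\<epsilon>, \<tau>)) \<epsilon> d = x' s (1, 0)"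
      by (rule velocity_path_coord[OF I st(2), where \<Gamma>="\<lambda>s. h \<otimes> \<Gamma> s" and S="?S" and s=s])
        (use st s x'[OF s] dom[OF s] d in \<open>auto intro: has_vector_derivative_fst_path simp: x_def\<close>)
    moreover have "velocity A ?I (\<lambda>\<epsilon>. h \<otimes> \<Gamma> (\<epsilon>, \<tau>)) \<epsilon> = left_act G A (h \<otimes> \<Gamma> s) (?\<eta> s)"
      using velocity_left_translation[OF I st(2) smooth_into_slice_fst[OF I \<Gamma> st(3)] h]
      by (simp add: body_variation_def st(1))
    moreover have "left_act G A (h \<otimes> \<Gamma> s) (?\<eta> s) d = ?X (x s) (?\<eta> s d)"
      unfolding x_def by (rule left_field_coord_eq[OF d dom[OF s] smooth_field_in[OF \<eta>]]) (use s in auto)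
    ultimately show ?thesis by simp
  qed
  have x0: "x (0, t) = chart_map d \<one>" unfolding x_def one ..
  have s0U: "(0, t) \<in> ?S \<inter> U" using s0 U(2) by blast
  let ?Y = "chart_map d ` chart_dom d"
  let ?D = "\<lambda>u. frechet_derivative (\<lambda>y. ?X y u) (at (chart_map d \<one>))"
  have D: "((\<lambda>y. ?X y u) has_derivative ?D u) (at (x (0, t)))" for u
    unfolding x0 by (rule smooth_on_open_has_derivative[OF smooth_on_left_field_coord[OF d] open_chart_image[OF d(1)]])
      (use d in blast)
  have xe: "((\<lambda>\<epsilon>. x (\<epsilon>, t)) has_vector_derivative ?\<eta> (0, t) d) (at 0 within ?I)"
    using has_vector_derivative_fst_slice[OF x'[OF s0U] t] x1[OF s0U] by (simp add: x0 left_field_coord_one[OF d])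
  have xt: "((\<lambda>\<tau>. x (0, \<tau>)) has_vector_derivative ?\<zeta> (0, t) d) (at t within ?J)"
    using has_vector_derivative_snd_slice[OF x'[OF s0U] 0] x2[OF s0U] by (simp add: x0 left_field_coord_one[OF d])
  define \<zeta>1 where "\<zeta>1 = tvec_deriv ?I (\<lambda>\<epsilon>. ?\<zeta> (\<epsilon>, t)) 0 d"
  define \<eta>1 where "\<eta>1 = tvec_deriv ?J (\<lambda>\<tau>. ?\<eta> (0, \<tau>)) t d"
  have \<zeta>e: "((\<lambda>\<epsilon>. ?\<zeta> (\<epsilon>, t) d) has_vector_derivative \<zeta>1) (at 0 within ?I)"
    unfolding \<zeta>1_def by (rule const_field_has_vector_derivative[OF I 0 smooth_field_slice_fst[OF \<zeta> t] d])
  have \<eta>t: "((\<lambda>\<tau>. ?\<eta> (0, \<tau>) d) has_vector_derivative \<eta>1) (at t within ?J)"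
    unfolding \<eta>1_def by (rule const_field_has_vector_derivative[OF J t smooth_field_slice_snd[OF \<eta> 0] d])
  have xY: "x s \<in> ?Y" if "s \<in> ?S \<inter> U" for s using dom[OF that] by (simp add: x_def)
  have Ve: "open ((\<lambda>\<epsilon>. (\<epsilon>, t)) -` U)" and Vt: "open ((\<lambda>\<tau>. (0, \<tau>)) -` U)"
    by (rule open_vimage[OF U(1)], intro continuous_intros)+
  \<comment> \<open>The time derivative of \<open>x\<close> is differentiated in \<epsilon>: one
    term comes from the moving point, the other from \<zeta>. At the identity \<open>?X\<close> is
    the identity map, which leaves just \<open>\<zeta>1\<close> in the second term.\<close>
  have "((\<lambda>\<epsilon>. ?X (x (\<epsilon>, t)) (?\<zeta> (\<epsilon>, t) d)) has_vector_derivative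
      ?D (?\<zeta> (0, t) d) (?\<eta> (0, t) d) + ?X (x (0, t)) \<zeta>1) (at 0 within ?I)"
    by (rule has_vector_derivative_parametric_linear[OF findim_model open_chart_image[OF d(1)]
          left_field_coord_linear[OF d] Ve _ _ 0 D xe \<zeta>e]) (use U(2) xY t in auto)
  then have "((\<lambda>\<epsilon>. x' (\<epsilon>, t) (0, 1)) has_vector_derivative
      ?D (?\<zeta> (0, t) d) (?\<eta> (0, t) d) + ?X (x (0, t)) \<zeta>1) (at 0 within ?I)"
    by (rule has_vector_derivative_transform_local[OF Ve _ 0, rotated -1]) (use U(2) t x2 in auto)
  then have D2: "((\<lambda>\<epsilon>. x' (\<epsilon>, t) (0, 1)) has_vector_derivative
      ?D (?\<zeta> (0, t) d) (?\<eta> (0, t) d) + \<zeta>1) (at 0 within ?I)"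
    by (simp add: x0 left_field_coord_one[OF d])
  have "((\<lambda>\<tau>. ?X (x (0, \<tau>)) (?\<eta> (0, \<tau>) d)) has_vector_derivative
      ?D (?\<eta> (0, t) d) (?\<zeta> (0, t) d) + ?X (x (0, t)) \<eta>1) (at t within ?J)"
    by (rule has_vector_derivative_parametric_linear[OF findim_model open_chart_image[OF d(1)]
          left_field_coord_linear[OF d] Vt _ _ t D xt \<eta>t]) (use U(2) xY 0 in auto)
  then have "((\<lambda>\<tau>. x' (0, \<tau>) (1, 0)) has_vector_derivative
      ?D (?\<eta> (0, t) d) (?\<zeta> (0, t) d) + ?X (x (0, t)) \<eta>1) (at t within ?J)"
    by (rule has_vector_derivative_transform_local[OF Vt _ t, rotated -1]) (use U(2) 0 x1 in auto)
  then have D1: "((\<lambda>\<tau>. x' (0, \<tau>) (1, 0)) has_vector_derivative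
      ?D (?\<eta> (0, t) d) (?\<zeta> (0, t) d) + \<eta>1) (at t within ?J)"
    by (simp add: x0 left_field_coord_one[OF d])
  \<comment> \<open>Equality of the mixed partials. The difference of the two \<open>?D\<close>
    terms is the coordinate form of the bracket in \<open>lie_ad_coord\<close>.\<close>
  have "?D (?\<eta> (0, t) d) (?\<zeta> (0, t) d) + \<eta>1 = ?D (?\<zeta> (0, t) d) (?\<eta> (0, t) d) + \<zeta>1"
    by (rule mixed_partials[OF findim_model r ab t U(1,2) x x' D2 D1])
  then show ?thesis
    unfolding \<zeta>1_def[symmetric] \<eta>1_def[symmetric]
      lie_ad_coord[OF d smooth_field_in[OF \<zeta> s0] smooth_field_in[OF \<eta> s0]]
    by (simp add: algebra_simps)
qed

lemma structure_equation:
  assumes r: "0 < r" and ab: "a < b" and t: "t \<in> {a..b}"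
    and \<Gamma>: "smooth_into ({-r<..<r} \<times> {a..b}) (carrier G) A \<Gamma>"
  shows "tvec_deriv {-r<..<r} (\<lambda>\<epsilon>. body_velocity {a..b} \<Gamma> (\<epsilon>, t)) 0 =
    tvec_add (tvec_deriv {a..b} (\<lambda>t. body_variation {-r<..<r} \<Gamma> (0, t)) t)
      (lie_ad G A (body_velocity {a..b} \<Gamma> (0, t)) (body_variation {-r<..<r} \<Gamma> (0, t)))"
proof
  fix d
  let ?I = "{-r<..<r}" and ?J = "{a..b}"
  have I: "thick ?I" by (rule thick_open) simp
  have J: "thick ?J" by (rule thick_Icc[OF ab])
  have 0: "0 \<in> ?I" using r by simp
  note \<zeta> = smooth_field_body_velocity[OF I J \<Gamma>] and \<eta> = smooth_field_body_variation[OF I J \<Gamma>]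
  show "tvec_deriv ?I (\<lambda>\<epsilon>. body_velocity ?J \<Gamma> (\<epsilon>, t)) 0 d =
    tvec_add (tvec_deriv ?J (\<lambda>t. body_variation ?I \<Gamma> (0, t)) t)
      (lie_ad G A (body_velocity ?J \<Gamma> (0, t)) (body_variation ?I \<Gamma> (0, t))) d"
  proof (cases "d \<in> A \<and> \<one> \<in> chart_dom d")
    case True
    then show ?thesis using structure_equation_coord[OF r ab t \<Gamma>] unfolding tvec_add_def by blast
  next
    case False
    \<comment> \<open>Away from the atlas charts around the identity, all components are 0 by the
      convention for tangent vectors, so both sides vanish.\<close>
    have 1: "((\<lambda>\<epsilon>. body_velocity ?J \<Gamma> (\<epsilon>, t) d) has_vector_derivative 0) (at 0 within ?I)"
      by (rule has_vector_derivative_transform[OF 0, of _ "\<lambda>_. 0"])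
        (use tangent_space_outside[OF smooth_field_in[OF \<zeta>] False] t in auto)
    have 2: "((\<lambda>\<tau>. body_variation ?I \<Gamma> (0, \<tau>) d) has_vector_derivative 0) (at t within ?J)"
      by (rule has_vector_derivative_transform[OF t, of _ "\<lambda>_. 0"])
        (use tangent_space_outside[OF smooth_field_in[OF \<eta>] False] 0 in auto)
    have "lie_ad G A \<xi> \<xi>' d = 0" for \<xi> \<xi>' using False by (auto simp: lie_ad_def vf_bracket_def)
    then show ?thesis
      unfolding tvec_deriv_def tvec_add_def thick_vector_derivative[OF I 0 1] thick_vector_derivative[OF J t 2] by simp
  qed
qed

end

section \<open>The variational principles\<close>

lemma stationary_cong:
  assumes "0 < r" "\<And>\<epsilon>. \<epsilon> \<in> {-r<..<r} \<Longrightarrow> F \<epsilon> = H \<epsilon>"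
  shows "(F has_real_derivative 0) (at 0) \<longleftrightarrow> (H has_real_derivative 0) (at 0)"
proof
  show "(H has_real_derivative 0) (at 0)" if "(F has_real_derivative 0) (at 0)"
    by (rule has_field_derivative_transform_within_open[OF that, of "{-r<..<r}"]) (use assms in auto)
  show "(F has_real_derivative 0) (at 0)" if "(H has_real_derivative 0) (at 0)"
    by (rule has_field_derivative_transform_within_open[OF that, of "{-r<..<r}"]) (use assms in auto)
qed

text \<open>Both first variations are the integral of the same pointwise derivative. The two strips
  may have different widths.\<close>

lemma stationary_transfer:
  fixes f1 f2 :: "real \<times> real \<Rightarrow> real"
  assumes r: "0 < r1" "0 < r2" and ab: "a < b"
    and f: "smooth_on ({-r1<..<r1} \<times> {a..b}) f1" "smooth_on ({-r2<..<r2} \<times> {a..b}) f2"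
    and d: "\<And>t. t \<in> {a..b} \<Longrightarrow> \<exists>d. ((\<lambda>\<epsilon>. f1 (\<epsilon>, t)) has_vector_derivative d) (at 0 within {-r1<..<r1}) \<and>
      ((\<lambda>\<epsilon>. f2 (\<epsilon>, t)) has_vector_derivative d) (at 0 within {-r2<..<r2})"
    and stat: "((\<lambda>\<epsilon>. integral {a..b} (\<lambda>t. f1 (\<epsilon>, t))) has_real_derivative 0) (at 0)"
  shows "((\<lambda>\<epsilon>. integral {a..b} (\<lambda>t. f2 (\<epsilon>, t))) has_real_derivative 0) (at 0)"
proof -
  obtain d where d: "\<And>t. t \<in> {a..b} \<Longrightarrow> ((\<lambda>\<epsilon>. f1 (\<epsilon>, t)) has_vector_derivative d t) (at 0 within {-r1<..<r1})"
    "\<And>t. t \<in> {a..b} \<Longrightarrow> ((\<lambda>\<epsilon>. f2 (\<epsilon>, t)) has_vector_derivative d t) (at 0 within {-r2<..<r2})"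
    using d by metis
  have "((\<lambda>\<epsilon>. integral {a..b} (\<lambda>t. f1 (\<epsilon>, t))) has_real_derivative integral {a..b} d) (at 0)"
    using leibniz_strip[OF r(1) ab f(1) d(1)] by (simp add: has_real_derivative_iff_has_vector_derivative)
  then have "integral {a..b} d = 0" using stat DERIV_unique by blast
  then show ?thesis
    using leibniz_strip[OF r(2) ab f(2) d(2)] by (simp add: has_real_derivative_iff_has_vector_derivative)
qed

context smooth_manifold
begin

lemma smooth_cofield_constI:
  assumes "\<And>s. s \<in> S \<Longrightarrow> q s \<in> cotangent_space A x"
    and "\<And>c u. c \<in> A \<Longrightarrow> x \<in> chart_dom c \<Longrightarrow> smooth_on S (\<lambda>s. q s (tvec_of A c x u))"
  shows "smooth_cofield S (\<lambda>_. x) q"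
  unfolding smooth_cofield_def
proof (intro conjI ballI impI)
  fix s c assume c: "c \<in> A" "x \<in> chart_dom c"
  show "\<exists>U. open U \<and> s \<in> U \<and> (\<lambda>_. x) ` (S \<inter> U) \<subseteq> chart_dom c \<and>
      (\<forall>u. smooth_on (S \<inter> U) (\<lambda>s. q s (tvec_of A c x u)))"
    by (rule exI[of _ UNIV]) (use c assms(2)[OF c] in auto)
qed (rule assms(1))

lemma smooth_field_const:
  assumes "thick S" "x \<in> M" "c \<in> A" "x \<in> chart_dom c" "smooth_on S u"
  shows "smooth_field S (\<lambda>_. x) (\<lambda>s. tvec_of A c x (u s))"
  by (rule smooth_field_tvec_of[OF smooth_into_const[OF assms(1,2)] assms(3) _ assms(5)]) (use assms(4) in auto)

lemma smooth_cofield_constD: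
  assumes "thick S" "x \<in> M" "c \<in> A" "x \<in> chart_dom c" "smooth_cofield S (\<lambda>_. x) q"
  shows "smooth_on S (\<lambda>s. q s (tvec_of A c x u))"
  by (rule smooth_on_pairing[OF assms(1) smooth_into_const[OF assms(1,2)] assms(5)
        smooth_field_const[OF assms(1-4) smooth_on_const]])

text \<open>In the product rule the term with the derivative of the covector is paired with
  \<open>u \<tau> = 0\<close> and drops out. Hence the variation of the momentum does not contribute
  where the constraint holds.\<close>

lemma pairing_has_vector_derivative:
  fixes I :: "real set"
  assumes I: "open I" "\<tau> \<in> I" and x: "x \<in> M" "c \<in> A" "x \<in> chart_dom c" and q: "smooth_cofield I (\<lambda>_. x) q"
    and u: "(u has_vector_derivative u1) (at \<tau> within I)" "u \<tau> = 0"
  shows "((\<lambda>\<epsilon>. q \<epsilon> (tvec_of A c x (u \<epsilon>))) has_vector_derivative q \<tau> (tvec_of A c x u1)) (at \<tau> within I)"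
proof -
  let ?X = "\<lambda>\<epsilon> u. q \<epsilon> (tvec_of A c x u)"
  let ?D = "\<lambda>u. frechet_derivative (\<lambda>\<epsilon>. ?X \<epsilon> u) (at \<tau>)"
  have lin: "linear (?X \<epsilon>)" if "\<epsilon> \<in> I" for \<epsilon>
    by (rule bounded_linear.linear[OF cotangent_coord_bounded_linear[OF smooth_cofield_in[OF q that] x(2,3)]])
  have D: "((\<lambda>\<epsilon>. ?X \<epsilon> u) has_derivative ?D u) (at \<tau>)" for u
    by (rule smooth_on_open_has_derivative[OF smooth_cofield_constD[OF thick_open[OF I(1)] x q] I])
  have "((\<lambda>\<epsilon>. ?X \<epsilon> 0) has_derivative (\<lambda>_. 0)) (at \<tau>)"
    by (rule has_derivative_transform_within_open[OF has_derivative_const I]) (simp add: linear_0[OF lin])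
  then have D0: "?D 0 = (\<lambda>_. 0)" using has_derivative_unique[OF D] by blast
  have "((\<lambda>\<epsilon>. ?X \<epsilon> (u \<epsilon>)) has_vector_derivative ?D (u \<tau>) 1 + ?X \<tau> u1) (at \<tau> within I)"
    by (rule has_vector_derivative_parametric_linear[where X="?X" and y="\<lambda>\<epsilon>. \<epsilon>" and Y=I and V=UNIV and D="?D",
          OF findim_model I(1) lin open_UNIV UNIV_I _ I(2) D has_vector_derivative_id u(1)]) auto
  then show ?thesis by (simp add: u(2) D0)
qed

end

locale lie_group_lagrangian = lie_group G A
  for G :: "('g, 'k) monoid_scheme" (structure) and A :: "('g, 'e::real_normed_vector) chart set" +
  fixes L l :: "'g \<times> ('g, 'e) tvec \<Rightarrow> real" and g :: "real \<Rightarrow> 'g" and a b :: real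
  assumes L_smooth: "smooth_map (tangent_bundle (carrier G) A) (tangent_bundle_atlas A) UNIV std_atlas L"
    and l_def: "l = left_trivialization G A L"
    and ab: "a < b"
    and g_smooth: "smooth_into {a..b} (carrier G) A g"
begin

abbreviation J :: "real set" where "J \<equiv> {a..b}"
abbreviation I :: "real \<Rightarrow> real set" where "I r \<equiv> {-r<..<r}"

definition \<xi>0 :: "real \<Rightarrow> ('g, 'e) tvec" where
  "\<xi>0 t = left_triv G A (g t) (velocity A J g t)"

lemma thick_J: "thick J" by (rule thick_Icc[OF ab])
lemma thick_I: "thick (I r)" by (rule thick_open) simp
lemma thick_IJ: "thick (I r \<times> J)" by (rule thick_Times[OF thick_I thick_J])
lemma zero_I: "0 < r \<Longrightarrow> 0 \<in> I r" by simp

lemma g_carrier: "t \<in> J \<Longrightarrow> g t \<in> carrier G" by (rule smooth_into_carrier[OF g_smooth])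

lemma \<xi>0_in: "t \<in> J \<Longrightarrow> \<xi>0 t \<in> tangent_space A \<one>"
  unfolding \<xi>0_def by (rule left_triv_in[OF g_carrier velocity_in[OF thick_J _ g_smooth]])

section \<open>The trivialized Lagrangian and its first variation\<close>

lemma l_apply: "l (x, \<xi>) = L (x, left_act G A x \<xi>)"
  by (simp add: l_def left_trivialization_def)

lemma L_eq_l: "x \<in> carrier G \<Longrightarrow> w \<in> tangent_space A x \<Longrightarrow> L (x, w) = l (x, left_triv G A x w)"
  by (simp add: l_apply left_act_left_triv)

lemma smooth_on_l:
  assumes "thick S" "smooth_into S (carrier G) A \<Gamma>" "smooth_field S (\<lambda>_. \<one>) \<zeta>"
  shows "smooth_on S (\<lambda>s. l (\<Gamma> s, \<zeta> s))"
  unfolding l_apply by (rule smooth_on_bundle_function[OF L_smooth assms(1,2) smooth_field_left_act[OF assms]])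

definition l_coord :: "('g, 'e) chart \<Rightarrow> ('g, 'e) chart \<Rightarrow> 'e \<times> 'e \<Rightarrow> real" where
  "l_coord c d z = l (chart_inv c (fst z), tvec_of A d \<one> (snd z))"

lemma l_coord_eq:
  assumes "c \<in> A" "x \<in> chart_dom c" "d \<in> A" "\<one> \<in> chart_dom d" "\<xi> \<in> tangent_space A \<one>"
  shows "l (x, \<xi>) = l_coord c d (chart_map c x, \<xi> d)"
  unfolding l_coord_def by (simp add: chart_inv_map[OF assms(1,2)] tvec_of_eq[OF assms(5,3,4)])

lemma l_coord_has_derivative:
  assumes c: "c \<in> A" "x \<in> chart_dom c" and d: "d \<in> A" "\<one> \<in> chart_dom d"
  shows "(l_coord c d has_derivative frechet_derivative (l_coord c d) (at (chart_map c x, u))) (at (chart_map c x, u))"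
proof -
  let ?Y = "(chart_map c ` chart_dom c) \<times> (UNIV :: 'e set)"
  have Y: "open ?Y" by (intro open_Times open_chart_image[OF c(1)] open_UNIV)
  have th: "thick ?Y" by (rule thick_open[OF Y])
  have "smooth_on ?Y (\<lambda>z. l (chart_inv c (fst z), tvec_of A d \<one> (snd z)))"
  proof (rule smooth_on_l[OF th])
    show "smooth_into ?Y (carrier G) A (\<lambda>z. chart_inv c (fst z))"
      by (rule smooth_into_chart_inv[OF c(1) th smooth_on_fst[OF smooth_on_id]]) auto
    show "smooth_field ?Y (\<lambda>_. \<one>) (\<lambda>z. tvec_of A d \<one> (snd z))"
      by (rule smooth_field_const[OF th one_closed d smooth_on_snd[OF smooth_on_id]])
  qed
  then have "smooth_on ?Y (l_coord c d)" unfolding l_coord_def[abs_def] .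
  then show ?thesis by (rule smooth_on_open_has_derivative[OF _ Y]) (use c in auto)
qed

text \<open>The chain rule for \<open>l\<close> in coordinates. The linear form depends only on the
  base point, and its argument only on the two first-order variations, so families agreeing in these
  data have the same pointwise derivative.\<close>

lemma l_variation:
  fixes T :: "real set"
  assumes T: "thick T" "\<tau> \<in> T" and \<gamma>: "smooth_into T (carrier G) A \<gamma>" and \<zeta>: "smooth_field T (\<lambda>_. \<one>) \<zeta>"
    and c: "c \<in> A" "\<gamma> \<tau> \<in> chart_dom c" and d: "d \<in> A" "\<one> \<in> chart_dom d"
  shows "((\<lambda>\<epsilon>. l (\<gamma> \<epsilon>, \<zeta> \<epsilon>)) has_vector_derivative
    frechet_derivative (l_coord c d) (at (chart_map c (\<gamma> \<tau>), \<zeta> \<tau> d)) (velocity A T \<gamma> \<tau> c, tvec_deriv T \<zeta> \<tau> d))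
    (at \<tau> within T)"
proof -
  let ?D = "frechet_derivative (l_coord c d) (at (chart_map c (\<gamma> \<tau>), \<zeta> \<tau> d))"
  have D: "(l_coord c d has_derivative ?D) (at (chart_map c (\<gamma> \<tau>), \<zeta> \<tau> d))"
    by (rule l_coord_has_derivative[OF c d])
  obtain U where U: "open U" "\<tau> \<in> U" "\<gamma> ` (T \<inter> U) \<subseteq> chart_dom c" using smooth_intoD[OF \<gamma> T(2) c] by blast
  have "((\<lambda>\<epsilon>. (chart_map c (\<gamma> \<epsilon>), \<zeta> \<epsilon> d)) has_derivative
      (\<lambda>h. (h *\<^sub>R velocity A T \<gamma> \<tau> c, h *\<^sub>R tvec_deriv T \<zeta> \<tau> d))) (at \<tau> within T)"
    by (intro has_derivative_Pair velocity_has_vector_derivative[OF T \<gamma> c, unfolded has_vector_derivative_def]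
        const_field_has_vector_derivative[OF T \<zeta> d, unfolded has_vector_derivative_def])
  from has_derivative_compose[OF this D]
  have "((\<lambda>\<epsilon>. l_coord c d (chart_map c (\<gamma> \<epsilon>), \<zeta> \<epsilon> d)) has_derivative
      (\<lambda>h. h *\<^sub>R ?D (velocity A T \<gamma> \<tau> c, tvec_deriv T \<zeta> \<tau> d))) (at \<tau> within T)"
    using linear_scale[OF has_derivative_linear[OF D], of _ "(velocity A T \<gamma> \<tau> c, tvec_deriv T \<zeta> \<tau> d)"] by simp
  then have "((\<lambda>\<epsilon>. l_coord c d (chart_map c (\<gamma> \<epsilon>), \<zeta> \<epsilon> d)) has_vector_derivative
      ?D (velocity A T \<gamma> \<tau> c, tvec_deriv T \<zeta> \<tau> d)) (at \<tau> within T)"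
    unfolding has_vector_derivative_def .
  then show ?thesis
  proof (rule has_vector_derivative_transform_local[OF U(1,2) T(2), rotated -1])
    fix \<epsilon> assume e: "\<epsilon> \<in> T \<inter> U"
    have "\<gamma> \<epsilon> \<in> chart_dom c" using e U(3) by blast
    then show "l_coord c d (chart_map c (\<gamma> \<epsilon>), \<zeta> \<epsilon> d) = l (\<gamma> \<epsilon>, \<zeta> \<epsilon>)"
      using l_coord_eq[OF c(1) _ d smooth_field_in[OF \<zeta>]] e by simp
  qed
qed

lemma body_velocity_zero:
  assumes "\<And>t. t \<in> J \<Longrightarrow> \<Gamma> (0, t) = g t" "t \<in> J"
  shows "body_velocity J \<Gamma> (0, t) = \<xi>0 t"
  using velocity_cong[of t J "\<lambda>\<tau>. \<Gamma> (0, \<tau>)" g A] assms by (simp add: body_velocity_def \<xi>0_def)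

subsection \<open>Reformulation in terms of components\<close>

lemma atlas_carrier: "atlas (carrier G) A" by unfold_locales

definition admissible :: "real \<Rightarrow> (real \<times> real \<Rightarrow> 'g) \<Rightarrow> bool" where
  "admissible r \<Gamma> \<longleftrightarrow> 0 < r \<and> smooth_into (I r \<times> J) (carrier G) A \<Gamma> \<and> (\<forall>t\<in>J. \<Gamma> (0, t) = g t)"

definition fixed_ends :: "real \<Rightarrow> (real \<times> real \<Rightarrow> 'g) \<Rightarrow> bool" where
  "fixed_ends r \<Gamma> \<longleftrightarrow> (\<forall>\<epsilon>\<in>I r. \<Gamma> (\<epsilon>, a) = g a \<and> \<Gamma> (\<epsilon>, b) = g b)"

text \<open>Brings the action into the form \<open>l\<close> of point and body velocity that it
  shares with the trivialized principles; within the strip the two integrands are equal.\<close>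

lemma hamilton_iff:
  "hamilton_principle G A L a b g \<longleftrightarrow> (\<forall>r \<Gamma>. admissible r \<Gamma> \<longrightarrow> fixed_ends r \<Gamma> \<longrightarrow>
    ((\<lambda>\<epsilon>. integral J (\<lambda>t. l (\<Gamma> (\<epsilon>, t), body_velocity J \<Gamma> (\<epsilon>, t)))) has_real_derivative 0) (at 0))"
proof -
  have eq: "((\<lambda>\<epsilon>. integral J (\<lambda>t. L (\<Gamma> (\<epsilon>, t), velocity A J (\<lambda>s. \<Gamma> (\<epsilon>, s)) t))) has_real_derivative 0) (at 0) \<longleftrightarrow>
      ((\<lambda>\<epsilon>. integral J (\<lambda>t. l (\<Gamma> (\<epsilon>, t), body_velocity J \<Gamma> (\<epsilon>, t)))) has_real_derivative 0) (at 0)"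
    if adm: "admissible r \<Gamma>" for r \<Gamma>
  proof (rule stationary_cong)
    show "0 < r" using adm unfolding admissible_def by blast
    have \<Gamma>: "smooth_into (I r \<times> J) (carrier G) A \<Gamma>" using adm unfolding admissible_def by blast
    fix \<epsilon> assume e: "\<epsilon> \<in> I r"
    show "integral J (\<lambda>t. L (\<Gamma> (\<epsilon>, t), velocity A J (\<lambda>s. \<Gamma> (\<epsilon>, s)) t)) =
        integral J (\<lambda>t. l (\<Gamma> (\<epsilon>, t), body_velocity J \<Gamma> (\<epsilon>, t)))"
    proof (rule integral_cong)
      fix t assume t: "t \<in> J"
      show "L (\<Gamma> (\<epsilon>, t), velocity A J (\<lambda>s. \<Gamma> (\<epsilon>, s)) t) = l (\<Gamma> (\<epsilon>, t), body_velocity J \<Gamma> (\<epsilon>, t))"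
        using L_eq_l[OF _ velocity_in[OF thick_J t smooth_into_slice_snd[OF thick_J \<Gamma> e]]]
          smooth_into_carrier[OF \<Gamma>] e t by (simp add: body_velocity_def)
    qed
  qed
  have fam: "family_through a b (carrier G) A g r \<Gamma> \<longleftrightarrow> admissible r \<Gamma>"
    and fx: "fixed_endpoints a b (\<lambda>x. x) g r \<Gamma> \<longleftrightarrow> fixed_ends r \<Gamma>" for r \<Gamma>
    unfolding family_through_def admissible_def fixed_endpoints_def fixed_ends_def by auto
  show ?thesis unfolding hamilton_principle_def fam fx using eq by blast
qed

lemma trivialized_hamilton_iff:
  "trivialized_hamilton_principle G A l a b g \<longleftrightarrow> (\<forall>\<eta>. smooth_field J (\<lambda>_. \<one>) \<eta> \<longrightarrow> \<eta> a = tvec_zero \<longrightarrow> \<eta> b = tvec_zero \<longrightarrow>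
    (\<forall>r h \<zeta>. admissible r h \<longrightarrow> smooth_field (I r \<times> J) (\<lambda>_. \<one>) \<zeta> \<longrightarrow> (\<forall>t\<in>J. \<zeta> (0, t) = \<xi>0 t) \<longrightarrow>
      (\<forall>t\<in>J. velocity A (I r) (\<lambda>\<epsilon>. h (\<epsilon>, t)) 0 = left_act G A (g t) (\<eta> t) \<and>
        tvec_deriv (I r) (\<lambda>\<epsilon>. \<zeta> (\<epsilon>, t)) 0 = tvec_add (tvec_deriv J \<eta> t) (lie_ad G A (\<xi>0 t) (\<eta> t))) \<longrightarrow>
      ((\<lambda>\<epsilon>. integral J (\<lambda>t. l (h (\<epsilon>, t), \<zeta> (\<epsilon>, t)))) has_real_derivative 0) (at 0)))"
proof -
  have fam: "family_through a b (carrier G \<times> lie_algebra G A) (prod_atlas A (lie_algebra_atlas G A))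
      (\<lambda>t. (g t, \<xi>0 t)) r \<Gamma> \<longleftrightarrow>
    admissible r (\<lambda>s. fst (\<Gamma> s)) \<and> smooth_field (I r \<times> J) (\<lambda>_. \<one>) (\<lambda>s. snd (\<Gamma> s)) \<and>
      (\<forall>t\<in>J. snd (\<Gamma> (0, t)) = \<xi>0 t)" for r \<Gamma>
    unfolding family_through_def lie_algebra_def admissible_def
      smooth_into_prod_iff[OF atlas_carrier atlas_tangent_space[OF one_closed] thick_IJ]
      smooth_into_tangent_space_iff[OF one_closed thick_IJ] by (auto simp: prod_eq_iff)
  have field: "smooth_into J (lie_algebra G A) (lie_algebra_atlas G A) \<eta> \<longleftrightarrow> smooth_field J (\<lambda>_. \<one>) \<eta>" for \<eta>
    unfolding lie_algebra_def by (rule smooth_into_tangent_space_iff[OF one_closed thick_J])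
  show ?thesis (is "_ \<longleftrightarrow> ?R")
  proof
    assume *: "trivialized_hamilton_principle G A l a b g"
    show ?R
    proof (intro allI impI)
      fix \<eta> r h \<zeta>
      assume \<eta>: "smooth_field J (\<lambda>_. \<one>) \<eta>" "\<eta> a = tvec_zero" "\<eta> b = tvec_zero"
        and h: "admissible r h" and \<zeta>: "smooth_field (I r \<times> J) (\<lambda>_. \<one>) \<zeta>" "\<forall>t\<in>J. \<zeta> (0, t) = \<xi>0 t"
        and v: "\<forall>t\<in>J. velocity A (I r) (\<lambda>\<epsilon>. h (\<epsilon>, t)) 0 = left_act G A (g t) (\<eta> t) \<and>
        tvec_deriv (I r) (\<lambda>\<epsilon>. \<zeta> (\<epsilon>, t)) 0 = tvec_add (tvec_deriv J \<eta> t) (lie_ad G A (\<xi>0 t) (\<eta> t))"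
      from *[unfolded trivialized_hamilton_principle_def Let_def \<xi>0_def[symmetric] field fam,
          rule_format, OF \<eta>, of r "\<lambda>s. (h s, \<zeta> s)"] h \<zeta> v
      show "((\<lambda>\<epsilon>. integral J (\<lambda>t. l (h (\<epsilon>, t), \<zeta> (\<epsilon>, t)))) has_real_derivative 0) (at 0)" by simp
    qed
  next
    assume *: ?R
    show "trivialized_hamilton_principle G A l a b g"
      unfolding trivialized_hamilton_principle_def Let_def \<xi>0_def[symmetric] field fam
    proof (intro allI impI, elim conjE)
      fix \<eta> r \<Gamma>
      assume \<eta>: "smooth_field J (\<lambda>_. \<one>) \<eta>" "\<eta> a = tvec_zero" "\<eta> b = tvec_zero"
        and h: "admissible r (\<lambda>s. fst (\<Gamma> s))" and \<zeta>: "smooth_field (I r \<times> J) (\<lambda>_. \<one>) (\<lambda>s. snd (\<Gamma> s))"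
        "\<forall>t\<in>J. snd (\<Gamma> (0, t)) = \<xi>0 t"
        and v: "\<forall>t\<in>J. velocity A (I r) (\<lambda>\<epsilon>. fst (\<Gamma> (\<epsilon>, t))) 0 = left_act G A (g t) (\<eta> t) \<and>
        tvec_deriv (I r) (\<lambda>\<epsilon>. snd (\<Gamma> (\<epsilon>, t))) 0 = tvec_add (tvec_deriv J \<eta> t) (lie_ad G A (\<xi>0 t) (\<eta> t))"
      from *[rule_format, OF \<eta> h \<zeta>(1)] \<zeta>(2) v
      show "((\<lambda>\<epsilon>. integral J (\<lambda>t. l (\<Gamma> (\<epsilon>, t)))) has_real_derivative 0) (at 0)" by simp
    qed
  qed
qed

lemma hamilton_pontryagin_iff:
  "hamilton_pontryagin_principle G A L a b g v p \<longleftrightarrow>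
    (\<forall>r h w q. admissible r h \<longrightarrow> smooth_field (I r \<times> J) h w \<longrightarrow> smooth_cofield (I r \<times> J) h q \<longrightarrow>
      (\<forall>t\<in>J. w (0, t) = v t) \<longrightarrow> (\<forall>t\<in>J. q (0, t) = p t) \<longrightarrow> fixed_ends r h \<longrightarrow>
      ((\<lambda>\<epsilon>. integral J (\<lambda>t. L (h (\<epsilon>, t), w (\<epsilon>, t)) +
        q (\<epsilon>, t) (tvec_diff (velocity A J (\<lambda>s. h (\<epsilon>, s)) t) (w (\<epsilon>, t))))) has_real_derivative 0) (at 0))"
    (is "_ \<longleftrightarrow> ?R")
proof -
  have fam: "family_through a b (pontryagin_bundle (carrier G) A) (pontryagin_bundle_atlas A)
      (\<lambda>t. (g t, v t, p t)) r (\<lambda>s. (h s, w s, q s)) \<longleftrightarrow>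
    admissible r h \<and> smooth_field (I r \<times> J) h w \<and> smooth_cofield (I r \<times> J) h q \<and>
      (\<forall>t\<in>J. w (0, t) = v t) \<and> (\<forall>t\<in>J. q (0, t) = p t)" for r h w q
    unfolding family_through_def admissible_def smooth_into_pontryagin_iff[OF thick_IJ] by auto
  have fx: "fixed_endpoints a b fst g r (\<lambda>s. (h s, w s, q s)) \<longleftrightarrow> fixed_ends r h"
    for r h and w :: "real \<times> real \<Rightarrow> ('g, 'e) tvec" and q :: "real \<times> real \<Rightarrow> ('g, 'e) tvec \<Rightarrow> real"
    unfolding fixed_endpoints_def fixed_ends_def by simp
  show ?thesis
  proof
    assume *: "hamilton_pontryagin_principle G A L a b g v p"
    show ?R
    proof (intro allI impI)
      fix r h w q
      assume "admissible r h" "smooth_field (I r \<times> J) h w" "smooth_cofield (I r \<times> J) h q"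
        "\<forall>t\<in>J. w (0, t) = v t" "\<forall>t\<in>J. q (0, t) = p t" "fixed_ends r h"
      then have "family_through a b (pontryagin_bundle (carrier G) A) (pontryagin_bundle_atlas A)
          (\<lambda>t. (g t, v t, p t)) r (\<lambda>s. (h s, w s, q s))" "fixed_endpoints a b fst g r (\<lambda>s. (h s, w s, q s))"
        unfolding fam fx by auto
      from *[unfolded hamilton_pontryagin_principle_def, rule_format, OF this]
      show "((\<lambda>\<epsilon>. integral J (\<lambda>t. L (h (\<epsilon>, t), w (\<epsilon>, t)) +
        q (\<epsilon>, t) (tvec_diff (velocity A J (\<lambda>s. h (\<epsilon>, s)) t) (w (\<epsilon>, t))))) has_real_derivative 0) (at 0)"
        by simp
    qed
  next
    assume *: ?R
    show "hamilton_pontryagin_principle G A L a b g v p"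
      unfolding hamilton_pontryagin_principle_def
    proof (intro allI impI)
      fix r \<Gamma>
      assume 1: "family_through a b (pontryagin_bundle (carrier G) A) (pontryagin_bundle_atlas A)
          (\<lambda>t. (g t, v t, p t)) r \<Gamma>" and 2: "fixed_endpoints a b fst g r \<Gamma>"
      obtain h w q where \<Gamma>: "\<Gamma> = (\<lambda>s. (h s, w s, q s))"
        by (rule that[of "\<lambda>s. fst (\<Gamma> s)" "\<lambda>s. fst (snd (\<Gamma> s))" "\<lambda>s. snd (snd (\<Gamma> s))"]) simp
      have "((\<lambda>\<epsilon>. integral J (\<lambda>t. L (h (\<epsilon>, t), w (\<epsilon>, t)) +
        q (\<epsilon>, t) (tvec_diff (velocity A J (\<lambda>s. h (\<epsilon>, s)) t) (w (\<epsilon>, t))))) has_real_derivative 0) (at 0)"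
        by (rule *[rule_format]) (use 1[unfolded \<Gamma> fam] 2[unfolded \<Gamma> fx] in auto)
      then show "((\<lambda>\<epsilon>. integral J (\<lambda>t. case \<Gamma> (\<epsilon>, t) of (h, w, q) \<Rightarrow>
             L (h, w) + q (tvec_diff (velocity A J (\<lambda>s. fst (\<Gamma> (\<epsilon>, s))) t) w)))
           has_real_derivative 0) (at 0)" unfolding \<Gamma> by simp
    qed
  qed
qed

lemma trivialized_hamilton_pontryagin_iff:
  "trivialized_hamilton_pontryagin_principle G A l a b g \<xi> \<mu> \<longleftrightarrow>
    (\<forall>r h \<zeta> \<nu>. admissible r h \<longrightarrow> smooth_field (I r \<times> J) (\<lambda>_. \<one>) \<zeta> \<longrightarrow> smooth_cofield (I r \<times> J) (\<lambda>_. \<one>) \<nu> \<longrightarrow>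
      (\<forall>t\<in>J. \<zeta> (0, t) = \<xi> t) \<longrightarrow> (\<forall>t\<in>J. \<nu> (0, t) = \<mu> t) \<longrightarrow> fixed_ends r h \<longrightarrow>
      ((\<lambda>\<epsilon>. integral J (\<lambda>t. l (h (\<epsilon>, t), \<zeta> (\<epsilon>, t)) +
        \<nu> (\<epsilon>, t) (tvec_diff (body_velocity J h (\<epsilon>, t)) (\<zeta> (\<epsilon>, t))))) has_real_derivative 0) (at 0))"
    (is "_ \<longleftrightarrow> ?R")
proof -
  note at = atlas_tangent_space[OF one_closed] and cat = atlas_cotangent_space[OF one_closed]
  have fam: "family_through a b (carrier G \<times> lie_algebra G A \<times> lie_algebra_dual G A)
      (prod_atlas A (prod_atlas (lie_algebra_atlas G A) (lie_algebra_dual_atlas G A)))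
      (\<lambda>t. (g t, \<xi> t, \<mu> t)) r (\<lambda>s. (h s, \<zeta> s, \<nu> s)) \<longleftrightarrow>
    admissible r h \<and> smooth_field (I r \<times> J) (\<lambda>_. \<one>) \<zeta> \<and> smooth_cofield (I r \<times> J) (\<lambda>_. \<one>) \<nu> \<and>
      (\<forall>t\<in>J. \<zeta> (0, t) = \<xi> t) \<and> (\<forall>t\<in>J. \<nu> (0, t) = \<mu> t)" for r h \<zeta> \<nu>
    unfolding family_through_def admissible_def lie_algebra_def lie_algebra_dual_def
      smooth_into_prod_iff[OF atlas_carrier atlas_prod[OF at cat] thick_IJ] smooth_into_prod_iff[OF at cat thick_IJ]
      smooth_into_tangent_space_iff[OF one_closed thick_IJ] smooth_into_cotangent_space_iff[OF one_closed thick_IJ]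
      fst_conv snd_conv by auto
  have fx: "fixed_endpoints a b fst g r (\<lambda>s. (h s, w s, q s)) \<longleftrightarrow> fixed_ends r h"
    for r h and w :: "real \<times> real \<Rightarrow> ('g, 'e) tvec" and q :: "real \<times> real \<Rightarrow> ('g, 'e) tvec \<Rightarrow> real"
    unfolding fixed_endpoints_def fixed_ends_def by simp
  show ?thesis
  proof
    assume *: "trivialized_hamilton_pontryagin_principle G A l a b g \<xi> \<mu>"
    show ?R
    proof (intro allI impI)
      fix r h \<zeta> \<nu>
      assume "admissible r h" "smooth_field (I r \<times> J) (\<lambda>_. \<one>) \<zeta>" "smooth_cofield (I r \<times> J) (\<lambda>_. \<one>) \<nu>"
        "\<forall>t\<in>J. \<zeta> (0, t) = \<xi> t" "\<forall>t\<in>J. \<nu> (0, t) = \<mu> t" "fixed_ends r h"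
      then have "family_through a b (carrier G \<times> lie_algebra G A \<times> lie_algebra_dual G A)
          (prod_atlas A (prod_atlas (lie_algebra_atlas G A) (lie_algebra_dual_atlas G A)))
          (\<lambda>t. (g t, \<xi> t, \<mu> t)) r (\<lambda>s. (h s, \<zeta> s, \<nu> s))" "fixed_endpoints a b fst g r (\<lambda>s. (h s, \<zeta> s, \<nu> s))"
        unfolding fam fx by auto
      from *[unfolded trivialized_hamilton_pontryagin_principle_def, rule_format, OF this]
      show "((\<lambda>\<epsilon>. integral J (\<lambda>t. l (h (\<epsilon>, t), \<zeta> (\<epsilon>, t)) +
        \<nu> (\<epsilon>, t) (tvec_diff (body_velocity J h (\<epsilon>, t)) (\<zeta> (\<epsilon>, t))))) has_real_derivative 0) (at 0)"
        by (simp add: body_velocity_def)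
    qed
  next
    assume *: ?R
    show "trivialized_hamilton_pontryagin_principle G A l a b g \<xi> \<mu>"
      unfolding trivialized_hamilton_pontryagin_principle_def
    proof (intro allI impI)
      fix r \<Gamma>
      assume 1: "family_through a b (carrier G \<times> lie_algebra G A \<times> lie_algebra_dual G A)
          (prod_atlas A (prod_atlas (lie_algebra_atlas G A) (lie_algebra_dual_atlas G A)))
          (\<lambda>t. (g t, \<xi> t, \<mu> t)) r \<Gamma>" and 2: "fixed_endpoints a b fst g r \<Gamma>"
      obtain h \<zeta> \<nu> where \<Gamma>: "\<Gamma> = (\<lambda>s. (h s, \<zeta> s, \<nu> s))"
        by (rule that[of "\<lambda>s. fst (\<Gamma> s)" "\<lambda>s. fst (snd (\<Gamma> s))" "\<lambda>s. snd (snd (\<Gamma> s))"]) simp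
      have "((\<lambda>\<epsilon>. integral J (\<lambda>t. l (h (\<epsilon>, t), \<zeta> (\<epsilon>, t)) +
        \<nu> (\<epsilon>, t) (tvec_diff (body_velocity J h (\<epsilon>, t)) (\<zeta> (\<epsilon>, t))))) has_real_derivative 0) (at 0)"
        by (rule *[rule_format]) (use 1[unfolded \<Gamma> fam] 2[unfolded \<Gamma> fx] in auto)
      then show "((\<lambda>\<epsilon>. integral J (\<lambda>t. case \<Gamma> (\<epsilon>, t) of (h, \<zeta>, \<nu>) \<Rightarrow>
             l (h, \<zeta>) + \<nu> (tvec_diff (left_triv G A h (velocity A J (\<lambda>s. fst (\<Gamma> (\<epsilon>, s))) t)) \<zeta>)))
           has_real_derivative 0) (at 0)" unfolding \<Gamma> by (simp add: body_velocity_def)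
    qed
  qed
qed

subsection \<open>Hamilton's principle and its trivialization\<close>

lemma hamilton_if_trivialized:
  assumes *: "trivialized_hamilton_principle G A l a b g"
  shows "hamilton_principle G A L a b g"
  unfolding hamilton_iff
proof (intro allI impI)
  fix r \<Gamma> assume adm: "admissible r \<Gamma>" and ends: "fixed_ends r \<Gamma>"
  have r: "0 < r" and \<Gamma>: "smooth_into (I r \<times> J) (carrier G) A \<Gamma>" and \<Gamma>0: "\<And>t. t \<in> J \<Longrightarrow> \<Gamma> (0, t) = g t"
    using adm unfolding admissible_def by auto
  define \<eta> where "\<eta> t = body_variation (I r) \<Gamma> (0, t)" for t
  note var = smooth_field_body_variation[OF thick_I thick_J \<Gamma>]
  have \<eta>: "smooth_field J (\<lambda>_. \<one>) \<eta>"
    using smooth_field_slice_snd[OF var zero_I[OF r]] unfolding \<eta>_def[abs_def] .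
  \<comment> \<open>At a fixed end the family is constant in \<epsilon>, so \<eta> has the zero
    boundary values required of it.\<close>
  have bd: "\<eta> t = tvec_zero" if t: "t \<in> J" and c: "\<And>\<epsilon>. \<epsilon> \<in> I r \<Longrightarrow> \<Gamma> (\<epsilon>, t) = g t" for t
  proof -
    have "velocity A (I r) (\<lambda>\<epsilon>. \<Gamma> (\<epsilon>, t)) 0 = tvec_zero" by (rule velocity_const[OF thick_I zero_I[OF r] c])
    moreover have "\<Gamma> (0, t) \<in> carrier G" by (rule smooth_into_carrier[OF \<Gamma>]) (use t r in auto)
    ultimately show ?thesis unfolding \<eta>_def body_variation_def by (simp add: left_triv_zero)
  qed
  show "((\<lambda>\<epsilon>. integral J (\<lambda>t. l (\<Gamma> (\<epsilon>, t), body_velocity J \<Gamma> (\<epsilon>, t)))) has_real_derivative 0) (at 0)"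
  proof (rule *[unfolded trivialized_hamilton_iff, rule_format, OF \<eta> _ _ adm smooth_field_body_velocity[OF thick_I thick_J \<Gamma>]])
    show "\<eta> a = tvec_zero" "\<eta> b = tvec_zero"
      using bd ends ab unfolding fixed_ends_def by auto
    fix t assume t: "t \<in> J"
    show \<xi>: "body_velocity J \<Gamma> (0, t) = \<xi>0 t" by (rule body_velocity_zero[OF \<Gamma>0 t])
    have "left_act G A (\<Gamma> (0, t)) (\<eta> t) = velocity A (I r) (\<lambda>\<epsilon>. \<Gamma> (\<epsilon>, t)) 0"
      unfolding \<eta>_def body_variation_def fst_conv snd_conv
      by (rule left_act_left_triv[OF smooth_into_carrier[OF \<Gamma>] velocity_in[OF thick_I zero_I[OF r] smooth_into_slice_fst[OF thick_I \<Gamma> t]]])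
        (use t r in auto)
    then show "velocity A (I r) (\<lambda>\<epsilon>. \<Gamma> (\<epsilon>, t)) 0 = left_act G A (g t) (\<eta> t) \<and>
        tvec_deriv (I r) (\<lambda>\<epsilon>. body_velocity J \<Gamma> (\<epsilon>, t)) 0 = tvec_add (tvec_deriv J \<eta> t) (lie_ad G A (\<xi>0 t) (\<eta> t))"
      using structure_equation[OF r ab t \<Gamma>] \<xi> \<Gamma>0[OF t] by (simp add: \<eta>_def[abs_def])
  qed
qed

text \<open>The given family \<open>(h, \<zeta>)\<close> is prescribed only to first order: \<zeta>
  need not be the body velocity of \<open>h\<close>, and \<open>h\<close> need not keep its ends
  fixed for nonzero \<epsilon>. Hamilton's principle is therefore applied to another family \<Gamma>
  with the same first-order data, and the result is transferred.\<close>

lemma trivialized_if_hamilton: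
  assumes *: "hamilton_principle G A L a b g"
  shows "trivialized_hamilton_principle G A l a b g"
  unfolding trivialized_hamilton_iff
proof (intro allI impI)
  fix \<eta> r h \<zeta>
  assume \<eta>: "smooth_field J (\<lambda>_. \<one>) \<eta>" "\<eta> a = tvec_zero" "\<eta> b = tvec_zero"
    and adm: "admissible r h" and \<zeta>: "smooth_field (I r \<times> J) (\<lambda>_. \<one>) \<zeta>" "\<forall>t\<in>J. \<zeta> (0, t) = \<xi>0 t"
    and v: "\<forall>t\<in>J. velocity A (I r) (\<lambda>\<epsilon>. h (\<epsilon>, t)) 0 = left_act G A (g t) (\<eta> t) \<and>
      tvec_deriv (I r) (\<lambda>\<epsilon>. \<zeta> (\<epsilon>, t)) 0 = tvec_add (tvec_deriv J \<eta> t) (lie_ad G A (\<xi>0 t) (\<eta> t))"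
  have r: "0 < r" and h: "smooth_into (I r \<times> J) (carrier G) A h" and h0: "\<And>t. t \<in> J \<Longrightarrow> h (0, t) = g t"
    using adm unfolding admissible_def by auto
  obtain d where d: "d \<in> A" "\<one> \<in> chart_dom d" using cover[OF one_closed] by blast
  let ?o = "chart_map d \<one>"
  have \<eta>d: "smooth_on J (\<lambda>t. \<eta> t d)" by (rule smooth_on_const_field_coord[OF thick_J \<eta>(1) d])
  obtain \<delta> where \<delta>: "\<delta> > 0" "ball ?o \<delta> \<subseteq> chart_map d ` chart_dom d"
    using open_chart_image[OF d(1)] d(2) open_contains_ball by blast
  have "compact ((\<lambda>t. \<eta> t d) ` J)" by (rule compact_continuous_image[OF smooth_on_continuous[OF \<eta>d] compact_Icc])
  then obtain B where B: "B > 0" "\<And>t. t \<in> J \<Longrightarrow> norm (\<eta> t d) \<le> B"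
    using compact_imp_bounded bounded_pos by (metis (no_types, lifting) image_eqI)
  define \<rho> where "\<rho> = \<delta> / B"
  have \<rho>: "0 < \<rho>" using \<delta>(1) B(1) by (simp add: \<rho>_def)
  have near: "?o + \<epsilon> *\<^sub>R \<eta> t d \<in> chart_map d ` chart_dom d" if e: "\<epsilon> \<in> I \<rho>" and t: "t \<in> J" for \<epsilon> t
  proof -
    have "\<bar>\<epsilon>\<bar> < \<delta> / B" using e by (auto simp: \<rho>_def)
    then have "\<bar>\<epsilon>\<bar> * B < \<delta>" using B(1) by (simp add: pos_less_divide_eq)
    moreover have "norm (\<epsilon> *\<^sub>R \<eta> t d) \<le> \<bar>\<epsilon>\<bar> * B" using B(2)[OF t] by (simp add: mult_left_mono)
    ultimately have "?o + \<epsilon> *\<^sub>R \<eta> t d \<in> ball ?o \<delta>" by (simp add: dist_norm)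
    then show ?thesis using \<delta>(2) by blast
  qed
  \<comment> \<open>Adding \<open>?o\<close> lets an uncentred chart serve. \<open>B\<close> bounds
    \<eta> on the compact interval, and for \<open>\<bar>\<epsilon>\<bar>\<close> below
    \<open>\<delta> / B\<close> the argument stays in the ball around \<open>?o\<close> inside the
    chart image.\<close>
  define \<beta> where "\<beta> = (\<lambda>s. chart_inv d (?o + fst s *\<^sub>R \<eta> (snd s) d))"
  define \<Gamma> where "\<Gamma> = (\<lambda>s. g (snd s) \<otimes> \<beta> s)"
  have snd_sm: "smooth_on (I \<rho> \<times> J) snd" by (rule smooth_on_snd[OF smooth_on_id])
  have \<beta>: "smooth_into (I \<rho> \<times> J) (carrier G) A \<beta>"
    unfolding \<beta>_def
  proof (rule smooth_into_chart_inv[OF d(1) thick_IJ])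
    show "smooth_on (I \<rho> \<times> J) (\<lambda>s. ?o + fst s *\<^sub>R \<eta> (snd s) d)"
      by (intro smooth_on_add smooth_on_const smooth_on_scaleR smooth_on_fst[OF smooth_on_id]
          smooth_on_compose[OF findim_real \<eta>d snd_sm]) auto
    show "(\<lambda>s. ?o + fst s *\<^sub>R \<eta> (snd s) d) ` (I \<rho> \<times> J) \<subseteq> chart_map d ` chart_dom d" using near by auto
  qed
  have "smooth_into (I \<rho> \<times> J) (carrier G) A (\<lambda>s. g (snd s))"
    by (rule smooth_into_compose[OF findim_real g_smooth snd_sm _ thick_IJ]) auto
  then have \<Gamma>: "smooth_into (I \<rho> \<times> J) (carrier G) A \<Gamma>" unfolding \<Gamma>_def by (rule smooth_into_mult[OF thick_IJ _ \<beta>])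
  have \<beta>0: "\<beta> (0, t) = \<one>" for t by (simp add: \<beta>_def chart_inv_map[OF d])
  have \<Gamma>0: "\<Gamma> (0, t) = g t" if "t \<in> J" for t using g_carrier[OF that] by (simp add: \<Gamma>_def \<beta>0)
  have adm\<Gamma>: "admissible \<rho> \<Gamma>" unfolding admissible_def using \<rho> \<Gamma> \<Gamma>0 by blast
  have "\<beta> (\<epsilon>, a) = \<one>" "\<beta> (\<epsilon>, b) = \<one>" for \<epsilon>
    by (simp_all add: \<beta>_def \<eta> tvec_zero_def chart_inv_map[OF d])
  then have ends: "fixed_ends \<rho> \<Gamma>" unfolding fixed_ends_def using g_carrier ab by (simp add: \<Gamma>_def)
  have stat: "((\<lambda>\<epsilon>. integral J (\<lambda>t. l (\<Gamma> (\<epsilon>, t), body_velocity J \<Gamma> (\<epsilon>, t)))) has_real_derivative 0) (at 0)"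
    by (rule *[unfolded hamilton_iff, rule_format, OF adm\<Gamma> ends])
  note bv = smooth_field_body_velocity[OF thick_I thick_J \<Gamma>]
  have vel: "velocity A (I \<rho>) (\<lambda>\<epsilon>. \<Gamma> (\<epsilon>, t)) 0 = left_act G A (g t) (\<eta> t)" if t: "t \<in> J" for t
  proof -
    have \<beta>t: "smooth_into (I \<rho>) (carrier G) A (\<lambda>\<epsilon>. \<beta> (\<epsilon>, t))" by (rule smooth_into_slice_fst[OF thick_I \<beta> t])
    note v\<beta> = velocity_in[OF thick_I zero_I[OF \<rho>] \<beta>t]
    have "((\<lambda>\<epsilon>. ?o + \<epsilon> *\<^sub>R \<eta> t d) has_vector_derivative \<eta> t d) (at 0 within I \<rho>)"
      unfolding has_vector_derivative_def by (auto intro!: derivative_eq_intros)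
    then have "((\<lambda>\<epsilon>. chart_map d (\<beta> (\<epsilon>, t))) has_vector_derivative \<eta> t d) (at 0 within I \<rho>)"
      by (rule has_vector_derivative_transform[OF zero_I[OF \<rho>], rotated])
        (use near t in \<open>simp add: \<beta>_def chart_map_inv\<close>)
    from thick_vector_derivative[OF thick_I zero_I[OF \<rho>] this]
    have "velocity A (I \<rho>) (\<lambda>\<epsilon>. \<beta> (\<epsilon>, t)) 0 d = \<eta> t d" using d by (simp add: velocity_def o_def \<beta>0)
    moreover have "velocity A (I \<rho>) (\<lambda>\<epsilon>. \<beta> (\<epsilon>, t)) 0 \<in> tangent_space A \<one>" using v\<beta> by (simp add: \<beta>0)
    ultimately have eq: "velocity A (I \<rho>) (\<lambda>\<epsilon>. \<beta> (\<epsilon>, t)) 0 = \<eta> t"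
      using tvec_eqI[OF _ smooth_field_in[OF \<eta>(1) t] d] by blast
    have gt: "smooth_into (I \<rho>) (carrier G) A (\<lambda>\<epsilon>. g t \<otimes> \<beta> (\<epsilon>, t))"
      by (rule smooth_into_mult[OF thick_I smooth_into_const[OF thick_I g_carrier[OF t]] \<beta>t])
    have "differentiable_map_at (\<lambda>x. g t \<otimes> x) (\<beta> (0, t))"
      unfolding \<beta>0 by (rule differentiable_left_translation[OF g_carrier[OF t] one_closed])
    from velocity_map[OF thick_I zero_I[OF \<rho>] \<beta>t this gt]
    show ?thesis by (simp add: \<Gamma>_def left_act_def eq \<beta>0)
  qed
  \<comment> \<open>Once \<eta> is matched along all of \<open>J\<close>, the structure equation
    matches the first-order change of the body velocity as well.\<close>
  have var: "body_variation (I \<rho>) \<Gamma> (0, t) = \<eta> t" if t: "t \<in> J" for t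
    using left_triv_left_act[OF g_carrier[OF t] smooth_field_in[OF \<eta>(1) t]]
    by (simp add: body_variation_def vel[OF t] \<Gamma>0[OF t])
  have bv0: "body_velocity J \<Gamma> (0, t) = \<xi>0 t" if "t \<in> J" for t by (rule body_velocity_zero[OF \<Gamma>0 that])
  show "((\<lambda>\<epsilon>. integral J (\<lambda>t. l (h (\<epsilon>, t), \<zeta> (\<epsilon>, t)))) has_real_derivative 0) (at 0)"
  proof (rule stationary_transfer[OF \<rho> r ab smooth_on_l[OF thick_IJ \<Gamma> bv] smooth_on_l[OF thick_IJ h \<zeta>(1)] _ stat])
    fix t assume t: "t \<in> J"
    obtain c where c: "c \<in> A" "g t \<in> chart_dom c" using cover[OF g_carrier[OF t]] by blast
    let ?D = "frechet_derivative (l_coord c d) (at (chart_map c (g t), \<xi>0 t d))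
      (left_act G A (g t) (\<eta> t) c, tvec_add (tvec_deriv J \<eta> t) (lie_ad G A (\<xi>0 t) (\<eta> t)) d)"
    have c\<Gamma>: "\<Gamma> (0, t) \<in> chart_dom c" using c by (simp add: \<Gamma>0[OF t])
    have "tvec_deriv J (\<lambda>t. body_variation (I \<rho>) \<Gamma> (0, t)) t = tvec_deriv J \<eta> t"
      by (rule tvec_deriv_cong[OF t var])
    then have "tvec_deriv (I \<rho>) (\<lambda>\<epsilon>. body_velocity J \<Gamma> (\<epsilon>, t)) 0 = tvec_add (tvec_deriv J \<eta> t) (lie_ad G A (\<xi>0 t) (\<eta> t))"
      using structure_equation[OF \<rho> ab t \<Gamma>] by (simp add: bv0[OF t] var[OF t])
    then have 1: "((\<lambda>\<epsilon>. l (\<Gamma> (\<epsilon>, t), body_velocity J \<Gamma> (\<epsilon>, t))) has_vector_derivative ?D) (at 0 within I \<rho>)"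
      using l_variation[OF thick_I zero_I[OF \<rho>] smooth_into_slice_fst[OF thick_I \<Gamma> t] smooth_field_slice_fst[OF bv t] c(1) c\<Gamma> d]
      by (simp add: vel[OF t] \<Gamma>0[OF t] bv0[OF t])
    have ch: "h (0, t) \<in> chart_dom c" using c by (simp add: h0[OF t])
    have "\<zeta> (0, t) = \<xi>0 t" using \<zeta>(2) t by blast
    moreover have "velocity A (I r) (\<lambda>\<epsilon>. h (\<epsilon>, t)) 0 = left_act G A (g t) (\<eta> t)"
      "tvec_deriv (I r) (\<lambda>\<epsilon>. \<zeta> (\<epsilon>, t)) 0 = tvec_add (tvec_deriv J \<eta> t) (lie_ad G A (\<xi>0 t) (\<eta> t))"
      using v t by auto
    ultimately have 2: "((\<lambda>\<epsilon>. l (h (\<epsilon>, t), \<zeta> (\<epsilon>, t))) has_vector_derivative ?D) (at 0 within I r)"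
      using l_variation[OF thick_I zero_I[OF r] smooth_into_slice_fst[OF thick_I h t] smooth_field_slice_fst[OF \<zeta>(1) t] c(1) ch d]
      by (simp add: h0[OF t])
    from 1 2 show "\<exists>D. ((\<lambda>\<epsilon>. l (\<Gamma> (\<epsilon>, t), body_velocity J \<Gamma> (\<epsilon>, t))) has_vector_derivative D) (at 0 within I \<rho>) \<and>
        ((\<lambda>\<epsilon>. l (h (\<epsilon>, t), \<zeta> (\<epsilon>, t))) has_vector_derivative D) (at 0 within I r)" by blast
  qed
qed

subsection \<open>The trivialized Hamilton-Pontryagin principle\<close>

lemma smooth_on_momentum_term:
  assumes "smooth_into (I r \<times> J) (carrier G) A h" "smooth_field (I r \<times> J) (\<lambda>_. \<one>) \<zeta>"
    "smooth_cofield (I r \<times> J) (\<lambda>_. \<one>) \<nu>"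
  shows "smooth_on (I r \<times> J) (\<lambda>s. \<nu> s (tvec_diff (body_velocity J h s) (\<zeta> s)))"
proof -
  note bv = smooth_field_body_velocity[OF thick_I thick_J assms(1)]
  note c = smooth_into_const[OF thick_IJ one_closed]
  have "smooth_on (I r \<times> J) (\<lambda>s. \<nu> s (body_velocity J h s) - \<nu> s (\<zeta> s))"
    by (intro smooth_on_diff smooth_on_pairing[OF thick_IJ c assms(3)] bv assms(2))
  then show ?thesis
    by (rule smooth_on_cong[rotated])
      (rule cotangent_diff[OF smooth_cofield_in[OF assms(3)] smooth_field_in[OF bv] smooth_field_in[OF assms(2)], symmetric])
qed

text \<open>The partial derivative of \<open>l\<close> in the Lie algebra variable at
  \<open>(g t, \<xi>0 t)\<close>. It is taken along a line in the fibre, with no chart at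
  \<open>g t\<close>, so that smoothness in \<open>t\<close> can be shown on all of \<open>J\<close>
  at once.\<close>

definition fiber_derivative :: "('g, 'e) chart \<Rightarrow> real \<Rightarrow> 'e \<Rightarrow> real" where
  "fiber_derivative d t u = vector_derivative (\<lambda>s. l (g t, tvec_of A d \<one> (\<xi>0 t d + s *\<^sub>R u))) (at 0)"

text \<open>In any chart around \<open>g t\<close> the same number is a partial derivative of
  \<open>l_coord\<close>; this yields linearity in \<open>u\<close> and the comparison with
  \<open>l_variation\<close>.\<close>

lemma fiber_derivative_eq:
  assumes c: "c \<in> A" "g t \<in> chart_dom c" and d: "d \<in> A" "\<one> \<in> chart_dom d"
  shows "fiber_derivative d t u = frechet_derivative (l_coord c d) (at (chart_map c (g t), \<xi>0 t d)) (0, u)"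
proof -
  let ?D = "frechet_derivative (l_coord c d) (at (chart_map c (g t), \<xi>0 t d))"
  have D: "(l_coord c d has_derivative ?D) (at (chart_map c (g t), \<xi>0 t d + 0 *\<^sub>R u))"
    using l_coord_has_derivative[OF c d] by simp
  have "((\<lambda>s. (chart_map c (g t), \<xi>0 t d + s *\<^sub>R u)) has_derivative (\<lambda>s. (0, s *\<^sub>R u))) (at 0)"
    by (auto intro!: derivative_eq_intros)
  from has_derivative_compose[OF this D]
  have "((\<lambda>s. l_coord c d (chart_map c (g t), \<xi>0 t d + s *\<^sub>R u)) has_vector_derivative ?D (0, u)) (at 0)"
    unfolding has_vector_derivative_def using linear_scale[OF has_derivative_linear[OF D], of _ "(0, u)"] by simp
  then have "((\<lambda>s. l (g t, tvec_of A d \<one> (\<xi>0 t d + s *\<^sub>R u))) has_vector_derivative ?D (0, u)) (at 0)"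
    unfolding l_coord_eq[OF c d tvec_of_in[OF d]] tvec_of_self[OF d] .
  then show ?thesis unfolding fiber_derivative_def by (rule vector_derivative_at)
qed

lemma fiber_derivative_linear:
  assumes t: "t \<in> J" and d: "d \<in> A" "\<one> \<in> chart_dom d"
  shows "linear (fiber_derivative d t)"
proof -
  obtain c where c: "c \<in> A" "g t \<in> chart_dom c" using cover[OF g_carrier[OF t]] by blast
  have l: "linear (frechet_derivative (l_coord c d) (at (chart_map c (g t), \<xi>0 t d)))"
    by (rule has_derivative_linear[OF l_coord_has_derivative[OF c d]])
  show ?thesis
    by (rule linearI) (use linear_add[OF l, of "(0, _)" "(0, _)"] linear_scale[OF l, of _ "(0, _)"]
      in \<open>simp_all add: fiber_derivative_eq[OF c d]\<close>)
qed

lemma \<xi>0_smooth: "smooth_field J (\<lambda>_. \<one>) \<xi>0"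
proof -
  \<comment> \<open>The family constant in \<epsilon>, on a strip whose half-width 1 is arbitrary,
    exhibits \<xi>0 as a slice of a smooth body velocity.\<close>
  have G: "smooth_into (I 1 \<times> J) (carrier G) A (\<lambda>s. g (snd s))"
    by (rule smooth_into_compose[OF findim_real g_smooth smooth_on_snd[OF smooth_on_id] _ thick_IJ]) auto
  show ?thesis
    by (rule smooth_field_cong[OF _ _ smooth_field_slice_snd[OF smooth_field_body_velocity[OF thick_I thick_J G], of 0]])
      (simp_all add: body_velocity_zero)
qed

text \<open>The line parameter is added as a second variable: \<open>F\<close> is smooth on
  \<open>J\<close> times the real line, and the fibre derivative is its partial derivative in that
  variable, restricted to 0.\<close>

lemma fiber_derivative_smooth:
  assumes d: "d \<in> A" "\<one> \<in> chart_dom d"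
  shows "smooth_on J (\<lambda>t. fiber_derivative d t u)"
proof -
  define F where "F = (\<lambda>z. l (g (fst z), tvec_of A d \<one> (\<xi>0 (fst z) d + snd z *\<^sub>R u)))"
  let ?S = "J \<times> (UNIV :: real set)"
  have S: "thick ?S" by (rule thick_Times[OF thick_J thick_UNIV])
  have fst_sm: "smooth_on ?S fst" by (rule smooth_on_fst[OF smooth_on_id])
  have F: "smooth_on ?S F"
    unfolding F_def
  proof (rule smooth_on_l[OF S])
    show "smooth_into ?S (carrier G) A (\<lambda>z. g (fst z))"
      by (rule smooth_into_compose[OF findim_real g_smooth fst_sm _ S]) auto
    show "smooth_field ?S (\<lambda>_. \<one>) (\<lambda>z. tvec_of A d \<one> (\<xi>0 (fst z) d + snd z *\<^sub>R u))"
      by (intro smooth_field_const[OF S one_closed d] smooth_on_add smooth_on_scaleR smooth_on_const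
          smooth_on_snd[OF smooth_on_id]
          smooth_on_compose[OF findim_real smooth_on_const_field_coord[OF thick_J \<xi>0_smooth d] fst_sm]) auto
  qed
  obtain F' where F': "\<And>z. z \<in> ?S \<Longrightarrow> (F has_derivative F' z) (at z within ?S)"
    "\<And>v. smooth_on ?S (\<lambda>z. F' z v)" using smooth_on_derivative[OF S F] by metis
  have "smooth_on J (\<lambda>t. F' (t, 0) (0, 1))"
    by (rule smooth_on_compose[OF findim_prod[OF findim_real findim_real] F'(2)])
      (auto intro!: smooth_on_Pair smooth_on_id smooth_on_const)
  then show ?thesis
  proof (rule smooth_on_cong[rotated])
    fix t assume t: "t \<in> J"
    have "((\<lambda>s. F (t, s)) has_vector_derivative F' (t, 0) (0, 1)) (at 0 within UNIV)"
      by (rule has_vector_derivative_snd_slice[OF F'(1) t]) (use t in auto)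
    then show "F' (t, 0) (0, 1) = fiber_derivative d t u"
      unfolding fiber_derivative_def by (simp add: F_def vector_derivative_at)
  qed
qed

lemma momentum_smooth:
  assumes d: "d \<in> A" "\<one> \<in> chart_dom d"
  shows "smooth_cofield J (\<lambda>_. \<one>) (\<lambda>t. covec_of d \<one> (fiber_derivative d t))"
proof (rule smooth_cofield_constI)
  show "covec_of d \<one> (fiber_derivative d t) \<in> cotangent_space A \<one>" if "t \<in> J" for t
    by (rule covec_of_in[OF fiber_derivative_linear[OF that d]])
  show "smooth_on J (\<lambda>t. covec_of d \<one> (fiber_derivative d t) (tvec_of A c \<one> u))"
    if "c \<in> A" "\<one> \<in> chart_dom c" for c u
    using fiber_derivative_smooth[OF d] by (simp add: covec_of_def tvec_of_in that)
qed

text \<open>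
  With the momentum equal to the fiber derivative of \<open>l\<close>, the two actions have the same first
  variation, because the difference of their integrands vanishes to second order.
\<close>

lemma trivialized_hamilton_pontryagin_if_hamilton:
  assumes *: "hamilton_principle G A L a b g" and d: "d \<in> A" "\<one> \<in> chart_dom d"
  shows "trivialized_hamilton_pontryagin_principle G A l a b g \<xi>0 (\<lambda>t. covec_of d \<one> (fiber_derivative d t))"
  unfolding trivialized_hamilton_pontryagin_iff
proof (intro allI impI)
  fix r h \<zeta> \<nu>
  assume adm: "admissible r h" and \<zeta>: "smooth_field (I r \<times> J) (\<lambda>_. \<one>) \<zeta>" "\<forall>t\<in>J. \<zeta> (0, t) = \<xi>0 t"
    and \<nu>: "smooth_cofield (I r \<times> J) (\<lambda>_. \<one>) \<nu>" "\<forall>t\<in>J. \<nu> (0, t) = covec_of d \<one> (fiber_derivative d t)"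
    and ends: "fixed_ends r h"
  have r: "0 < r" and h: "smooth_into (I r \<times> J) (carrier G) A h" and h0: "\<And>t. t \<in> J \<Longrightarrow> h (0, t) = g t"
    using adm unfolding admissible_def by auto
  note 0 = zero_I[OF r]
  note bv = smooth_field_body_velocity[OF thick_I thick_J h]
  have bv0: "body_velocity J h (0, t) = \<xi>0 t" if "t \<in> J" for t by (rule body_velocity_zero[OF h0 that])
  have stat: "((\<lambda>\<epsilon>. integral J (\<lambda>t. l (h (\<epsilon>, t), body_velocity J h (\<epsilon>, t)))) has_real_derivative 0) (at 0)"
    by (rule *[unfolded hamilton_iff, rule_format, OF adm ends])
  have f2: "smooth_on (I r \<times> J) (\<lambda>s. l (h s, \<zeta> s) + \<nu> s (tvec_diff (body_velocity J h s) (\<zeta> s)))"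
    by (intro smooth_on_add smooth_on_l[OF thick_IJ h \<zeta>(1)] smooth_on_momentum_term h \<zeta>(1) \<nu>(1))
  show "((\<lambda>\<epsilon>. integral J (\<lambda>t. l (h (\<epsilon>, t), \<zeta> (\<epsilon>, t)) +
      \<nu> (\<epsilon>, t) (tvec_diff (body_velocity J h (\<epsilon>, t)) (\<zeta> (\<epsilon>, t))))) has_real_derivative 0) (at 0)"
  proof (rule stationary_transfer[OF r r ab smooth_on_l[OF thick_IJ h bv] f2 _ stat])
    fix t assume t: "t \<in> J"
    obtain c where c: "c \<in> A" "g t \<in> chart_dom c" using cover[OF g_carrier[OF t]] by blast
    have ch: "h (0, t) \<in> chart_dom c" using c by (simp add: h0[OF t])
    let ?D = "frechet_derivative (l_coord c d) (at (chart_map c (g t), \<xi>0 t d))"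
    define x1 where "x1 = velocity A (I r) (\<lambda>\<epsilon>. h (\<epsilon>, t)) 0 c"
    define b1 where "b1 = tvec_deriv (I r) (\<lambda>\<epsilon>. body_velocity J h (\<epsilon>, t)) 0 d"
    define z1 where "z1 = tvec_deriv (I r) (\<lambda>\<epsilon>. \<zeta> (\<epsilon>, t)) 0 d"
    have \<zeta>0: "\<zeta> (0, t) = \<xi>0 t" using \<zeta>(2) t by blast
    note ht = smooth_into_slice_fst[OF thick_I h t] and bt = smooth_field_slice_fst[OF bv t]
      and zt = smooth_field_slice_fst[OF \<zeta>(1) t]
    have 1: "((\<lambda>\<epsilon>. l (h (\<epsilon>, t), body_velocity J h (\<epsilon>, t))) has_vector_derivative ?D (x1, b1)) (at 0 within I r)"
      using l_variation[OF thick_I 0 ht bt c(1) ch d] by (simp add: x1_def b1_def h0[OF t] bv0[OF t])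
    have 2: "((\<lambda>\<epsilon>. l (h (\<epsilon>, t), \<zeta> (\<epsilon>, t))) has_vector_derivative ?D (x1, z1)) (at 0 within I r)"
      using l_variation[OF thick_I 0 ht zt c(1) ch d] by (simp add: x1_def z1_def h0[OF t] \<zeta>0)
    have "smooth_cofield (I r) (\<lambda>_. \<one>) (\<lambda>\<epsilon>. \<nu> (\<epsilon>, t))"
    proof (rule smooth_cofield_constI)
      show "\<nu> (\<epsilon>, t) \<in> cotangent_space A \<one>" if "\<epsilon> \<in> I r" for \<epsilon> using smooth_cofield_in[OF \<nu>(1)] that t by blast
      show "smooth_on (I r) (\<lambda>\<epsilon>. \<nu> (\<epsilon>, t) (tvec_of A k \<one> u))" if k: "k \<in> A" "\<one> \<in> chart_dom k" for k u
        by (rule smooth_on_compose[OF findim_prod[OF findim_real findim_real]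
              smooth_cofield_constD[OF thick_IJ one_closed k \<nu>(1)]])
          (use t in \<open>auto intro!: smooth_on_Pair smooth_on_id smooth_on_const\<close>)
    qed
    \<comment> \<open>At \<epsilon> = 0 both \<zeta> and the body velocity equal \<xi>0, so the
      vector paired with \<nu> vanishes there and only its own derivative survives.\<close>
    then have "((\<lambda>\<epsilon>. \<nu> (\<epsilon>, t) (tvec_of A d \<one> (body_velocity J h (\<epsilon>, t) d - \<zeta> (\<epsilon>, t) d))) has_vector_derivative
        \<nu> (0, t) (tvec_of A d \<one> (b1 - z1))) (at 0 within I r)"
      unfolding b1_def z1_def
      by (intro pairing_has_vector_derivative[OF _ 0 one_closed d] has_vector_derivative_diff
          const_field_has_vector_derivative[OF thick_I 0 bt d] const_field_has_vector_derivative[OF thick_I 0 zt d])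
        (auto simp: bv0[OF t] \<zeta>0)
    then have 3: "((\<lambda>\<epsilon>. \<nu> (\<epsilon>, t) (tvec_diff (body_velocity J h (\<epsilon>, t)) (\<zeta> (\<epsilon>, t)))) has_vector_derivative
        \<nu> (0, t) (tvec_of A d \<one> (b1 - z1))) (at 0 within I r)"
    proof (rule has_vector_derivative_transform[OF 0, rotated])
      fix \<epsilon> assume e: "\<epsilon> \<in> I r"
      have "tvec_diff (body_velocity J h (\<epsilon>, t)) (\<zeta> (\<epsilon>, t)) \<in> tangent_space A \<one>"
        by (rule tvec_diff_in[OF smooth_field_in[OF bt e] smooth_field_in[OF zt e]])
      from tvec_of_eq[OF this d]
      show "\<nu> (\<epsilon>, t) (tvec_diff (body_velocity J h (\<epsilon>, t)) (\<zeta> (\<epsilon>, t))) =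
          \<nu> (\<epsilon>, t) (tvec_of A d \<one> (body_velocity J h (\<epsilon>, t) d - \<zeta> (\<epsilon>, t) d))"
        by (simp add: tvec_diff_def)
    qed
    have "\<nu> (0, t) = covec_of d \<one> (fiber_derivative d t)" using \<nu>(2) t by blast
    then have "\<nu> (0, t) (tvec_of A d \<one> (b1 - z1)) = ?D (0, b1 - z1)"
      by (simp add: covec_of_def tvec_of_in[OF d] tvec_of_self[OF d] fiber_derivative_eq[OF c d])
    \<comment> \<open>The momentum term adds exactly the fibre direction by which the variation of
      \<zeta> misses that of the body velocity.\<close>
    moreover have "?D (x1, z1) + ?D (0, b1 - z1) = ?D (x1, b1)"
      using linear_add[OF has_derivative_linear[OF l_coord_has_derivative[OF c d]], of "\<xi>0 t d" "(x1, z1)" "(0, b1 - z1)"]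
      by simp
    ultimately have 4: "((\<lambda>\<epsilon>. l (h (\<epsilon>, t), \<zeta> (\<epsilon>, t)) + \<nu> (\<epsilon>, t) (tvec_diff (body_velocity J h (\<epsilon>, t)) (\<zeta> (\<epsilon>, t))))
        has_vector_derivative ?D (x1, b1)) (at 0 within I r)"
      using has_vector_derivative_add[OF 2 3] by simp
    from 1 4 show "\<exists>D. ((\<lambda>\<epsilon>. l (h (\<epsilon>, t), body_velocity J h (\<epsilon>, t))) has_vector_derivative D) (at 0 within I r) \<and>
        ((\<lambda>\<epsilon>. l (h (\<epsilon>, t), \<zeta> (\<epsilon>, t)) + \<nu> (\<epsilon>, t) (tvec_diff (body_velocity J h (\<epsilon>, t)) (\<zeta> (\<epsilon>, t))))
        has_vector_derivative D) (at 0 within I r)" by blast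
  qed
qed

lemma smooth_field_time:
  assumes "smooth_field J (\<lambda>_. \<one>) w"
  shows "smooth_field (I r \<times> J) (\<lambda>_. \<one>) (\<lambda>s. w (snd s))"
  by (rule smooth_field_compose[OF findim_real assms smooth_on_snd[OF smooth_on_id]]) auto

text \<open>
  Varying only the momentum, in the direction metrically dual to \<open>\<xi>0 - \<xi>\<close>, forces \<open>\<xi> = \<xi>0\<close>.
\<close>

lemma reconstruction_equation:
  assumes *: "trivialized_hamilton_pontryagin_principle G A l a b g \<xi> \<mu>"
    and \<xi>: "smooth_field J (\<lambda>_. \<one>) \<xi>" and \<mu>: "smooth_cofield J (\<lambda>_. \<one>) \<mu>" and t: "t \<in> J"
  shows "\<xi> t = \<xi>0 t"
proof -
  obtain d where d: "d \<in> A" "\<one> \<in> chart_dom d" using cover[OF one_closed] by blast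
  obtain B :: "'e set" and \<kappa> where B: "finite B" "\<And>b. bounded_linear (\<kappa> b)"
    "\<And>x. (\<Sum>b\<in>B. \<kappa> b x *\<^sub>R b) = x" using findim_coords[OF findim_model] by blast
  define \<delta> where "\<delta> t = \<xi>0 t d - \<xi> t d" for t
  \<comment> \<open>Pairing with \<delta> in the inner product of coefficients, so that \<beta>
    evaluated at the constraint defect is a sum of squares.\<close>
  define \<beta> where "\<beta> t = covec_of d \<one> (\<lambda>u. \<Sum>b\<in>B. \<kappa> b (\<delta> t) * \<kappa> b u)" for t
  define \<nu> where "\<nu> = (\<lambda>s w. \<mu> (snd s) w + fst s * \<beta> (snd s) w)"
  have \<delta>: "smooth_on J \<delta>" unfolding \<delta>_def
    by (intro smooth_on_diff smooth_on_const_field_coord[OF thick_J _ d] \<xi>0_smooth \<xi>)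
  have snd_sm: "smooth_on (I 1 \<times> J) snd" by (rule smooth_on_snd[OF smooth_on_id])
  have \<beta>in: "\<beta> t \<in> cotangent_space A \<one>" for t
    unfolding \<beta>_def
    by (intro covec_of_in bounded_linear.linear bounded_linear_sum bounded_linear_const_mult B(2))
  have \<nu>: "smooth_cofield (I 1 \<times> J) (\<lambda>_. \<one>) \<nu>"
  proof (rule smooth_cofield_constI)
    fix s assume "s \<in> I 1 \<times> J"
    then have m: "\<mu> (snd s) \<in> cotangent_space A \<one>" using smooth_cofield_in[OF \<mu>, of "snd s"] by auto
    show "\<nu> s \<in> cotangent_space A \<one>"
      unfolding cotangent_space_def
      by (auto simp: \<nu>_def cotangent_add[OF m] cotangent_add[OF \<beta>in] cotangent_scale[OF m] cotangent_scale[OF \<beta>in]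
          cotangent_outside[OF m] cotangent_outside[OF \<beta>in] algebra_simps)
  next
    fix k u assume k: "k \<in> A" "\<one> \<in> chart_dom k"
    have "smooth_on (I 1 \<times> J) (\<lambda>s. \<mu> (snd s) (tvec_of A k \<one> u) +
        fst s *\<^sub>R (\<Sum>b\<in>B. \<kappa> b (\<delta> (snd s)) *\<^sub>R \<kappa> b (tvec_of A k \<one> u d)))"
      by (intro smooth_on_add smooth_on_scaleR smooth_on_sum smooth_on_const smooth_on_fst[OF smooth_on_id]
          smooth_on_bounded_linear[OF B(2)] smooth_on_compose[OF findim_real \<delta> snd_sm]
          smooth_on_compose[OF findim_real smooth_cofield_constD[OF thick_J one_closed k \<mu>] snd_sm]) auto
    then show "smooth_on (I 1 \<times> J) (\<lambda>s. \<nu> s (tvec_of A k \<one> u))"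
      by (simp add: \<nu>_def \<beta>_def covec_of_def tvec_of_in k)
  qed
  have h: "smooth_into (I 1 \<times> J) (carrier G) A (\<lambda>s. g (snd s))"
    by (rule smooth_into_compose[OF findim_real g_smooth snd_sm _ thick_IJ]) auto
  have adm: "admissible 1 (\<lambda>s. g (snd s))" unfolding admissible_def using h by simp
  have ends: "fixed_ends 1 (\<lambda>s. g (snd s))" unfolding fixed_ends_def by simp
  have bv: "body_velocity J (\<lambda>s. g (snd s)) (\<epsilon>, t) = \<xi>0 t" for \<epsilon> t
    by (simp add: body_velocity_def \<xi>0_def)
  let ?f = "\<lambda>s. l (g (snd s), \<xi> (snd s)) + \<nu> s (tvec_diff (body_velocity J (\<lambda>s. g (snd s)) s) (\<xi> (snd s)))"
  have f: "smooth_on (I 1 \<times> J) ?f"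
    by (intro smooth_on_add smooth_on_l[OF thick_IJ h] smooth_on_momentum_term h smooth_field_time \<xi> \<nu>)
  have stat: "((\<lambda>\<epsilon>. integral J (\<lambda>t. ?f (\<epsilon>, t))) has_real_derivative 0) (at 0)"
    using *[unfolded trivialized_hamilton_pontryagin_iff, rule_format, OF adm smooth_field_time[OF \<xi>] \<nu> _ _ ends]
    by (simp add: \<nu>_def)
  let ?d = "\<lambda>t. \<Sum>b\<in>B. \<kappa> b (\<delta> t) * \<kappa> b (\<delta> t)"
  have der: "((\<lambda>\<epsilon>. ?f (\<epsilon>, t)) has_vector_derivative ?d t) (at 0 within I 1)" if t: "t \<in> J" for t
  proof -
    have T: "tvec_diff (\<xi>0 t) (\<xi> t) \<in> tangent_space A \<one>"
      by (rule tvec_diff_in[OF \<xi>0_in[OF t] smooth_field_in[OF \<xi> t]])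
    \<comment> \<open>The integrand is affine in \<epsilon>, and its slope is that sum of
      squares.\<close>
    have "?f (\<epsilon>, t) = l (g t, \<xi> t) + \<mu> t (tvec_diff (\<xi>0 t) (\<xi> t)) + \<epsilon> * ?d t" for \<epsilon>
      using T by (simp add: \<nu>_def bv \<beta>_def covec_of_def tvec_diff_def \<delta>_def)
    then show ?thesis unfolding has_vector_derivative_def by (auto intro!: derivative_eq_intros)
  qed
  have "((\<lambda>\<epsilon>. integral J (\<lambda>t. ?f (\<epsilon>, t))) has_real_derivative integral J ?d) (at 0)"
    using leibniz_strip[OF zero_less_one ab f der] by (simp add: has_real_derivative_iff_has_vector_derivative)
  then have int0: "integral J ?d = 0" using stat DERIV_unique by blast
  have "smooth_on J (\<lambda>t. \<Sum>b\<in>B. \<kappa> b (\<delta> t) *\<^sub>R \<kappa> b (\<delta> t))"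
    by (intro smooth_on_sum smooth_on_scaleR smooth_on_bounded_linear[OF B(2)] \<delta>)
  then have "continuous_on J ?d" using smooth_on_continuous by force
  \<comment> \<open>A continuous nonnegative function with zero integral over a proper interval
    vanishes at every point of it.\<close>
  then have "?d t = 0"
    using integral_eq_0_iff[of a b ?d] int0 ab t by (simp add: sum_nonneg)
  then have "\<forall>b\<in>B. \<kappa> b (\<delta> t) = 0" using sum_nonneg_eq_0_iff[OF B(1), of "\<lambda>b. \<kappa> b (\<delta> t) * \<kappa> b (\<delta> t)"] by simp
  then have "(\<Sum>b\<in>B. \<kappa> b (\<delta> t) *\<^sub>R b) = 0" by simp
  then have "\<xi> t d = \<xi>0 t d" unfolding B(3) \<delta>_def by simp
  then show ?thesis by (rule tvec_eqI[OF smooth_field_in[OF \<xi> t] \<xi>0_in[OF t] d])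
qed

text \<open>The test family is \<Gamma> with its body velocity and with \<mu> independent of
  \<epsilon>. It passes through the given \<xi> because of the reconstruction equation, and its
  constraint term is zero for every \<epsilon>.\<close>

lemma hamilton_if_trivialized_hamilton_pontryagin:
  assumes *: "trivialized_hamilton_pontryagin_principle G A l a b g \<xi> \<mu>"
    and \<xi>: "smooth_field J (\<lambda>_. \<one>) \<xi>" and \<mu>: "smooth_cofield J (\<lambda>_. \<one>) \<mu>"
  shows "hamilton_principle G A L a b g"
  unfolding hamilton_iff
proof (intro allI impI)
  fix r \<Gamma> assume adm: "admissible r \<Gamma>" and ends: "fixed_ends r \<Gamma>"
  have r: "0 < r" and \<Gamma>: "smooth_into (I r \<times> J) (carrier G) A \<Gamma>" and \<Gamma>0: "\<And>t. t \<in> J \<Longrightarrow> \<Gamma> (0, t) = g t"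
    using adm unfolding admissible_def by auto
  note bv = smooth_field_body_velocity[OF thick_I thick_J \<Gamma>]
  have \<nu>: "smooth_cofield (I r \<times> J) (\<lambda>_. \<one>) (\<lambda>s. \<mu> (snd s))"
  proof (rule smooth_cofield_constI)
    show "\<mu> (snd s) \<in> cotangent_space A \<one>" if "s \<in> I r \<times> J" for s using smooth_cofield_in[OF \<mu>] that by auto
    show "smooth_on (I r \<times> J) (\<lambda>s. \<mu> (snd s) (tvec_of A k \<one> u))" if k: "k \<in> A" "\<one> \<in> chart_dom k" for k u
      by (rule smooth_on_compose[OF findim_real smooth_cofield_constD[OF thick_J one_closed k \<mu>]
            smooth_on_snd[OF smooth_on_id]]) auto
  qed
  have "((\<lambda>\<epsilon>. integral J (\<lambda>t. l (\<Gamma> (\<epsilon>, t), body_velocity J \<Gamma> (\<epsilon>, t)) +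
      \<mu> (snd (\<epsilon>, t)) (tvec_diff (body_velocity J \<Gamma> (\<epsilon>, t)) (body_velocity J \<Gamma> (\<epsilon>, t))))) has_real_derivative 0) (at 0)"
  proof (rule *[unfolded trivialized_hamilton_pontryagin_iff, rule_format, OF adm bv \<nu> _ _ ends])
    show "body_velocity J \<Gamma> (0, t) = \<xi> t" if "t \<in> J" for t
      unfolding reconstruction_equation[OF * \<xi> \<mu> that] by (rule body_velocity_zero[OF \<Gamma>0 that])
  qed simp
  moreover have "integral J (\<lambda>t. l (\<Gamma> (\<epsilon>, t), body_velocity J \<Gamma> (\<epsilon>, t)) +
      \<mu> (snd (\<epsilon>, t)) (tvec_diff (body_velocity J \<Gamma> (\<epsilon>, t)) (body_velocity J \<Gamma> (\<epsilon>, t)))) =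
    integral J (\<lambda>t. l (\<Gamma> (\<epsilon>, t), body_velocity J \<Gamma> (\<epsilon>, t)))" if e: "\<epsilon> \<in> I r" for \<epsilon>
  proof (rule integral_cong)
    fix t assume t: "t \<in> J"
    have b: "body_velocity J \<Gamma> (\<epsilon>, t) \<in> tangent_space A \<one>" by (rule smooth_field_in[OF bv]) (use e t in auto)
    show "l (\<Gamma> (\<epsilon>, t), body_velocity J \<Gamma> (\<epsilon>, t)) +
        \<mu> (snd (\<epsilon>, t)) (tvec_diff (body_velocity J \<Gamma> (\<epsilon>, t)) (body_velocity J \<Gamma> (\<epsilon>, t))) =
      l (\<Gamma> (\<epsilon>, t), body_velocity J \<Gamma> (\<epsilon>, t))"
      using cotangent_diff[OF smooth_cofield_in[OF \<mu> t] b b] by simp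
  qed
  ultimately show "((\<lambda>\<epsilon>. integral J (\<lambda>t. l (\<Gamma> (\<epsilon>, t), body_velocity J \<Gamma> (\<epsilon>, t)))) has_real_derivative 0) (at 0)"
    using stationary_cong[OF r] by (metis (no_types, lifting))
qed

subsection \<open>Trivialization of the Pontryagin bundle\<close>

text \<open>Transposition makes the pairing invariant: left trivialization of vectors and
  \<open>left_act_dual\<close> of covectors cancel, so the integrands agree pointwise.\<close>

lemma pontryagin_integrand:
  assumes x: "x \<in> carrier G" and v: "v \<in> tangent_space A x" and w: "w \<in> tangent_space A x"
    and q: "q \<in> cotangent_space A x"
  shows "L (x, w) + q (tvec_diff v w) =
    l (x, left_triv G A x w) + left_act_dual x q (tvec_diff (left_triv G A x v) (left_triv G A x w))"
  using left_triv_in[OF x tvec_diff_in[OF v w]]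
  by (simp add: L_eq_l[OF x w] left_triv_diff[OF x, symmetric] left_act_dual_def left_act_left_triv[OF x tvec_diff_in[OF v w]])

lemma pontryagin_stationary_iff:
  assumes r: "0 < r" and h: "smooth_into (I r \<times> J) (carrier G) A h" and w: "smooth_field (I r \<times> J) h w"
    and q: "smooth_cofield (I r \<times> J) h q"
  shows "((\<lambda>\<epsilon>. integral J (\<lambda>t. L (h (\<epsilon>, t), w (\<epsilon>, t)) +
        q (\<epsilon>, t) (tvec_diff (velocity A J (\<lambda>s. h (\<epsilon>, s)) t) (w (\<epsilon>, t))))) has_real_derivative 0) (at 0) \<longleftrightarrow>
    ((\<lambda>\<epsilon>. integral J (\<lambda>t. l (h (\<epsilon>, t), left_triv G A (h (\<epsilon>, t)) (w (\<epsilon>, t))) +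
        left_act_dual (h (\<epsilon>, t)) (q (\<epsilon>, t))
          (tvec_diff (body_velocity J h (\<epsilon>, t)) (left_triv G A (h (\<epsilon>, t)) (w (\<epsilon>, t)))))) has_real_derivative 0) (at 0)"
proof (rule stationary_cong[OF r], rule integral_cong)
  fix \<epsilon> t assume e: "\<epsilon> \<in> I r" and t: "t \<in> J"
  then have s: "(\<epsilon>, t) \<in> I r \<times> J" by simp
  show "L (h (\<epsilon>, t), w (\<epsilon>, t)) + q (\<epsilon>, t) (tvec_diff (velocity A J (\<lambda>s. h (\<epsilon>, s)) t) (w (\<epsilon>, t))) =
    l (h (\<epsilon>, t), left_triv G A (h (\<epsilon>, t)) (w (\<epsilon>, t))) + left_act_dual (h (\<epsilon>, t)) (q (\<epsilon>, t))
      (tvec_diff (body_velocity J h (\<epsilon>, t)) (left_triv G A (h (\<epsilon>, t)) (w (\<epsilon>, t))))"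
    using pontryagin_integrand[OF smooth_into_carrier[OF h s]
        velocity_in[OF thick_J t smooth_into_slice_snd[OF thick_J h e]] smooth_field_in[OF w s] smooth_cofield_in[OF q s]]
    by (simp add: body_velocity_def)
qed

text \<open>Trivialization is a bijection between families that fixes the base map, hence also its
  ends. A trivialized test family is carried back to the bundle, where stationarity is
  known.\<close>

lemma trivialized_if_hamilton_pontryagin:
  assumes *: "hamilton_pontryagin_principle G A L a b g v p"
    and v: "\<And>t. t \<in> J \<Longrightarrow> v t \<in> tangent_space A (g t)" and p: "\<And>t. t \<in> J \<Longrightarrow> p t \<in> cotangent_space A (g t)"
  shows "trivialized_hamilton_pontryagin_principle G A l a b g
    (\<lambda>t. left_triv G A (g t) (v t)) (\<lambda>t. left_act_dual (g t) (p t))"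
  unfolding trivialized_hamilton_pontryagin_iff
proof (intro allI impI)
  fix r h \<zeta> \<nu>
  assume adm: "admissible r h" and \<zeta>: "smooth_field (I r \<times> J) (\<lambda>_. \<one>) \<zeta>" and \<zeta>0: "\<forall>t\<in>J. \<zeta> (0, t) = left_triv G A (g t) (v t)"
    and \<nu>: "smooth_cofield (I r \<times> J) (\<lambda>_. \<one>) \<nu>" and \<nu>0: "\<forall>t\<in>J. \<nu> (0, t) = left_act_dual (g t) (p t)"
    and ends: "fixed_ends r h"
  have r: "0 < r" and h: "smooth_into (I r \<times> J) (carrier G) A h" and h0: "\<And>t. t \<in> J \<Longrightarrow> h (0, t) = g t"
    using adm unfolding admissible_def by auto
  let ?w = "\<lambda>s. left_act G A (h s) (\<zeta> s)" and ?q = "\<lambda>s. left_triv_dual (h s) (\<nu> s)"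
  note w = smooth_field_left_act[OF thick_IJ h \<zeta>] and q = smooth_cofield_left_triv_dual[OF thick_IJ h \<nu>]
  have "((\<lambda>\<epsilon>. integral J (\<lambda>t. L (h (\<epsilon>, t), ?w (\<epsilon>, t)) +
        ?q (\<epsilon>, t) (tvec_diff (velocity A J (\<lambda>s. h (\<epsilon>, s)) t) (?w (\<epsilon>, t))))) has_real_derivative 0) (at 0)"
    by (rule *[unfolded hamilton_pontryagin_iff, rule_format, OF adm w q _ _ ends])
      (simp_all add: h0 \<zeta>0 \<nu>0 g_carrier v p left_act_left_triv left_triv_dual_left_act_dual)
  then have "((\<lambda>\<epsilon>. integral J (\<lambda>t. l (h (\<epsilon>, t), left_triv G A (h (\<epsilon>, t)) (?w (\<epsilon>, t))) +
        left_act_dual (h (\<epsilon>, t)) (?q (\<epsilon>, t))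
          (tvec_diff (body_velocity J h (\<epsilon>, t)) (left_triv G A (h (\<epsilon>, t)) (?w (\<epsilon>, t)))))) has_real_derivative 0) (at 0)"
    unfolding pontryagin_stationary_iff[OF r h w q] .
  moreover have "left_triv G A (h s) (?w s) = \<zeta> s" "left_act_dual (h s) (?q s) = \<nu> s" if "s \<in> I r \<times> J" for s
    using that smooth_into_carrier[OF h] smooth_field_in[OF \<zeta>] smooth_cofield_in[OF \<nu>]
    by (simp_all add: left_triv_left_act left_act_dual_left_triv_dual)
  ultimately show "((\<lambda>\<epsilon>. integral J (\<lambda>t. l (h (\<epsilon>, t), \<zeta> (\<epsilon>, t)) +
      \<nu> (\<epsilon>, t) (tvec_diff (body_velocity J h (\<epsilon>, t)) (\<zeta> (\<epsilon>, t))))) has_real_derivative 0) (at 0)"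
    by (subst stationary_cong[OF r]) (auto intro!: integral_cong)
qed

text \<open>The same correspondence read the other way: a test family in the bundle is trivialized,
  and the actions coincide.\<close>

lemma hamilton_pontryagin_if_trivialized:
  assumes *: "trivialized_hamilton_pontryagin_principle G A l a b g \<xi> \<mu>"
    and \<xi>: "\<And>t. t \<in> J \<Longrightarrow> \<xi> t \<in> tangent_space A \<one>" and \<mu>: "\<And>t. t \<in> J \<Longrightarrow> \<mu> t \<in> cotangent_space A \<one>"
  shows "hamilton_pontryagin_principle G A L a b g
    (\<lambda>t. left_act G A (g t) (\<xi> t)) (\<lambda>t. left_triv_dual (g t) (\<mu> t))"
  unfolding hamilton_pontryagin_iff
proof (intro allI impI)
  fix r h w q
  assume adm: "admissible r h" and w: "smooth_field (I r \<times> J) h w" and w0: "\<forall>t\<in>J. w (0, t) = left_act G A (g t) (\<xi> t)"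
    and q: "smooth_cofield (I r \<times> J) h q" and q0: "\<forall>t\<in>J. q (0, t) = left_triv_dual (g t) (\<mu> t)"
    and ends: "fixed_ends r h"
  have r: "0 < r" and h: "smooth_into (I r \<times> J) (carrier G) A h" and h0: "\<And>t. t \<in> J \<Longrightarrow> h (0, t) = g t"
    using adm unfolding admissible_def by auto
  show "((\<lambda>\<epsilon>. integral J (\<lambda>t. L (h (\<epsilon>, t), w (\<epsilon>, t)) +
        q (\<epsilon>, t) (tvec_diff (velocity A J (\<lambda>s. h (\<epsilon>, s)) t) (w (\<epsilon>, t))))) has_real_derivative 0) (at 0)"
    unfolding pontryagin_stationary_iff[OF r h w q]
    by (rule *[unfolded trivialized_hamilton_pontryagin_iff, rule_format,
          OF adm smooth_field_left_triv[OF thick_IJ h w] smooth_cofield_left_act_dual[OF thick_IJ h q] _ _ ends])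
      (simp_all add: h0 w0 q0 g_carrier \<xi> \<mu> left_triv_left_act left_act_dual_left_triv_dual)
qed

end

theorem theorem3p2:
  fixes G :: "('g, 'k) monoid_scheme"
    and A :: "('g, 'e::real_normed_vector) chart set"
    and L l :: "'g \<times> ('g, 'e) tvec \<Rightarrow> real"
    and g :: "real \<Rightarrow> 'g"
    and a b :: real
  assumes "lie_group G A"
    and "smooth_map (tangent_bundle (carrier G) A) (tangent_bundle_atlas A) UNIV std_atlas L"
    and "l = left_trivialization G A L"
    and "a < b"
    and "smooth_into {a..b} (carrier G) A g"
  shows
    "(hamilton_principle G A L a b g \<longleftrightarrow> trivialized_hamilton_principle G A l a b g) \<and>
     (trivialized_hamilton_principle G A l a b g \<longleftrightarrow>
       (\<exists>v p. smooth_into {a..b} (pontryagin_bundle (carrier G) A) (pontryagin_bundle_atlas A)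
                (\<lambda>t. (g t, v t, p t)) \<and>
              hamilton_pontryagin_principle G A L a b g v p)) \<and>
     ((\<exists>v p. smooth_into {a..b} (pontryagin_bundle (carrier G) A) (pontryagin_bundle_atlas A)
                (\<lambda>t. (g t, v t, p t)) \<and>
              hamilton_pontryagin_principle G A L a b g v p) \<longleftrightarrow>
       (\<exists>\<xi> \<mu>. smooth_into {a..b} (lie_algebra G A) (lie_algebra_atlas G A) \<xi> \<and>
              smooth_into {a..b} (lie_algebra_dual G A) (lie_algebra_dual_atlas G A) \<mu> \<and>
              trivialized_hamilton_pontryagin_principle G A l a b g \<xi> \<mu>))"
proof -
  interpret lie_group G A by fact
  interpret lie_group_lagrangian G A L l g a b by unfold_locales fact+
  have field: "smooth_into {a..b} (lie_algebra G A) (lie_algebra_atlas G A) \<xi> \<longleftrightarrow> smooth_field {a..b} (\<lambda>_. \<one>\<^bsub>G\<^esub>) \<xi>"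
    and cofield: "smooth_into {a..b} (lie_algebra_dual G A) (lie_algebra_dual_atlas G A) \<mu> \<longleftrightarrow>
      smooth_cofield {a..b} (\<lambda>_. \<one>\<^bsub>G\<^esub>) \<mu>" for \<xi> \<mu>
    unfolding lie_algebra_def lie_algebra_dual_def
    by (rule smooth_into_tangent_space_iff[OF one_closed thick_J], rule smooth_into_cotangent_space_iff[OF one_closed thick_J])
  let ?HP = "\<exists>v p. smooth_into {a..b} (pontryagin_bundle (carrier G) A) (pontryagin_bundle_atlas A)
                (\<lambda>t. (g t, v t, p t)) \<and> hamilton_pontryagin_principle G A L a b g v p"
  let ?TP = "\<exists>\<xi> \<mu>. smooth_into {a..b} (lie_algebra G A) (lie_algebra_atlas G A) \<xi> \<and>
              smooth_into {a..b} (lie_algebra_dual G A) (lie_algebra_dual_atlas G A) \<mu> \<and>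
              trivialized_hamilton_pontryagin_principle G A l a b g \<xi> \<mu>"
  have 12: "hamilton_principle G A L a b g \<longleftrightarrow> trivialized_hamilton_principle G A l a b g"
    using hamilton_if_trivialized trivialized_if_hamilton by blast
  have 14: "hamilton_principle G A L a b g \<longleftrightarrow> ?TP"
  proof
    \<comment> \<open>The chart only supplies coordinates on the Lie algebra in which to write down
      the momentum; any chart at the identity will do.\<close>
    obtain d where d: "d \<in> A" "\<one>\<^bsub>G\<^esub> \<in> chart_dom d" using cover[OF one_closed] by blast
    assume "hamilton_principle G A L a b g"
    from trivialized_hamilton_pontryagin_if_hamilton[OF this d] \<xi>0_smooth momentum_smooth[OF d]
    show ?TP unfolding field cofield by blast
  next
    assume ?TP
    then show "hamilton_principle G A L a b g"
      unfolding field cofield using hamilton_if_trivialized_hamilton_pontryagin by blast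
  qed
  have 34: "?HP \<longleftrightarrow> ?TP"
  proof
    assume ?HP
    then obtain v p where v: "smooth_field {a..b} g v" and p: "smooth_cofield {a..b} g p"
      and HP: "hamilton_pontryagin_principle G A L a b g v p"
      unfolding smooth_into_pontryagin_iff[OF thick_J] by blast
    from trivialized_if_hamilton_pontryagin[OF HP smooth_field_in[OF v] smooth_cofield_in[OF p]]
      smooth_field_left_triv[OF thick_J g_smooth v] smooth_cofield_left_act_dual[OF thick_J g_smooth p]
    show ?TP unfolding field cofield by blast
  next
    assume ?TP
    then obtain \<xi> \<mu> where \<xi>: "smooth_field {a..b} (\<lambda>_. \<one>\<^bsub>G\<^esub>) \<xi>" and \<mu>: "smooth_cofield {a..b} (\<lambda>_. \<one>\<^bsub>G\<^esub>) \<mu>"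
      and TP: "trivialized_hamilton_pontryagin_principle G A l a b g \<xi> \<mu>"
      unfolding field cofield by blast
    from hamilton_pontryagin_if_trivialized[OF TP smooth_field_in[OF \<xi>] smooth_cofield_in[OF \<mu>]]
      smooth_field_left_act[OF thick_J g_smooth \<xi>] smooth_cofield_left_triv_dual[OF thick_J g_smooth \<mu>] g_smooth
    show ?HP unfolding smooth_into_pontryagin_iff[OF thick_J] by blast
  qed
  from 12 14 34 show ?thesis by blast
qed

end
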